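(* Let $(M,J,g,\omega)$ be a compact almost Kähler $4$-manifold. Then $$\mathcal H^3_{d+d^c}=\mathcal H^3_{d+d^\Lambda}.$$
   Context: An almost Kähler manifold $(M,J,g,\omega)$ is a symplectic manifold $(M,\omega)$ with an $\omega$-compatible almost complex structure $J$ and associated Riemannian metric $g(\cdot,\cdot)=\omega(J\cdot,\cdot)$ (sign conventions such that $g$ is positive definite); it is oriented by $J$ (equivalently by the top power of $\omega$), and $*$ is the $\mathbb C$-linear Hodge operator. $A^k$ is the space of smooth complex $k$-forms; $J$ acts on forms by $J\alpha=i^{p-q}\alpha$ for $\alpha\in A^{p,q}$; $d^c:=J^{-1}dJ$. $L\alpha=\omega\wedge\alpha$, $\Lambda\colon A^k\to A^{k-2}$ is the dual Lefschetz operator (contraction by $\omega$, the pointwise adjoint of $L$), and $d^\Lambda:=d\Lambda-\Lambda d$. For an operator $P$ on forms put $P^*:=-*P*$; in particular $(dd^c)^*\alpha=0$ means $dd^c*\alpha=0$, and $(dd^\Lambda)^*\alpha=0$ means $dd^\Lambda*\alpha=0$. The spaces are $$\mathcal H^3_{d+d^c}=\{\alpha\in A^3:d\alpha=0,\ d^c\alpha=0,\ (dd^c)^*\alpha=0\},$$ $$\mathcal H^3_{d+d^\Lambda}=\{\alpha\in A^3:d\alpha=0,\ d^\Lambda\alpha=0,\ (dd^\Lambda)^*\alpha=0\}.$$ *)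

theory Defs
  imports "HOL-Analysis.Analysis"
begin

section \<open>Smooth maps on open subsets of normed spaces\<close>

primrec times_differentiable_on ::
  "nat \<Rightarrow> 'a::real_normed_vector set \<Rightarrow> ('a \<Rightarrow> 'b::real_normed_vector) \<Rightarrow> bool" where
  "times_differentiable_on 0 S f \<longleftrightarrow> continuous_on S f"
| "times_differentiable_on (Suc k) S f \<longleftrightarrow>
     (\<forall>x\<in>S. f differentiable (at x)) \<and>
     (\<forall>v. times_differentiable_on k S (\<lambda>x. frechet_derivative f (at x) v))"

definition smooth_on :: "'a::real_normed_vector set \<Rightarrow> ('a \<Rightarrow> 'b::real_normed_vector) \<Rightarrow> bool" where
  "smooth_on S f \<longleftrightarrow> (\<forall>k. times_differentiable_on k S f)"

section \<open>Smooth manifolds\<close>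

type_synonym ('a, 'n) chart = "'a set \<times> ('a \<Rightarrow> real^'n)"

abbreviation chart_range :: "('a, 'n::finite) chart \<Rightarrow> (real^'n) set" where
  "chart_range c \<equiv> snd c ` fst c"

abbreviation transition :: "('a, 'n::finite) chart \<Rightarrow> ('a, 'n) chart \<Rightarrow> real^'n \<Rightarrow> real^'n" where
  "transition c c' \<equiv> snd c' \<circ> inv_into (fst c) (snd c)"

abbreviation overlap :: "('a, 'n::finite) chart \<Rightarrow> ('a, 'n) chart \<Rightarrow> (real^'n) set" where
  "overlap c c' \<equiv> snd c ` (fst c \<inter> fst c')"

definition second_countable_space :: "'a topology \<Rightarrow> bool" where
  "second_countable_space X \<longleftrightarrow>
     (\<exists>\<B>. countable \<B> \<and> (\<forall>V\<in>\<B>. openin X V) \<and>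
          (\<forall>U x. openin X U \<and> x \<in> U \<longrightarrow> (\<exists>V\<in>\<B>. x \<in> V \<and> V \<subseteq> U)))"

text \<open>\<open>A\<close> is any smooth atlas; it need not be maximal.\<close>

definition smooth_manifold :: "'a topology \<Rightarrow> ('a, 'n::finite) chart set \<Rightarrow> bool" where
  "smooth_manifold X A \<longleftrightarrow>
     Hausdorff_space X \<and> second_countable_space X \<and>
     (\<Union>c\<in>A. fst c) = topspace X \<and>
     (\<forall>c\<in>A. openin X (fst c) \<and> open (chart_range c) \<and>
        homeomorphic_map (subtopology X (fst c)) (top_of_set (chart_range c)) (snd c)) \<and>
     (\<forall>c\<in>A. \<forall>c'\<in>A. smooth_on (overlap c c') (transition c c'))"

section \<open>Differential forms\<close>

text \<open>
  A multilinear form on \<open>\<real>\<^sup>n\<close> is a function on lists of vectors, and a \<open>k\<close>-form vanishes on all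
  lists whose length is not \<open>k\<close>.
\<close>

definition alternating_form :: "nat \<Rightarrow> ((real^'n) list \<Rightarrow> 'b::real_vector) \<Rightarrow> bool" where
  "alternating_form k f \<longleftrightarrow>
     (\<forall>vs. length vs \<noteq> k \<longrightarrow> f vs = 0) \<and>
     (\<forall>vs i. length vs = k \<and> i < k \<longrightarrow> linear (\<lambda>v. f (vs[i := v]))) \<and>
     (\<forall>vs i j. length vs = k \<and> i < j \<and> j < k \<and> vs ! i = vs ! j \<longrightarrow> f vs = 0)"

text \<open>
  A form \<open>\<alpha>\<close> on a manifold is the family of its coordinate expressions: \<open>\<alpha> c\<close> is the form
  \<open>(\<phi>\<^sup>-\<^sup>1)\<^sup>*\<alpha>\<close> on the range of the chart \<open>c = (U, \<phi>)\<close>, and on overlaps these expressions are related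
  by pullback along the transition map. Values at pairs \<open>(c, x)\<close> that do not represent a point
  of the manifold are normalised to \<open>0\<close>.
\<close>

type_synonym ('a, 'n, 'b) form = "('a, 'n) chart \<Rightarrow> real^'n \<Rightarrow> (real^'n) list \<Rightarrow> 'b"

definition smooth_form ::
  "('a, 'n::finite) chart set \<Rightarrow> nat \<Rightarrow> ('a, 'n, 'b::real_normed_vector) form \<Rightarrow> bool" where
  "smooth_form A k \<alpha> \<longleftrightarrow>
     (\<forall>c\<in>A. \<forall>x\<in>chart_range c. alternating_form k (\<alpha> c x)) \<and>
     (\<forall>c\<in>A. \<forall>vs. smooth_on (chart_range c) (\<lambda>x. \<alpha> c x vs)) \<and>
     (\<forall>c\<in>A. \<forall>c'\<in>A. \<forall>x\<in>overlap c c'. \<forall>vs.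
        \<alpha> c x vs =
        \<alpha> c' (transition c c' x) (map (frechet_derivative (transition c c') (at x)) vs)) \<and>
     (\<forall>c x vs. \<not> (c \<in> A \<and> x \<in> chart_range c) \<longrightarrow> \<alpha> c x vs = 0)"

definition form_zero :: "('a, 'n::finite) chart set \<Rightarrow> ('a, 'n, 'b::zero) form \<Rightarrow> bool" where
  "form_zero A \<alpha> \<longleftrightarrow> (\<forall>c\<in>A. \<forall>x\<in>chart_range c. \<forall>vs. \<alpha> c x vs = 0)"

text \<open>
  \<open>(d\<alpha>)(v\<^sub>0, \<dots>, v\<^sub>k) = \<Sum>\<^sub>i (-1)\<^sup>i D\<alpha>(v\<^sub>i)(v\<^sub>0, \<dots>, v\<^sub>i omitted, \<dots>, v\<^sub>k)\<close> for constant vector fields \<open>v\<^sub>i\<close>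
  on \<open>\<real>\<^sup>n\<close>.
\<close>

definition ext_d :: "('a, 'n::finite, 'b::real_normed_field) form \<Rightarrow> ('a, 'n, 'b) form" where
  "ext_d \<alpha> c x vs =
     (\<Sum>i<length vs. (-1) ^ i *
        frechet_derivative (\<lambda>y. \<alpha> c y (take i vs @ drop (Suc i) vs)) (at x) (vs ! i))"

section \<open>Almost Kaehler structures\<close>

definition almost_complex_structure ::
  "('a, 'n::finite) chart set \<Rightarrow> (('a, 'n) chart \<Rightarrow> real^'n \<Rightarrow> real^'n \<Rightarrow> real^'n) \<Rightarrow> bool" where
  "almost_complex_structure A J \<longleftrightarrow>
     (\<forall>c\<in>A. \<forall>x\<in>chart_range c. linear (J c x) \<and> (\<forall>v. J c x (J c x v) = - v)) \<and>
     (\<forall>c\<in>A. \<forall>v. smooth_on (chart_range c) (\<lambda>x. J c x v)) \<and>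
     (\<forall>c\<in>A. \<forall>c'\<in>A. \<forall>x\<in>overlap c c'. \<forall>v.
        frechet_derivative (transition c c') (at x) (J c x v) =
        J c' (transition c c' x) (frechet_derivative (transition c c') (at x) v))"

definition symplectic_form ::
  "('a, 'n::finite) chart set \<Rightarrow> ('a, 'n, real) form \<Rightarrow> bool" where
  "symplectic_form A \<omega> \<longleftrightarrow>
     smooth_form A 2 \<omega> \<and> form_zero A (ext_d \<omega>) \<and>
     (\<forall>c\<in>A. \<forall>x\<in>chart_range c. \<forall>u. (\<forall>v. \<omega> c x [u, v] = 0) \<longrightarrow> u = 0)"

text \<open>Pointwise, \<open>g(u, v) = \<omega>(Ju, v)\<close>.\<close>

definition metric ::
  "((real^'n) list \<Rightarrow> real) \<Rightarrow> (real^'n \<Rightarrow> real^'n) \<Rightarrow> real^'n \<Rightarrow> real^'n \<Rightarrow> real" where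
  "metric w j u v = w [j u, v]"

definition almost_kaehler ::
  "'a topology \<Rightarrow> ('a, 'n::finite) chart set \<Rightarrow>
   (('a, 'n) chart \<Rightarrow> real^'n \<Rightarrow> real^'n \<Rightarrow> real^'n) \<Rightarrow> ('a, 'n, real) form \<Rightarrow> bool" where
  "almost_kaehler X A J \<omega> \<longleftrightarrow>
     smooth_manifold X A \<and> almost_complex_structure A J \<and> symplectic_form A \<omega> \<and>
     (\<forall>c\<in>A. \<forall>x\<in>chart_range c.
        (\<forall>u v. \<omega> c x [J c x u, J c x v] = \<omega> c x [u, v]) \<and>
        (\<forall>u. u \<noteq> 0 \<longrightarrow> metric (\<omega> c x) (J c x) u u > 0))"

section \<open>Pointwise operators\<close>

text \<open>
  The part \<open>\<alpha>\<^sup>p\<^sup>,\<^sup>q\<close> of bidegree \<open>(p, q)\<close> of a complex-valued form: each argument \<open>v\<close> is split as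
  \<open>v = (v - \<i> Jv)/2 + (v + \<i> Jv)/2\<close> into its \<open>(1,0)\<close> and \<open>(0,1)\<close> components, the form is expanded
  complex-multilinearly, and the terms with exactly \<open>p\<close> arguments of type \<open>(1,0)\<close> and \<open>q\<close> of
  type \<open>(0,1)\<close> are kept.
\<close>

fun bidegree_part ::
  "(real^'n \<Rightarrow> real^'n) \<Rightarrow> nat \<Rightarrow> nat \<Rightarrow> ((real^'n) list \<Rightarrow> complex) \<Rightarrow> (real^'n) list \<Rightarrow> complex" where
  "bidegree_part j p q a [] = (if p = 0 \<and> q = 0 then a [] else 0)"
| "bidegree_part j p q a (v # vs) =
     (if p = 0 then 0 else
        (bidegree_part j (p - 1) q (\<lambda>ws. a (v # ws)) vs
         - \<i> * bidegree_part j (p - 1) q (\<lambda>ws. a (j v # ws)) vs) / 2) +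
     (if q = 0 then 0 else
        (bidegree_part j p (q - 1) (\<lambda>ws. a (v # ws)) vs
         + \<i> * bidegree_part j p (q - 1) (\<lambda>ws. a (j v # ws)) vs) / 2)"

text \<open>\<open>J\<close> multiplies the part of bidegree \<open>(p, q)\<close> by \<open>\<i>\<^sup>p\<^sup>-\<^sup>q\<close>, and \<open>J\<^sup>-\<^sup>1\<close> by \<open>\<i>\<^sup>q\<^sup>-\<^sup>p\<close>.\<close>

definition J_act ::
  "(real^'n \<Rightarrow> real^'n) \<Rightarrow> ((real^'n) list \<Rightarrow> complex) \<Rightarrow> (real^'n) list \<Rightarrow> complex" where
  "J_act j a vs =
     (\<Sum>(p, q) \<in> {(p, q). p + q = length vs}. \<i> powi (int p - int q) * bidegree_part j p q a vs)"

definition J_inv_act ::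
  "(real^'n \<Rightarrow> real^'n) \<Rightarrow> ((real^'n) list \<Rightarrow> complex) \<Rightarrow> (real^'n) list \<Rightarrow> complex" where
  "J_inv_act j a vs =
     (\<Sum>(p, q) \<in> {(p, q). p + q = length vs}. \<i> powi (int q - int p) * bidegree_part j p q a vs)"

text \<open>
  The frame \<open>e\<^sup>a = \<Sum>\<^sub>b g\<^sup>a\<^sup>b \<partial>\<^sub>b\<close>, characterised by \<open>g(e\<^sup>a, \<partial>\<^sub>b) = \<delta>\<^sup>a\<^sub>b\<close>, where \<open>\<partial>\<^sub>a = axis a 1\<close>.
\<close>

definition reciprocal_frame :: "(real^'n \<Rightarrow> real^'n \<Rightarrow> real) \<Rightarrow> 'n \<Rightarrow> real^'n" where
  "reciprocal_frame g a = matrix_inv (\<chi> i j. g (axis i 1) (axis j 1)) $ a"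

text \<open>
  Contraction with \<open>w\<close>, the indices being raised with \<open>g\<close>; this is the adjoint of
  \<open>\<alpha> \<mapsto> w \<and> \<alpha>\<close>, so that \<open>\<Lambda>\<omega> = n/2\<close> for an almost Kaehler form in real dimension \<open>n\<close>.
\<close>

definition contraction ::
  "(real^'n \<Rightarrow> real^'n \<Rightarrow> real) \<Rightarrow> ((real^'n) list \<Rightarrow> real) \<Rightarrow>
   ((real^'n) list \<Rightarrow> complex) \<Rightarrow> (real^'n) list \<Rightarrow> complex" where
  "contraction g w a vs =
     (\<Sum>i\<in>UNIV. \<Sum>j\<in>UNIV.
        of_real (w [reciprocal_frame g i, reciprocal_frame g j]) *
        a (axis i 1 # axis j 1 # vs)) / 2"

text \<open>
  The wedge product as a signed sum over shuffles: the arguments with positions in \<open>S\<close> go to \<open>a\<close>,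
  the remaining ones to \<open>b\<close>.
\<close>

definition wedge ::
  "((real^'n) list \<Rightarrow> 'b::comm_ring_1) \<Rightarrow> ((real^'n) list \<Rightarrow> 'b) \<Rightarrow> (real^'n) list \<Rightarrow> 'b" where
  "wedge a b vs =
     (\<Sum>S\<in>Pow {..<length vs}.
        (-1) ^ card {(i, j). i \<in> S \<and> j \<in> {..<length vs} - S \<and> j < i} *
        a (nths vs S) * b (nths vs (- S)))"

text \<open>
  The Riemannian volume form in dimension 4: up to sign, its value on \<open>v\<^sub>1, \<dots>, v\<^sub>4\<close> is the square
  root of the Gram determinant; the sign is that of \<open>w \<and> w\<close>, i.e. the orientation is the one
  given by the top power of the symplectic form.
\<close>

definition gram_det :: "(real^'n \<Rightarrow> real^'n \<Rightarrow> real) \<Rightarrow> (real^'n) list \<Rightarrow> real" where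
  "gram_det g vs =
     (\<Sum>p | p permutes {..<length vs}. of_int (sign p) * (\<Prod>i<length vs. g (vs ! i) (vs ! p i)))"

definition volume_form ::
  "(real^4 \<Rightarrow> real^4 \<Rightarrow> real) \<Rightarrow> ((real^4) list \<Rightarrow> real) \<Rightarrow> (real^4) list \<Rightarrow> real" where
  "volume_form g w vs = sgn (wedge w w vs) * sqrt (gram_det g vs)"

text \<open>
  The complex-linear Hodge operator, normalised by \<open>\<alpha> \<and> *\<beta> = \<langle>\<alpha>, \<beta>\<rangle> vol\<close> with \<open>\<langle>_, _\<rangle>\<close> complex
  bilinear. In coordinates, for \<open>\<alpha>\<close> of degree \<open>k\<close>,
  \<open>(*\<alpha>)(v\<^sub>1, \<dots>) = 1/k! \<Sum> \<alpha>(\<partial>\<^sub>i\<^sub>1, \<dots>, \<partial>\<^sub>i\<^sub>k) vol(e\<^sup>i\<^sup>1, \<dots>, e\<^sup>i\<^sup>k, v\<^sub>1, \<dots>)\<close>. The degree \<open>k\<close> is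
  read off from the number of arguments \<open>v\<^sub>i\<close>, as \<open>k = 4 - length vs\<close>; the value is \<open>0\<close> for more
  than four arguments, since the volume form vanishes there.
\<close>

definition hodge ::
  "(real^4 \<Rightarrow> real^4 \<Rightarrow> real) \<Rightarrow> ((real^4) list \<Rightarrow> real) \<Rightarrow>
   ((real^4) list \<Rightarrow> complex) \<Rightarrow> (real^4) list \<Rightarrow> complex" where
  "hodge g w a vs =
     (\<Sum>is | length is = 4 - length vs.
        a (map (\<lambda>i. axis i 1) is) *
        of_real (volume_form g w (map (reciprocal_frame g) is @ vs)))
     / fact (4 - length vs)"

section \<open>Operators on forms and the harmonic spaces\<close>

definition J_op ::
  "(('a, 'n::finite) chart \<Rightarrow> real^'n \<Rightarrow> real^'n \<Rightarrow> real^'n) \<Rightarrow>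
   ('a, 'n, complex) form \<Rightarrow> ('a, 'n, complex) form" where
  "J_op J \<alpha> c x = J_act (J c x) (\<alpha> c x)"

definition J_inv_op ::
  "(('a, 'n::finite) chart \<Rightarrow> real^'n \<Rightarrow> real^'n \<Rightarrow> real^'n) \<Rightarrow>
   ('a, 'n, complex) form \<Rightarrow> ('a, 'n, complex) form" where
  "J_inv_op J \<alpha> c x = J_inv_act (J c x) (\<alpha> c x)"

definition d_c ::
  "(('a, 'n::finite) chart \<Rightarrow> real^'n \<Rightarrow> real^'n \<Rightarrow> real^'n) \<Rightarrow>
   ('a, 'n, complex) form \<Rightarrow> ('a, 'n, complex) form" where
  "d_c J \<alpha> = J_inv_op J (ext_d (J_op J \<alpha>))"

definition dual_lefschetz ::
  "(('a, 'n::finite) chart \<Rightarrow> real^'n \<Rightarrow> real^'n \<Rightarrow> real^'n) \<Rightarrow> ('a, 'n, real) form \<Rightarrow>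
   ('a, 'n, complex) form \<Rightarrow> ('a, 'n, complex) form" where
  "dual_lefschetz J \<omega> \<alpha> c x = contraction (metric (\<omega> c x) (J c x)) (\<omega> c x) (\<alpha> c x)"

definition d_Lambda ::
  "(('a, 'n::finite) chart \<Rightarrow> real^'n \<Rightarrow> real^'n \<Rightarrow> real^'n) \<Rightarrow> ('a, 'n, real) form \<Rightarrow>
   ('a, 'n, complex) form \<Rightarrow> ('a, 'n, complex) form" where
  "d_Lambda J \<omega> \<alpha> c x vs =
     ext_d (dual_lefschetz J \<omega> \<alpha>) c x vs - dual_lefschetz J \<omega> (ext_d \<alpha>) c x vs"

definition star ::
  "(('a, 4) chart \<Rightarrow> real^4 \<Rightarrow> real^4 \<Rightarrow> real^4) \<Rightarrow> ('a, 4, real) form \<Rightarrow>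
   ('a, 4, complex) form \<Rightarrow> ('a, 4, complex) form" where
  "star J \<omega> \<alpha> c x = hodge (metric (\<omega> c x) (J c x)) (\<omega> c x) (\<alpha> c x)"

text \<open>\<open>P\<^sup>* = - * P *\<close>\<close>

definition star_adjoint ::
  "(('a, 4) chart \<Rightarrow> real^4 \<Rightarrow> real^4 \<Rightarrow> real^4) \<Rightarrow> ('a, 4, real) form \<Rightarrow>
   (('a, 4, complex) form \<Rightarrow> ('a, 4, complex) form) \<Rightarrow>
   ('a, 4, complex) form \<Rightarrow> ('a, 4, complex) form" where
  "star_adjoint J \<omega> P \<alpha> c x vs = - star J \<omega> (P (star J \<omega> \<alpha>)) c x vs"

definition harmonic_d_dc ::
  "('a, 4) chart set \<Rightarrow> (('a, 4) chart \<Rightarrow> real^4 \<Rightarrow> real^4 \<Rightarrow> real^4) \<Rightarrow>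
   ('a, 4, real) form \<Rightarrow> nat \<Rightarrow> ('a, 4, complex) form set" where
  "harmonic_d_dc A J \<omega> k =
     {\<alpha>. smooth_form A k \<alpha> \<and> form_zero A (ext_d \<alpha>) \<and> form_zero A (d_c J \<alpha>) \<and>
         form_zero A (star_adjoint J \<omega> (\<lambda>\<beta>. ext_d (d_c J \<beta>)) \<alpha>)}"

definition harmonic_d_dLambda ::
  "('a, 4) chart set \<Rightarrow> (('a, 4) chart \<Rightarrow> real^4 \<Rightarrow> real^4 \<Rightarrow> real^4) \<Rightarrow>
   ('a, 4, real) form \<Rightarrow> nat \<Rightarrow> ('a, 4, complex) form set" where
  "harmonic_d_dLambda A J \<omega> k =
     {\<alpha>. smooth_form A k \<alpha> \<and> form_zero A (ext_d \<alpha>) \<and> form_zero A (d_Lambda J \<omega> \<alpha>) \<and>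
         form_zero A (star_adjoint J \<omega> (\<lambda>\<beta>. ext_d (d_Lambda J \<omega> \<beta>)) \<alpha>)}"

end

theory Submission
  imports Defs
begin

text \<open>
  On an almost Kaehler four-manifold write a three-form as \<open>\<alpha> = \<iota>\<^sub>W vol\<close> (up to sign) and put
  \<open>\<beta> = \<omega>(W, _)\<close>, \<open>\<eta> = *\<alpha> = g(W, _)\<close>, so that \<open>\<Lambda>\<alpha> = -\<beta>\<close> and \<open>J\<eta> = \<beta>\<close>. Since \<open>\<omega>\<close> is closed,
  \<open>d\<alpha> = 0\<close> means \<open>\<Lambda>d\<beta> = 0\<close> and \<open>d\<^sup>c\<alpha> = 0\<close> means \<open>\<Lambda>d\<eta> = 0\<close>. Hence, for closed \<open>\<alpha>\<close>,
  the \<open>d + d\<^sup>c\<close> conditions are \<open>\<Lambda>d\<eta> = 0\<close> and \<open>d(J d\<beta>) = 0\<close>, while the \<open>d + d\<^sup>\<Lambda>\<close> conditions are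
  \<open>d\<beta> = 0\<close> and \<open>d(\<Lambda>d\<eta>) = 0\<close>.

  Both implications follow from Stokes' theorem in the form \<open>\<integral> H \<and> d\<theta> = 0\<close> for closed two-forms \<open>H\<close>.
  If \<open>\<Lambda>d\<beta> = 0\<close> and \<open>d(J d\<beta>) = 0\<close>, take \<open>H = J d\<beta>\<close> and \<open>\<theta>\<close> conjugate to \<open>\<beta>\<close>: on primitive two-forms
  \<open>J = -*\<close>, so the integrand is \<open>-|d\<beta>|\<^sup>2 vol\<close> and \<open>d\<beta> = 0\<close>. Conversely, if \<open>C = \<Lambda>d\<eta>\<close> is locally constant,
  take \<open>H\<close> to be \<open>\<omega>\<close> times the conjugate of \<open>C\<close> and \<open>\<theta> = \<eta>\<close>: the integrand is \<open>|C|\<^sup>2 vol\<close>, so \<open>C = 0\<close>.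
\<close>

section \<open>Differentiable maps\<close>

text \<open>Wedging with \<omega> identifies one-forms with three-forms in dimension four: up to
  sign \<alpha> is \<omega> \<and> \<beta> and J\<alpha> is \<omega> \<and> \<eta>, so closedness of
  either three-form only sees d\<beta> or d\<eta>. The equality J = -* on primitive two-forms is a
  matter of type: primitive (1,1)-forms are anti-self-dual and fixed by J, while forms of type (2,0)
  and (0,2) are self-dual and J acts on them by -1. Conjugates enter because the forms are complex
  and only a Hermitian square has a sign.

  The obstacle is Stokes' theorem for an atlas that need not be oriented. The three-form H \<and>
  \<theta> is encoded by a vector (\<open>cross\<close>) which, like the Pfaffian of \<omega>,
  acquires the determinant of a change of chart. Their quotient is a vector field, the absolute
  value of the Pfaffian is a density, and H \<and> d\<theta> becomes a divergence. What is then
  proved is that an everywhere nonnegative divergence on a compact manifold vanishes at each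
  point.\<close>

lemma frechet_derivative_eq:
  "(f has_derivative f') (at x) \<Longrightarrow> frechet_derivative f (at x) = f'"
  by (rule frechet_derivative_at[symmetric])

lemma frechet_derivative_cong_open:
  assumes "open S" "x \<in> S" "\<And>y. y \<in> S \<Longrightarrow> f y = g y"
  shows "frechet_derivative f (at x) = frechet_derivative g (at x)"
proof -
  have "(f has_derivative D) (at x) \<longleftrightarrow> (g has_derivative D) (at x)" for D
    using assms by (metis has_derivative_transform_within_open)
  then show ?thesis
    unfolding frechet_derivative_def by simp
qed

lemma differentiable_cong_open:
  assumes "open S" "x \<in> S" "\<And>y. y \<in> S \<Longrightarrow> f y = g y" "f differentiable (at x)"
  shows "g differentiable (at x)"
  using assms unfolding differentiable_def by (metis has_derivative_transform_within_open)

lemma times_differentiable_on_cong: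
  assumes "open S" "\<And>x. x \<in> S \<Longrightarrow> f x = g x" "times_differentiable_on k S f"
  shows "times_differentiable_on k S g"
  using assms(2,3)
proof (induction k arbitrary: f g)
  case 0
  then show ?case by (simp cong: continuous_on_cong)
next
  case (Suc k)
  have "frechet_derivative f (at x) = frechet_derivative g (at x)" if "x \<in> S" for x
    using frechet_derivative_cong_open[OF assms(1) that] Suc.prems by blast
  then have "times_differentiable_on k S (\<lambda>x. frechet_derivative g (at x) v)" for v
    using Suc.IH[of "\<lambda>x. frechet_derivative f (at x) v"] Suc.prems by simp
  then show ?case
    using Suc.prems differentiable_cong_open[OF assms(1)] by (auto; blast)
qed

lemma times_differentiable_on_Suc_D:
  "times_differentiable_on (Suc k) S f \<Longrightarrow> times_differentiable_on k S f"
proof (induction k arbitrary: f)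
  case 0
  then show ?case
    by (auto intro!: continuous_at_imp_continuous_on differentiable_imp_continuous_within)
next
  case (Suc k)
  have "times_differentiable_on k S (\<lambda>x. frechet_derivative f (at x) v)" for v
    using Suc.prems by (intro Suc.IH) simp
  then show ?case using Suc.prems by simp
qed

lemma times_differentiable_on_subset:
  "times_differentiable_on k S f \<Longrightarrow> T \<subseteq> S \<Longrightarrow> times_differentiable_on k T f"
  by (induction k arbitrary: f) (auto intro: continuous_on_subset)

lemma times_differentiable_on_Un:
  assumes "open S" "open T" "times_differentiable_on k S f" "times_differentiable_on k T f"
  shows "times_differentiable_on k (S \<union> T) f"
  using assms(3,4)
  by (induction k arbitrary: f) (auto intro!: continuous_on_open_Un assms)

lemma times_differentiable_on_has_derivative:
  assumes "times_differentiable_on (Suc k) S f" "x \<in> S"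
  shows "(f has_derivative frechet_derivative f (at x)) (at x)"
  using assms by (auto simp: frechet_derivative_works)

text \<open>\<open>frechet_derivative\<close> is a choice term; here it is enough to exhibit some
  derivative. The product, quotient and chain rules below go through this lemma.\<close>

lemma times_differentiable_on_SucI:
  assumes "open S" "\<And>x. x \<in> S \<Longrightarrow> (f has_derivative D x) (at x)"
    "\<And>v. times_differentiable_on k S (\<lambda>x. D x v)"
  shows "times_differentiable_on (Suc k) S f"
proof -
  have "times_differentiable_on k S (\<lambda>x. frechet_derivative f (at x) v)" for v
    by (rule times_differentiable_on_cong[OF assms(1) _ assms(3)[of v]])
      (simp add: frechet_derivative_eq[OF assms(2)])
  then show ?thesis
    using assms(2) by (auto simp: differentiable_def)
qed

lemma times_differentiable_on_const [simp]:
  "times_differentiable_on k S (\<lambda>x. c)"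
  by (induction k arbitrary: c) auto

lemma times_differentiable_on_add:
  assumes "open S" "times_differentiable_on k S f" "times_differentiable_on k S g"
  shows "times_differentiable_on k S (\<lambda>x. f x + g x)"
  using assms(2,3)
proof (induction k arbitrary: f g)
  case 0
  then show ?case by (auto intro: continuous_on_add)
next
  case (Suc k)
  show ?case
  proof (rule times_differentiable_on_SucI[OF assms(1)])
    show "((\<lambda>x. f x + g x) has_derivative
      (\<lambda>v. frechet_derivative f (at x) v + frechet_derivative g (at x) v)) (at x)" if "x \<in> S" for x
      using that Suc.prems by (intro has_derivative_add times_differentiable_on_has_derivative)
  qed (use Suc in auto)
qed

lemma times_differentiable_on_bounded_linear:
  assumes "open S" "times_differentiable_on k S f" "bounded_linear h"
  shows "times_differentiable_on k S (\<lambda>x. h (f x))"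
  using assms(2)
proof (induction k arbitrary: f)
  case 0
  then show ?case by (auto intro: bounded_linear.continuous_on[OF assms(3)])
next
  case (Suc k)
  show ?case
  proof (rule times_differentiable_on_SucI[OF assms(1)])
    show "((\<lambda>x. h (f x)) has_derivative (\<lambda>v. h (frechet_derivative f (at x) v))) (at x)"
      if "x \<in> S" for x
      using that Suc.prems
      by (intro bounded_linear.has_derivative[OF assms(3)] times_differentiable_on_has_derivative)
  qed (use Suc in auto)
qed

lemma times_differentiable_on_mult:
  fixes f g :: "'a::real_normed_vector \<Rightarrow> 'b::real_normed_algebra"
  assumes "open S" "times_differentiable_on k S f" "times_differentiable_on k S g"
  shows "times_differentiable_on k S (\<lambda>x. f x * g x)"
  using assms(2,3)
proof (induction k arbitrary: f g)
  case 0
  then show ?case by (auto intro: continuous_on_mult)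
next
  case (Suc k)
  show ?case
  proof (rule times_differentiable_on_SucI[OF assms(1)])
    show "((\<lambda>x. f x * g x) has_derivative
      (\<lambda>v. f x * frechet_derivative g (at x) v + frechet_derivative f (at x) v * g x)) (at x)"
      if "x \<in> S" for x
      using that Suc.prems by (intro has_derivative_mult times_differentiable_on_has_derivative)
  next
    fix v
    show "times_differentiable_on k S
      (\<lambda>x. f x * frechet_derivative g (at x) v + frechet_derivative f (at x) v * g x)"
      using Suc.prems times_differentiable_on_Suc_D[OF Suc.prems(1)]
        times_differentiable_on_Suc_D[OF Suc.prems(2)]
      by (intro times_differentiable_on_add Suc.IH assms) auto
  qed
qed

lemma times_differentiable_on_minus:
  assumes "open S" "times_differentiable_on k S f"
  shows "times_differentiable_on k S (\<lambda>x. - f x)"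
  by (rule times_differentiable_on_bounded_linear[OF assms bounded_linear_minus[OF bounded_linear_ident]])

lemma times_differentiable_on_diff:
  assumes "open S" "times_differentiable_on k S f" "times_differentiable_on k S g"
  shows "times_differentiable_on k S (\<lambda>x. f x - g x)"
  using times_differentiable_on_add[OF assms(1,2) times_differentiable_on_minus[OF assms(1,3)]]
  by simp

lemma times_differentiable_on_sum:
  assumes "open S" "\<And>i. i \<in> I \<Longrightarrow> times_differentiable_on k S (f i)"
  shows "times_differentiable_on k S (\<lambda>x. \<Sum>i\<in>I. f i x)"
  using assms(2)
  by (induction I rule: infinite_finite_induct) (auto intro!: times_differentiable_on_add assms(1))

lemma times_differentiable_on_inverse:
  fixes f :: "'a::real_normed_vector \<Rightarrow> 'b::real_normed_field"
  assumes "open S" "times_differentiable_on k S f" "\<And>x. x \<in> S \<Longrightarrow> f x \<noteq> 0"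
  shows "times_differentiable_on k S (\<lambda>x. inverse (f x))"
  using assms(2)
proof (induction k)
  case 0
  then show ?case using assms by (auto intro: continuous_on_inverse)
next
  case (Suc k)
  show ?case
  proof (rule times_differentiable_on_SucI[OF assms(1)])
    show "((\<lambda>x. inverse (f x)) has_derivative
      (\<lambda>v. - (inverse (f x) * frechet_derivative f (at x) v * inverse (f x)))) (at x)"
      if "x \<in> S" for x
      using that Suc.prems assms by (intro Deriv.has_derivative_inverse times_differentiable_on_has_derivative)
  next
    fix v
    show "times_differentiable_on k S
      (\<lambda>x. - (inverse (f x) * frechet_derivative f (at x) v * inverse (f x)))"
      using Suc.prems Suc.IH[OF times_differentiable_on_Suc_D[OF Suc.prems]]
      by (intro times_differentiable_on_minus times_differentiable_on_mult assms) auto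
  qed
qed

lemma times_differentiable_on_divide:
  fixes f g :: "'a::real_normed_vector \<Rightarrow> 'b::real_normed_field"
  assumes "open S" "times_differentiable_on k S f" "times_differentiable_on k S g"
    "\<And>x. x \<in> S \<Longrightarrow> g x \<noteq> 0"
  shows "times_differentiable_on k S (\<lambda>x. f x / g x)"
  unfolding divide_inverse
  by (intro times_differentiable_on_mult times_differentiable_on_inverse assms)

lemmas times_differentiable_on_of_real =
  times_differentiable_on_bounded_linear[OF _ _ bounded_linear_of_real]

lemma linear_euclidean_expand:
  fixes L :: "real^'n \<Rightarrow> 'b::real_vector"
  assumes "linear L"
  shows "L v = (\<Sum>i\<in>UNIV. (v $ i) *\<^sub>R L (axis i 1))"
proof -
  have "L v = L (\<Sum>i\<in>UNIV. (v $ i) *\<^sub>R axis i 1)"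
    by (simp add: basis_expansion flip: scalar_mult_eq_scaleR)
  then show ?thesis by (simp add: linear_sum[OF assms] linear_cmul[OF assms])
qed

lemma times_differentiable_on_compose:
  fixes T :: "'a::real_normed_vector \<Rightarrow> real^'n"
  assumes "open S" "open U" "times_differentiable_on 1 S T" "times_differentiable_on 1 U f" "T ` S \<subseteq> U"
  shows "times_differentiable_on 1 S (\<lambda>x. f (T x))"
    and "x \<in> S \<Longrightarrow> frechet_derivative (\<lambda>x. f (T x)) (at x) =
      (\<lambda>v. frechet_derivative f (at (T x)) (frechet_derivative T (at x) v))"
proof -
  have T: "(T has_derivative frechet_derivative T (at x)) (at x)" if "x \<in> S" for x
    using assms(3) that by (intro times_differentiable_on_has_derivative[of 0 S]) auto
  have f: "(f has_derivative frechet_derivative f (at (T x))) (at (T x))" if "x \<in> S" for x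
    using assms(4,5) that by (intro times_differentiable_on_has_derivative[of 0 U]) auto
  have fT: "((\<lambda>x. f (T x)) has_derivative
      (\<lambda>v. frechet_derivative f (at (T x)) (frechet_derivative T (at x) v))) (at x)" if "x \<in> S" for x
    using diff_chain_at[OF T f] that by (simp add: o_def)
  then show "x \<in> S \<Longrightarrow> frechet_derivative (\<lambda>x. f (T x)) (at x) =
      (\<lambda>v. frechet_derivative f (at (T x)) (frechet_derivative T (at x) v))"
    by (rule frechet_derivative_eq)
  have contT: "continuous_on S T"
    using times_differentiable_on_Suc_D[of 0 S T] assms(3) by simp
  \<comment> \<open>The class only controls derivatives in fixed directions, while here the
    direction moves with \<open>x\<close>. Expanding it in the standard basis leaves finitely many
    fixed directions.\<close>
  have "continuous_on S (\<lambda>x. frechet_derivative f (at (T x)) (frechet_derivative T (at x) v))" for v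
  proof -
    have "continuous_on S (\<lambda>x. frechet_derivative f (at (T x)) w)" for w
      using assms(4,5) by (intro continuous_on_compose2[OF _ contT, of U "\<lambda>y. frechet_derivative f (at y) w"]) auto
    moreover have "continuous_on S (\<lambda>x. frechet_derivative T (at x) v)"
      using assms(3) by simp
    ultimately have "continuous_on S (\<lambda>x. \<Sum>i\<in>UNIV. (frechet_derivative T (at x) v $ i) *\<^sub>R
        frechet_derivative f (at (T x)) (axis i 1))"
      by (intro continuous_on_sum continuous_on_scaleR continuous_on_component)
    moreover have "frechet_derivative f (at (T x)) (frechet_derivative T (at x) v) =
      (\<Sum>i\<in>UNIV. (frechet_derivative T (at x) v $ i) *\<^sub>R
        frechet_derivative f (at (T x)) (axis i 1))" if "x \<in> S" for x
      by (rule linear_euclidean_expand) (rule has_derivative_linear[OF f[OF that]])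
    ultimately show ?thesis by (simp cong: continuous_on_cong)
  qed
  then show "times_differentiable_on 1 S (\<lambda>x. f (T x))"
    unfolding One_nat_def by (intro times_differentiable_on_SucI[OF assms(1) fT]) auto
qed

section \<open>Alternating forms on a four-dimensional space\<close>

definition alt2 :: "(4 \<Rightarrow> 4 \<Rightarrow> 'a::comm_ring_1) \<Rightarrow> bool" where
  "alt2 X \<longleftrightarrow> (\<forall>a. X a a = 0) \<and> (\<forall>a b. X b a = - X a b)"

text \<open>In dimension 4, \<open>X \<and> Y = pf_pair X Y dx\<^sub>1 \<dots> dx\<^sub>4\<close> for two-forms with coefficients \<open>X\<close> and \<open>Y\<close>, and \<open>pf\<close> is
  the Pfaffian.\<close>

definition pf_pair :: "(4 \<Rightarrow> 4 \<Rightarrow> 'a::comm_ring_1) \<Rightarrow> (4 \<Rightarrow> 4 \<Rightarrow> 'a) \<Rightarrow> 'a" where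
  "pf_pair X Y = X 1 2 * Y 3 4 - X 1 3 * Y 2 4 + X 1 4 * Y 2 3
     + X 2 3 * Y 1 4 - X 2 4 * Y 1 3 + X 3 4 * Y 1 2"

definition pf :: "(4 \<Rightarrow> 4 \<Rightarrow> 'a::comm_ring_1) \<Rightarrow> 'a" where
  "pf X = X 1 2 * X 3 4 - X 1 3 * X 2 4 + X 1 4 * X 2 3"

text \<open>Laplace expansion along the first two rows, that is, \<open>pf_pair\<close> of the
  bivectors u \<and> v and w \<and> z.\<close>

definition det4 :: "(4 \<Rightarrow> 'a::comm_ring_1) \<Rightarrow> (4 \<Rightarrow> 'a) \<Rightarrow> (4 \<Rightarrow> 'a) \<Rightarrow> (4 \<Rightarrow> 'a) \<Rightarrow> 'a" where
  "det4 u v w z =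
     (u 1 * v 2 - u 2 * v 1) * (w 3 * z 4 - w 4 * z 3)
   - (u 1 * v 3 - u 3 * v 1) * (w 2 * z 4 - w 4 * z 2)
   + (u 1 * v 4 - u 4 * v 1) * (w 2 * z 3 - w 3 * z 2)
   + (u 2 * v 3 - u 3 * v 2) * (w 1 * z 4 - w 4 * z 1)
   - (u 2 * v 4 - u 4 * v 2) * (w 1 * z 3 - w 3 * z 1)
   + (u 3 * v 4 - u 4 * v 3) * (w 1 * z 2 - w 2 * z 1)"

text \<open>As matrices this is \<open>S^T X S\<close>; column \<open>a\<close> of \<open>S\<close>
  holds the components of the image of the \<open>a\<close>-th basis vector.\<close>

definition pullback2 :: "(4 \<Rightarrow> 4 \<Rightarrow> 'a::comm_ring_1) \<Rightarrow> (4 \<Rightarrow> 4 \<Rightarrow> 'a) \<Rightarrow> 4 \<Rightarrow> 4 \<Rightarrow> 'a" where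
  "pullback2 S X a b = (\<Sum>k\<in>UNIV. \<Sum>l\<in>UNIV. S k a * S l b * X k l)"

lemma det_4:
  "det (A::'a::comm_ring_1^4^4) = det4 (\<lambda>i. A $ 1 $ i) (\<lambda>i. A $ 2 $ i) (\<lambda>i. A $ 3 $ i) (\<lambda>i. A $ 4 $ i)"
proof -
  have f1234: "finite {2::4, 3, 4}" "1 \<notin> {2::4, 3, 4}" by auto
  have f234: "finite {3::4, 4}" "2 \<notin> {3::4, 4}" by auto
  have f34: "finite {4::4}" "3 \<notin> {4::4}" by auto
  show ?thesis
    unfolding det_def UNIV_4
    unfolding sum_over_permutations_insert[OF f1234]
    unfolding sum_over_permutations_insert[OF f234]
    unfolding sum_over_permutations_insert[OF f34]
    unfolding permutes_sing
    by (simp add: sign_swap_id permutation_swap_id sign_compose permutation_compose sign_id swap_id_eq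
        det4_def algebra_simps)
qed

lemma alt2_components:
  assumes "alt2 X"
  shows "X 1 1 = 0" "X 2 2 = 0" "X 3 3 = 0" "X 4 4 = 0" "X 2 1 = - X 1 2" "X 3 1 = - X 1 3"
    "X 4 1 = - X 1 4" "X 3 2 = - X 2 3" "X 4 2 = - X 2 4" "X 4 3 = - X 3 4"
  using assms unfolding alt2_def by blast+

lemma pullback2_alt:
  assumes "alt2 X"
  shows "pullback2 S X a b =
      X 1 2 * (S 1 a * S 2 b - S 2 a * S 1 b) + X 1 3 * (S 1 a * S 3 b - S 3 a * S 1 b)
    + X 1 4 * (S 1 a * S 4 b - S 4 a * S 1 b) + X 2 3 * (S 2 a * S 3 b - S 3 a * S 2 b)
    + X 2 4 * (S 2 a * S 4 b - S 4 a * S 2 b) + X 3 4 * (S 3 a * S 4 b - S 4 a * S 3 b)"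
  unfolding pullback2_def sum_4 by (simp add: alt2_components[OF assms] algebra_simps)

lemma det4_repeated:
  "det4 u u w z = 0" "det4 u v u z = 0" "det4 u v w u = 0"
  "det4 u v v z = 0" "det4 u v w v = 0" "det4 u v w w = 0"
  unfolding det4_def by (simp_all add: algebra_simps)

text \<open>Both pulled-back forms are combinations of two-by-two minors of \<open>S\<close>, so
  their pairing is the sum of \<open>X k l * Y m n\<close> times the determinant of the rows
  \<open>k\<close>, \<open>l\<close>, \<open>m\<close>, \<open>n\<close>. A repeated row gives zero;
  only complementary pairs of indices survive, with the signs of \<open>pf_pair\<close>.\<close>

lemma pf_pair_pullback2:
  assumes "alt2 X" "alt2 Y"
  shows "pf_pair (pullback2 S X) (pullback2 S Y) = det4 (S 1) (S 2) (S 3) (S 4) * pf_pair X Y"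
proof -
  define M where "M a b k l = S k a * S l b - S l a * S k b" for a b k l
  define D where "D k l m n = det4 (S k) (S l) (S m) (S n)" for k l m n
  have D: "D k l m n = M 1 2 k l * M 3 4 m n - M 1 3 k l * M 2 4 m n + M 1 4 k l * M 2 3 m n
      + M 2 3 k l * M 1 4 m n - M 2 4 k l * M 1 3 m n + M 3 4 k l * M 1 2 m n" for k l m n
    by (simp add: D_def M_def det4_def mult.commute)
  \<comment> \<open>\<open>E k l\<close> is the coefficient of \<open>Y k l\<close> in the expanded
    pairing.\<close>
  define E where "E k l = (X 1 2 * D 1 2 k l + X 1 3 * D 1 3 k l + X 1 4 * D 1 4 k l
      + X 2 3 * D 2 3 k l + X 2 4 * D 2 4 k l + X 3 4 * D 3 4 k l)" for k l
  have "pf_pair (pullback2 S X) (pullback2 S Y) =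
      Y 1 2 * E 1 2 + Y 1 3 * E 1 3 + Y 1 4 * E 1 4 + Y 2 3 * E 2 3 + Y 2 4 * E 2 4 + Y 3 4 * E 3 4"
    unfolding pf_pair_def pullback2_alt[OF assms(1)] pullback2_alt[OF assms(2)] M_def[symmetric] E_def D
    by (simp add: algebra_simps)
  moreover have
    "E 1 2 = X 3 4 * D 3 4 1 2" "E 1 3 = X 2 4 * D 2 4 1 3" "E 1 4 = X 2 3 * D 2 3 1 4"
    "E 2 3 = X 1 4 * D 1 4 2 3" "E 2 4 = X 1 3 * D 1 3 2 4" "E 3 4 = X 1 2 * D 1 2 3 4"
    unfolding E_def D_def by (simp_all add: det4_repeated)
  moreover have "D 3 4 1 2 = D 1 2 3 4" "D 2 4 1 3 = - D 1 2 3 4" "D 2 3 1 4 = D 1 2 3 4"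
    "D 1 4 2 3 = D 1 2 3 4" "D 1 3 2 4 = - D 1 2 3 4"
    unfolding D_def det4_def by (simp_all add: algebra_simps)
  ultimately show ?thesis
    by (simp add: D_def pf_pair_def algebra_simps)
qed

lemma pf_pair_self: "pf_pair X X = 2 * pf X"
  by (simp add: pf_pair_def pf_def algebra_simps)

text \<open>Pairing \<open>X\<close> with itself gives twice the Pfaffian; characteristic zero
  allows the 2 to be cancelled.\<close>

lemma pf_pullback2:
  assumes "alt2 (X :: 4 \<Rightarrow> 4 \<Rightarrow> 'a::{idom,ring_char_0})"
  shows "pf (pullback2 S X) = det4 (S 1) (S 2) (S 3) (S 4) * pf X"
  using pf_pair_pullback2[OF assms assms, of S] by (simp add: pf_pair_self)

lemma det4_transpose:
  "det4 (\<lambda>a. S a 1) (\<lambda>a. S a 2) (\<lambda>a. S a 3) (\<lambda>a. S a 4) = det4 (S 1) (S 2) (S 3) (S 4)"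
  unfolding det4_def by (simp add: algebra_simps)

definition alt3 :: "(4 \<Rightarrow> 4 \<Rightarrow> 4 \<Rightarrow> 'a::comm_ring_1) \<Rightarrow> bool" where
  "alt3 N \<longleftrightarrow> (\<forall>a b. N a a b = 0 \<and> N a b a = 0 \<and> N b a a = 0) \<and>
     (\<forall>a b c. N b a c = - N a b c \<and> N a c b = - N a b c)"

text \<open>A three-form with coefficients \<open>N\<close> is \<open>det4 _ _ _ (vec3 N)\<close> (lemma \<open>alt3_sum_eq_det4\<close>), and \<open>cross X b\<close> is the
  vector that represents \<open>X \<and> b\<close> in this way.\<close>

definition vec3 :: "(4 \<Rightarrow> 4 \<Rightarrow> 4 \<Rightarrow> 'a::comm_ring_1) \<Rightarrow> 4 \<Rightarrow> 'a" where
  "vec3 N l = (if l = 1 then - N 2 3 4 else if l = 2 then N 1 3 4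
     else if l = 3 then - N 1 2 4 else N 1 2 3)"

definition cross :: "(4 \<Rightarrow> 4 \<Rightarrow> 'a::comm_ring_1) \<Rightarrow> (4 \<Rightarrow> 'a) \<Rightarrow> 4 \<Rightarrow> 'a" where
  "cross X b l =
     (if l = 1 then X 3 4 * b 2 - X 2 4 * b 3 + X 2 3 * b 4
      else if l = 2 then - X 3 4 * b 1 + X 1 4 * b 3 - X 1 3 * b 4
      else if l = 3 then X 2 4 * b 1 - X 1 4 * b 2 + X 1 2 * b 4
      else - X 2 3 * b 1 + X 1 3 * b 2 - X 1 2 * b 3)"

lemma alt3_components:
  assumes "alt3 N"
  shows "N a a b = 0" "N a b a = 0" "N b a a = 0"
    "N 1 3 2 = - N 1 2 3" "N 2 1 3 = - N 1 2 3" "N 2 3 1 = N 1 2 3" "N 3 1 2 = N 1 2 3" "N 3 2 1 = - N 1 2 3"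
    "N 1 4 2 = - N 1 2 4" "N 2 1 4 = - N 1 2 4" "N 2 4 1 = N 1 2 4" "N 4 1 2 = N 1 2 4" "N 4 2 1 = - N 1 2 4"
    "N 1 4 3 = - N 1 3 4" "N 3 1 4 = - N 1 3 4" "N 3 4 1 = N 1 3 4" "N 4 1 3 = N 1 3 4" "N 4 3 1 = - N 1 3 4"
    "N 2 4 3 = - N 2 3 4" "N 3 2 4 = - N 2 3 4" "N 3 4 2 = N 2 3 4" "N 4 2 3 = N 2 3 4" "N 4 3 2 = - N 2 3 4"
  using assms unfolding alt3_def by (metis add.inverse_inverse)+

lemma alt3_sum_eq_det4:
  assumes "alt3 N"
  shows "(\<Sum>a\<in>UNIV. \<Sum>b\<in>UNIV. \<Sum>c\<in>UNIV. u a * v b * w c * N a b c) = det4 u v w (vec3 N)"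
  unfolding sum_4 det4_def vec3_def by (simp add: alt3_components[OF assms] algebra_simps)

lemma alt3_double_sum:
  assumes "alt3 N" "alt3 M"
  shows "(\<Sum>a\<in>UNIV. \<Sum>b\<in>UNIV. \<Sum>c\<in>UNIV. N a b c * M a b c) = 6 * (\<Sum>l\<in>UNIV. vec3 N l * vec3 M l)"
  unfolding sum_4 vec3_def by (simp add: alt3_components[OF assms(1)] alt3_components[OF assms(2)] algebra_simps)

text \<open>Cramer's rule for expanding \<open>v\<close> in the rows of \<open>S\<close>: moving
  \<open>v\<close> from the last slot to slot \<open>l\<close> costs exactly the sign built into
  \<open>vec3\<close>.\<close>

lemma cramer_vec3:
  "(\<Sum>l\<in>UNIV. S l m * vec3 (\<lambda>a b c. det4 (S a) (S b) (S c) v) l)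
    = det4 (S 1) (S 2) (S 3) (S 4) * v m"
proof -
  have "\<forall>m. (\<Sum>l\<in>UNIV. S l m * vec3 (\<lambda>a b c. det4 (S a) (S b) (S c) v) l)
    = det4 (S 1) (S 2) (S 3) (S 4) * v m"
    unfolding forall_4 sum_4 vec3_def det4_def by (simp add: algebra_simps)
  then show ?thesis by blast
qed

lemma alt3_det4: "alt3 (\<lambda>a b c. det4 (S a) (S b) (S c) v)"
  unfolding alt3_def det4_def by (simp add: algebra_simps)

text \<open>Contracting X \<and> X with W gives twice X(W, _) \<and> X, and X \<and> X is twice the
  Pfaffian. This is the isomorphism between vectors and three-forms on which the passage to
  one-forms rests.\<close>

lemma cross_interior:
  assumes "alt2 X"
  shows "cross X (\<lambda>m. \<Sum>k\<in>UNIV. W k * X k m) a = pf X * W a"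
proof -
  have "\<forall>a. cross X (\<lambda>m. \<Sum>k\<in>UNIV. W k * X k m) a = pf X * W a"
    unfolding forall_4 sum_4 cross_def pf_def by (simp add: alt2_components[OF assms] algebra_simps)
  then show ?thesis by blast
qed

text \<open>Testing \<open>cross X b\<close> against a covector \<open>s\<close> amounts to wedging
  with \<open>s\<close>. This reduces the transformation law of \<open>cross\<close> to that of
  \<open>pf_pair\<close>.\<close>

lemma cross_pair:
  "(\<Sum>a\<in>UNIV. s a * cross X b a) = pf_pair X (\<lambda>i j. s i * b j - s j * b i)"
  unfolding sum_4 cross_def pf_pair_def by (simp add: algebra_simps)

text \<open>X \<and> N has degree five and vanishes. Contracting it with the \<open>l\<close>-th
  basis vector trades the contraction of N for that of X. This is the coordinate form of
  \<Lambda>\<alpha> = -\<beta>.\<close>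

lemma pf_pair_alt3:
  assumes "alt2 X" "alt3 N"
  shows "pf_pair X (\<lambda>i j. N i j l) = - (\<Sum>k\<in>UNIV. vec3 N k * X k l)"
proof -
  have "\<forall>l. pf_pair X (\<lambda>i j. N i j l) = - (\<Sum>k\<in>UNIV. vec3 N k * X k l)"
    unfolding forall_4 sum_4 vec3_def pf_pair_def
    by (simp add: alt2_components[OF assms(1)] alt3_components[OF assms(2)] algebra_simps)
  then show ?thesis by blast
qed

section \<open>The action of J, freed from the bidegree decomposition\<close>

lemma bidegree_sum:
  fixes z :: complex
  assumes "z * z = -1"
  shows "(\<Sum>(p, q) \<in> {(p, q). p + q = length vs}. z powi (int p - int q) * bidegree_part j p q a vs)
    = (- \<i> * z) ^ length vs * a (map j vs)"
proof -
  have z0: "z \<noteq> 0" using assms by auto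
  have zi: "inverse z = - z" using assms by (metis inverse_unique minus_mult_right minus_minus)
  have conv: "(\<Sum>(p, q) \<in> {(p, q). p + q = n}. f p q) = (\<Sum>p\<le>n. f p (n - p))"
    for n and f :: "nat \<Rightarrow> nat \<Rightarrow> complex"
    by (rule sum.reindex_bij_witness[of _ "\<lambda>p. (p, n - p)" fst]) auto
  have "(\<Sum>p\<le>length vs. z powi (int p - int (length vs - p)) * bidegree_part j p (length vs - p) a vs)
    = (- \<i> * z) ^ length vs * a (map j vs)"
  proof (induction vs arbitrary: a)
    case Nil
    then show ?case by simp
  next
    case (Cons v vs)
    have t1: "z powi (1 + k) * ((x - \<i> * y) / 2) = z / 2 * (z powi k * x) - z * \<i> / 2 * (z powi k * y)"
      for k x y
      using z0 by (simp add: power_int_add field_simps)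
    have t2: "z powi (k - 1) * ((x + \<i> * y) / 2) =
        inverse z / 2 * (z powi k * x) + inverse z * \<i> / 2 * (z powi k * y)" for k x y
      using z0 by (simp add: power_int_diff field_simps)
    let ?n = "length vs"
    let ?B = "\<lambda>u p q. bidegree_part j p q (\<lambda>ws. a (u # ws)) vs"
    let ?S = "\<lambda>u. \<Sum>p\<le>?n. z powi (int p - int (?n - p)) * ?B u p (?n - p)"
    have "(\<Sum>p\<le>Suc ?n. z powi (int p - int (Suc ?n - p)) * bidegree_part j p (Suc ?n - p) a (v # vs))
      = (\<Sum>p\<le>Suc ?n. z powi (int p - int (Suc ?n - p)) *
           (if p = 0 then 0 else (?B v (p - 1) (Suc ?n - p) - \<i> * ?B (j v) (p - 1) (Suc ?n - p)) / 2))
      + (\<Sum>p\<le>Suc ?n. z powi (int p - int (Suc ?n - p)) *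
           (if Suc ?n - p = 0 then 0 else (?B v p (Suc ?n - p - 1) + \<i> * ?B (j v) p (Suc ?n - p - 1)) / 2))"
      by (simp add: distrib_left sum.distrib del: sum.atMost_Suc)
    also have "(\<Sum>p\<le>Suc ?n. z powi (int p - int (Suc ?n - p)) *
           (if p = 0 then 0 else (?B v (p - 1) (Suc ?n - p) - \<i> * ?B (j v) (p - 1) (Suc ?n - p)) / 2))
       = (\<Sum>p\<le>?n. z powi (1 + (int p - int (?n - p))) * ((?B v p (?n - p) - \<i> * ?B (j v) p (?n - p)) / 2))"
      by (subst sum.atMost_Suc_shift) (simp add: algebra_simps)
    also have "\<dots> = z * (?S v - \<i> * ?S (j v)) / 2"
      unfolding t1 sum_subtractf sum_distrib_left[symmetric] by (simp add: algebra_simps diff_divide_distrib)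
    also have "(\<Sum>p\<le>Suc ?n. z powi (int p - int (Suc ?n - p)) *
           (if Suc ?n - p = 0 then 0 else (?B v p (Suc ?n - p - 1) + \<i> * ?B (j v) p (Suc ?n - p - 1)) / 2))
       = (\<Sum>p\<le>?n. z powi ((int p - int (?n - p)) - 1) * ((?B v p (?n - p) + \<i> * ?B (j v) p (?n - p)) / 2))"
      by (subst sum.atMost_Suc) (auto intro!: sum.cong simp: Suc_diff_le algebra_simps)
    also have "\<dots> = inverse z * (?S v + \<i> * ?S (j v)) / 2"
      unfolding t2 sum.distrib sum_distrib_left[symmetric] by (simp add: algebra_simps add_divide_distrib)
    \<comment> \<open>One argument \<open>v\<close> contributes z (v - \<i> Jv) / 2 + inverse z (v +
      \<i> Jv) / 2. Since \<open>inverse z = - z\<close>, the terms in \<open>v\<close> cancel and -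
      \<i> z Jv remains. The value of \<open>z\<close> is \<i> for \<open>J_act\<close> and - \<i>
      for \<open>J_inv_act\<close>.\<close>
    also have "z * (?S v - \<i> * ?S (j v)) / 2 + inverse z * (?S v + \<i> * ?S (j v)) / 2 =
        (- \<i> * z) ^ Suc ?n * a (map j (v # vs))"
      unfolding Cons.IH zi by (simp add: field_simps)
    finally show ?case
      by (simp del: sum.atMost_Suc bidegree_part.simps)
  qed
  then show ?thesis by (simp add: conv)
qed

lemma J_act_eq: "J_act j a vs = a (map j vs)"
  unfolding J_act_def by (subst bidegree_sum) auto

text \<open>For z = - \<i> each argument contributes -Jv, in accordance with -J being the inverse of
  J on vectors.\<close>

lemma J_inv_act_eq: "J_inv_act j a vs = (- 1) ^ length vs * a (map j vs)"
proof -
  have "\<i> powi (int q - int p) = (- \<i>) powi (int p - int q)" for p q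
    by (metis inverse_i minus_diff_eq power_int_inverse power_int_minus)
  then show ?thesis
    unfolding J_inv_act_def by (simp only: bidegree_sum[of "- \<i>"]) (simp add: bidegree_sum)
qed

section \<open>Coefficients of alternating forms\<close>

definition coef2 :: "((real^4) list \<Rightarrow> 'b) \<Rightarrow> 4 \<Rightarrow> 4 \<Rightarrow> 'b" where
  "coef2 f a b = f [axis a 1, axis b 1]"

definition coef3 :: "((real^4) list \<Rightarrow> 'b) \<Rightarrow> 4 \<Rightarrow> 4 \<Rightarrow> 4 \<Rightarrow> 'b" where
  "coef3 f a b c = f [axis a 1, axis b 1, axis c 1]"

lemma alternating_form_2D:
  assumes "alternating_form 2 f"
  shows "linear (\<lambda>u. f [u, v])" "linear (\<lambda>v. f [u, v])" "f [u, u] = 0" "f [v, u] = - f [u, v]"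
proof -
  show l1: "linear (\<lambda>u. f [u, v])" for v
    using assms unfolding alternating_form_def by (auto dest!: spec[of _ "[v, v]"] spec[of _ "0::nat"])
  show l2: "linear (\<lambda>v. f [u, v])" for u
    using assms unfolding alternating_form_def by (auto dest!: spec[of _ "[u, u]"] spec[of _ "1::nat"])
  have z: "f [u, u] = 0" for u
  proof -
    have "\<And>vs i j. length vs = 2 \<and> i < j \<and> j < 2 \<and> vs ! i = vs ! j \<Longrightarrow> f vs = 0"
      using assms unfolding alternating_form_def by blast
    from this[of "[u, u]" 0 1] show ?thesis by simp
  qed
  show "f [u, u] = 0" by (rule z)
  have "f [u + v, u + v] = (f [u, u] + f [u, v]) + (f [v, u] + f [v, v])"
    by (simp add: linear_add[OF l1] linear_add[OF l2])
  then show "f [v, u] = - f [u, v]" by (simp add: z add_eq_0_iff)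
qed

lemma alternating_form_3D:
  assumes "alternating_form 3 f"
  shows "linear (\<lambda>u. f [u, v, w])" "linear (\<lambda>v. f [u, v, w])" "linear (\<lambda>w. f [u, v, w])"
    "f [u, u, w] = 0" "f [u, w, u] = 0" "f [w, u, u] = 0"
    "f [v, u, w] = - f [u, v, w]" "f [u, w, v] = - f [u, v, w]"
proof -
  have l: "\<And>vs i. length vs = 3 \<and> i < 3 \<Longrightarrow> linear (\<lambda>v. f (vs[i := v]))"
    using assms unfolding alternating_form_def by blast
  show l1: "linear (\<lambda>u. f [u, v, w])" for v w
    using l[of "[v, v, w]" 0] by simp
  show l2: "linear (\<lambda>v. f [u, v, w])" for u w
    using l[of "[u, u, w]" 1] by simp
  show l3: "linear (\<lambda>w. f [u, v, w])" for u v
    using l[of "[u, v, v]" 2] by simp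
  have z: "\<And>vs i j. length vs = 3 \<and> i < j \<and> j < 3 \<and> vs ! i = vs ! j \<Longrightarrow> f vs = 0"
    using assms unfolding alternating_form_def by blast
  show z1: "f [u, u, w] = 0" for u w using z[of "[u, u, w]" 0 1] by simp
  show z2: "f [u, w, u] = 0" for u w using z[of "[u, w, u]" 0 2] by simp
  show z3: "f [w, u, u] = 0" for u w using z[of "[w, u, u]" 1 2] by simp
  have "f [u + v, u + v, w] = (f [u, u, w] + f [u, v, w]) + (f [v, u, w] + f [v, v, w])"
    by (simp add: linear_add[OF l1] linear_add[OF l2])
  then show "f [v, u, w] = - f [u, v, w]" by (simp add: z1 add_eq_0_iff)
  have "f [u, v + w, v + w] = (f [u, v, v] + f [u, v, w]) + (f [u, w, v] + f [u, w, w])"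
    by (simp add: linear_add[OF l2] linear_add[OF l3])
  then show "f [u, w, v] = - f [u, v, w]" by (simp add: z3 add_eq_0_iff)
qed

lemma alt2_coef2:
  fixes f :: "(real^4) list \<Rightarrow> 'b::{real_vector,comm_ring_1}"
  assumes "alternating_form 2 f"
  shows "alt2 (coef2 f)"
  unfolding alt2_def coef2_def by (intro conjI allI alternating_form_2D(3,4)[OF assms])

lemma alt3_coef3:
  fixes f :: "(real^4) list \<Rightarrow> 'b::{real_vector,comm_ring_1}"
  assumes "alternating_form 3 f"
  shows "alt3 (coef3 f)"
  unfolding alt3_def coef3_def by (intro conjI allI alternating_form_3D(4-)[OF assms])

lemma linear_expand_of_real:
  fixes L :: "real^'n \<Rightarrow> 'b::real_algebra_1"
  assumes "linear L"
  shows "L v = (\<Sum>i\<in>UNIV. of_real (v $ i) * L (axis i 1))"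
  using linear_euclidean_expand[OF assms, of v] by (simp add: scaleR_conv_of_real)

lemma bilinear_expand:
  fixes f :: "real^'n \<Rightarrow> real^'n \<Rightarrow> 'b::real_algebra_1"
  assumes "\<And>v. linear (\<lambda>u. f u v)" "\<And>u. linear (\<lambda>v. f u v)"
  shows "f u v = (\<Sum>a\<in>UNIV. \<Sum>b\<in>UNIV. of_real (u $ a) * of_real (v $ b) * f (axis a 1) (axis b 1))"
proof -
  have "f (axis a 1) v = (\<Sum>b\<in>UNIV. of_real (v $ b) * f (axis a 1) (axis b 1))" for a
    by (rule linear_expand_of_real[OF assms(2)])
  then show ?thesis
    using linear_expand_of_real[OF assms(1), of u v] by (simp add: sum_distrib_left mult.assoc)
qed

text \<open>It is applied both to the images of basis vectors under a linear map and to the vectors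
  of a frame; either way it makes the Pfaffian identities available for values of
  \<open>f\<close>.\<close>

lemma pullback2_coef2:
  fixes f :: "(real^4) list \<Rightarrow> 'b::{real_algebra_1,comm_ring_1}"
  assumes "alternating_form 2 f"
  shows "pullback2 (\<lambda>k a. of_real (v a $ k)) (coef2 f) = (\<lambda>a b. f [v a, v b])"
  unfolding pullback2_def coef2_def
  by (intro ext bilinear_expand[of "\<lambda>u v. f [u, v]", OF alternating_form_2D(1,2)[OF assms], symmetric])

lemma alternating_form_3_det4:
  fixes f :: "(real^4) list \<Rightarrow> 'b::{real_algebra_1,comm_ring_1}"
  assumes "alternating_form 3 f"
  shows "f [u, v, w] =
    det4 (\<lambda>i. of_real (u $ i)) (\<lambda>i. of_real (v $ i)) (\<lambda>i. of_real (w $ i)) (vec3 (coef3 f))"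
proof -
  note l = alternating_form_3D(1-3)[OF assms]
  have "f [u, v, w] = (\<Sum>a\<in>UNIV. \<Sum>b\<in>UNIV. \<Sum>c\<in>UNIV.
      of_real (u $ a) * of_real (v $ b) * of_real (w $ c) * coef3 f a b c)"
  proof -
    have "f [u, v, w] = (\<Sum>a\<in>UNIV. of_real (u $ a) * f [axis a 1, v, w])"
      by (rule linear_expand_of_real[OF l(1)])
    moreover have "f [axis a 1, v, w] = (\<Sum>b\<in>UNIV. of_real (v $ b) * f [axis a 1, axis b 1, w])" for a
      by (rule linear_expand_of_real[OF l(2)])
    moreover have "f [axis a 1, axis b 1, w] = (\<Sum>c\<in>UNIV. of_real (w $ c) * coef3 f a b c)" for a b
      unfolding coef3_def by (rule linear_expand_of_real[OF l(3)])
    ultimately show ?thesis by (simp add: sum_distrib_left mult.assoc)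
  qed
  then show ?thesis by (simp add: alt3_sum_eq_det4[OF alt3_coef3[OF assms]])
qed

text \<open>A three-form is a vector times a density: this is \<open>cramer_vec3\<close> with the
  images of the basis vectors under \<open>T\<close> as rows. It is applied to transition maps and
  to J itself.\<close>

lemma vec3_pullback:
  fixes f :: "(real^4) list \<Rightarrow> 'b::{real_algebra_1,comm_ring_1}"
  assumes "alternating_form 3 f" "linear T" "\<And>u v w. f' [u, v, w] = f [T u, T v, T w]"
  shows "(\<Sum>l\<in>UNIV. of_real (T (axis l 1) $ m) * vec3 (coef3 f') l) =
    of_real (det (matrix T)) * vec3 (coef3 f) m"
proof -
  define S where "S l m = (of_real (T (axis l 1) $ m) :: 'b)" for l m
  have "coef3 f' = (\<lambda>a b c. det4 (S a) (S b) (S c) (vec3 (coef3 f)))"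
    unfolding fun_eq_iff coef3_def[of f'] assms(3) alternating_form_3_det4[OF assms(1)] S_def by simp
  moreover have "of_real (det (matrix T)) = det4 (S 1) (S 2) (S 3) (S 4)"
  proof -
    have "det (matrix T) = det (transpose (matrix T))" by simp
    also have "\<dots> = det4 (\<lambda>m. T (axis 1 1) $ m) (\<lambda>m. T (axis 2 1) $ m) (\<lambda>m. T (axis 3 1) $ m) (\<lambda>m. T (axis 4 1) $ m)"
      by (simp only: det_4) (simp add: transpose_def matrix_def)
    finally show ?thesis by (simp add: det4_def S_def)
  qed
  ultimately show ?thesis
    using cramer_vec3[of S m "vec3 (coef3 f)"] by (simp add: S_def)
qed

section \<open>Linear algebra of one tangent space: adapted frames\<close>

locale hermitian_space =
  fixes w :: "(real^4) list \<Rightarrow> real" and j :: "real^4 \<Rightarrow> real^4"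
  assumes alt: "alternating_form 2 w" and lin_j: "linear j" and jj: "j (j v) = - v"
    and compat: "w [j u, j v] = w [u, v]" and pos: "u \<noteq> 0 \<Longrightarrow> w [j u, u] > 0"
begin

lemmas w_linear = alternating_form_2D(1,2)[OF alt]
lemmas w_self = alternating_form_2D(3)[OF alt]
lemmas w_swap = alternating_form_2D(4)[OF alt]
lemmas w_simps = linear_add[OF w_linear(1)] linear_add[OF w_linear(2)]
  linear_cmul[OF w_linear(1)] linear_cmul[OF w_linear(2)] linear_neg[OF w_linear(1)]
  linear_neg[OF w_linear(2)] linear_diff[OF w_linear(1)] linear_diff[OF w_linear(2)]
  linear_0[OF w_linear(1)] linear_0[OF w_linear(2)]
lemmas j_simps = linear_add[OF lin_j] linear_cmul[OF lin_j] linear_neg[OF lin_j] linear_diff[OF lin_j]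
  linear_0[OF lin_j] jj

lemma w_j_left: "w [j u, v] = - w [u, j v]"
  using compat[of u "j v"] by (simp add: jj linear_neg[OF w_linear(2)])

text \<open>Gram-Schmidt for the metric, one complex line at a time. The value -1 is the
  normalisation g(f 1, f 1) = w [j (f 1), f 1] = 1 read with the arguments swapped.\<close>

lemma adapted_frame:
  obtains f :: "4 \<Rightarrow> real^4"
  where "f 2 = j (f 1)" "f 4 = j (f 3)" "w [f 1, f 2] = -1" "w [f 3, f 4] = -1"
    "w [f 1, f 3] = 0" "w [f 1, f 4] = 0" "w [f 2, f 3] = 0" "w [f 2, f 4] = 0"
proof -
  have unit: "\<exists>r::real. w [j (r *\<^sub>R u), r *\<^sub>R u] = 1 \<and> r \<noteq> 0" if "u \<noteq> 0" for u
  proof (intro exI[of _ "1 / sqrt (w [j u, u])"] conjI)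
    show "w [j ((1 / sqrt (w [j u, u])) *\<^sub>R u), (1 / sqrt (w [j u, u])) *\<^sub>R u] = 1"
      using pos[OF that] by (simp add: w_simps j_simps field_simps)
  qed (use pos[OF that] in simp)
  have "axis 1 1 \<noteq> (0::real^4)" by simp
  from unit[OF this] obtain u where u: "w [j u, u] = 1" by blast
  have "dim (span {u, j u}) < dim (UNIV :: (real^4) set)"
  proof -
    have "dim (span {u, j u}) \<le> card {u, j u}" by (simp add: dim_le_card')
    also have "\<dots> \<le> 2" by (simp add: card_insert_if)
    finally show ?thesis by simp
  qed
  then have "span {u, j u} \<noteq> UNIV" by force
  then obtain v0 where v0: "v0 \<notin> span {u, j u}" by blast
  \<comment> \<open>Subtract the orthogonal projection of \<open>v0\<close> to the complex line of
    \<open>u\<close>; the two coefficients are g(v0, u) and g(v0, Ju).\<close>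
  define v1 where "v1 = v0 - w [j v0, u] *\<^sub>R u - w [j v0, j u] *\<^sub>R j u"
  have "v1 \<noteq> 0"
  proof
    assume "v1 = 0"
    then have "v0 = w [j v0, u] *\<^sub>R u + w [j v0, j u] *\<^sub>R j u" by (simp add: v1_def algebra_simps)
    then have "v0 \<in> span {u, j u}"
      by (metis insertI1 insertI2 span_add span_base span_scale)
    with v0 show False by blast
  qed
  from unit[OF this] obtain r where r: "w [j (r *\<^sub>R v1), r *\<^sub>R v1] = 1" by blast
  have 1: "w [u, j u] = -1" using u alternating_form_2D(4)[OF alt, where u="j u" and v=u] by simp
  have o1: "w [u, v1] = 0"
    using w_j_left[of v0 u] compat[of v0 u] w_swap[of u v0] u 1
    by (simp add: v1_def w_simps w_self compat)
  have o2: "w [j u, v1] = 0"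
    using w_swap[of v0 "j u"] u w_j_left[of v0 u] by (simp add: v1_def w_simps w_self)
  have o3: "w [u, j v1] = 0" using o2 w_j_left by simp
  have o4: "w [j u, j v1] = 0" using o1 compat by simp
  define f :: "4 \<Rightarrow> real^4" where
    "f a = (if a = 1 then u else if a = 2 then j u else if a = 3 then r *\<^sub>R v1 else j (r *\<^sub>R v1))" for a
  have "w [r *\<^sub>R v1, j (r *\<^sub>R v1)] = - w [j (r *\<^sub>R v1), r *\<^sub>R v1]"
    by (rule alternating_form_2D(4)[OF alt])
  then have r': "w [r *\<^sub>R v1, j (r *\<^sub>R v1)] = -1" using r by simp
  show ?thesis
  proof (rule that[of f])
    show "w [f 3, f 4] = - 1" using r' by (simp add: f_def)
    show "w [f 1, f 4] = 0" "w [f 2, f 4] = 0"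
      using o3 o4 by (simp_all add: f_def linear_cmul[OF lin_j] linear_cmul[OF w_linear(2)])
  qed (use 1 o1 o2 in \<open>simp_all add: f_def linear_cmul[OF w_linear(2)]\<close>)
qed

end

section \<open>Wedge square, Gram determinant and volume form in coordinates\<close>

lemma sum_Pow_insert:
  assumes "finite A" "a \<notin> A"
  shows "sum f (Pow (insert a A)) = sum f (Pow A) + (\<Sum>S\<in>Pow A. f (insert a S))"
proof -
  have "sum f (Pow (insert a A)) = sum f (Pow A) + sum f (insert a ` Pow A)"
    unfolding Pow_insert using assms by (intro sum.union_disjoint) auto
  also have "sum f (insert a ` Pow A) = (\<Sum>S\<in>Pow A. f (insert a S))"
    using assms(2) by (intro sum.reindex_cong[of "insert a"]) (auto simp: inj_on_def)
  finally show ?thesis .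
qed

lemma sum_lists_length_Suc:
  fixes f :: "'n::finite list \<Rightarrow> 'b::comm_monoid_add"
  shows "(\<Sum>is | length is = Suc n. f is) = (\<Sum>i\<in>UNIV. \<Sum>is | length is = n. f (i # is))"
proof -
  have "{is :: 'n list. length is = Suc n} = (\<lambda>(i, is). i # is) ` (UNIV \<times> {is. length is = n})"
    by (auto simp: length_Suc_conv image_iff)
  then have "(\<Sum>is | length is = Suc n. f is) = (\<Sum>(i, is)\<in>UNIV \<times> {is. length is = n}. f (i # is))"
    by (simp add: sum.reindex inj_on_def case_prod_unfold)
  then show ?thesis by (simp add: sum.cartesian_product)
qed

lemma wedge_self_4:
  assumes "alternating_form 2 w"
  shows "wedge w w [u, v, y, z] =
    2 * (w [u, v] * w [y, z] - w [u, y] * w [v, z] + w [u, z] * w [v, y] :: real)"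
proof -
  have z: "w vs = 0" if "length vs \<noteq> 2" for vs
    using assms that unfolding alternating_form_def by blast
  have w: "{..<length [u, v, y, z]} = {0, 1, 2, 3}" by auto
  \<comment> \<open>The exponent of the shuffle sign. Only two-element sets matter, since
    \<open>w\<close> vanishes on lists of any other length.\<close>
  define N where "N S = card {(i, j). i \<in> S \<and> j \<in> {0, 1, 2, 3} - S \<and> j < i}" for S :: "nat set"
  have N: "N S = card X"
    if "{(i, j). i \<in> S \<and> j \<in> {0, 1, 2, 3} - S \<and> j < i} = X" for S X
    using that by (simp only: N_def)
  have c: "N {0, 1} = card ({} :: (nat \<times> nat) set)" "N {0, 2} = card {(2::nat, 1::nat)}"
    "N {0, 3} = card {(3::nat, 1::nat), (3, 2)}" "N {1, 2} = card {(1::nat, 0::nat), (2, 0)}"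
    "N {1, 3} = card {(1::nat, 0::nat), (3, 0), (3, 2)}"
    "N {2, 3} = card {(2::nat, 0::nat), (2, 1), (3, 0), (3, 1)}"
    by (rule N; auto)+
  have c': "N {0, Suc 0} = 0" "N {0, 2} = 1" "N {0, 3} = 2" "N {Suc 0, 2} = 2" "N {Suc 0, 3} = 3" "N {2, 3} = 4"
    using c by simp_all
  have "wedge w w [u, v, y, z] = (\<Sum>S\<in>Pow {0, 1, 2, 3}.
        (-1) ^ N S * w (nths [u, v, y, z] S) * w (nths [u, v, y, z] (- S)))"
    unfolding wedge_def w N_def ..
  also have "\<dots> = w [u, v] * w [y, z] - w [u, y] * w [v, z] + w [u, z] * w [v, y]
     + w [v, y] * w [u, z] - w [v, z] * w [u, y] + w [y, z] * w [u, v]"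
    by (simp add: sum_Pow_insert nths_Cons z c')
  finally show ?thesis by simp
qed

lemma gram_det_4:
  "gram_det g [u, v, y, z] = det4
    (\<lambda>i. g u (if i = 1 then u else if i = 2 then v else if i = 3 then y else z))
    (\<lambda>i. g v (if i = 1 then u else if i = 2 then v else if i = 3 then y else z))
    (\<lambda>i. g y (if i = 1 then u else if i = 2 then v else if i = 3 then y else z))
    (\<lambda>i. g z (if i = 1 then u else if i = 2 then v else if i = 3 then y else z))"
proof -
  have w: "{..<length [u, v, y, z]} = {0, 1, 2, 3}" by auto
  have f1234: "finite {1::nat, 2, 3}" "0 \<notin> {1::nat, 2, 3}" by auto
  have f234: "finite {2::nat, 3}" "1 \<notin> {2::nat, 3}" by auto
  have f34: "finite {3::nat}" "2 \<notin> {3::nat}" by auto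
  show ?thesis
    unfolding gram_det_def w
    unfolding sum_over_permutations_insert[OF f1234]
    unfolding sum_over_permutations_insert[OF f234]
    unfolding sum_over_permutations_insert[OF f34]
    unfolding permutes_sing
    by (simp add: sign_swap_id permutation_swap_id sign_compose permutation_compose sign_id swap_id_eq
        det4_def algebra_simps numeral_2_eq_2 numeral_3_eq_3)
qed

lemma alternating_form_comp_linear:
  assumes "alternating_form k f" "linear T"
  shows "alternating_form k (\<lambda>vs. f (map T vs))"
proof -
  have "linear (\<lambda>v. f (map T (vs[i := v])))" if "length vs = k" "i < k" for vs i
  proof -
    have "linear (\<lambda>v. f ((map T vs)[i := v]))"
      using assms(1) that unfolding alternating_form_def by simp
    from linear_compose[OF assms(2) this] show ?thesis by (simp add: o_def map_update)
  qed
  moreover have "f (map T vs) = 0" if h: "length vs = k" "i < l" "l < k" "vs ! i = vs ! l" for vs i l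
  proof -
    have "\<And>vs i l. length vs = k \<and> i < l \<and> l < k \<and> vs ! i = vs ! l \<Longrightarrow> f vs = 0"
      using assms(1) unfolding alternating_form_def by blast
    from this[of "map T vs" i l] h show ?thesis by simp
  qed
  moreover have "f (map T vs) = 0" if "length vs \<noteq> k" for vs
    using assms(1) that unfolding alternating_form_def by simp
  ultimately show ?thesis
    unfolding alternating_form_def by blast
qed

lemma alternating_form_linear_comp:
  assumes "alternating_form k f" "linear h"
  shows "alternating_form k (\<lambda>vs. h (f vs))"
proof -
  have "linear (\<lambda>v. h (f (vs[i := v])))" if "length vs = k" "i < k" for vs i
  proof -
    have "linear (\<lambda>v. f (vs[i := v]))"
      using assms(1) that unfolding alternating_form_def by simp
    from linear_compose[OF this assms(2)] show ?thesis by (simp add: o_def)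
  qed
  moreover have "h (f vs) = 0" if "f vs = 0" for vs
    using that linear_0[OF assms(2)] by simp
  ultimately show ?thesis
    using assms(1) unfolding alternating_form_def by blast
qed

context hermitian_space
begin

lemma metric_linear: "linear (\<lambda>u. metric w j u v)" "linear (\<lambda>v. metric w j u v)"
  unfolding metric_def using linear_compose[OF lin_j w_linear(1)] w_linear(2) by (simp_all add: o_def)

lemma metric_sym: "metric w j u v = metric w j v u"
  unfolding metric_def using w_j_left[of v u] w_swap[of "j u" v] by simp

definition gram :: "real^4^4" where
  "gram = (\<chi> a b. metric w j (axis a 1) (axis b 1))"

lemma gram_mult_right: "(\<Sum>m\<in>UNIV. gram $ k $ m * v $ m) = metric w j (axis k 1) v"
  using linear_expand_of_real[OF metric_linear(2), of "axis k 1" v] by (simp add: gram_def mult.commute)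

lemma gram_congruence: "(transpose V ** gram ** V) $ a $ b = metric w j (column a V) (column b V)"
proof -
  have "(transpose V ** gram ** V) $ a $ b = (\<Sum>k\<in>UNIV. V $ k $ a * (\<Sum>l\<in>UNIV. gram $ k $ l * column b V $ l))"
    by (simp add: matrix_mul_assoc[symmetric]) (simp add: matrix_matrix_mult_def transpose_def column_def)
  also have "\<dots> = (\<Sum>k\<in>UNIV. column a V $ k * metric w j (axis k 1) (column b V))"
    unfolding gram_mult_right by (simp add: column_def)
  also have "\<dots> = metric w j (column a V) (column b V)"
    using linear_expand_of_real[OF metric_linear(1), of "column a V" "column b V"] by simp
  finally show ?thesis .
qed

text \<open>In the frame the Pfaffian of the form is (-1)(-1) = 1, and by
  \<open>pf_pullback2\<close> it is also the determinant of the frame times the Pfaffian in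
  coordinates. Hence the latter never vanishes, and its sign compares the coordinates with the
  orientation given by w \<and> w.\<close>

lemma adapted_frame_det:
  obtains f :: "4 \<Rightarrow> real^4"
  where "f 2 = j (f 1)" "f 4 = j (f 3)" "w [f 1, f 2] = -1" "w [f 3, f 4] = -1"
    "w [f 1, f 3] = 0" "w [f 1, f 4] = 0" "w [f 2, f 3] = 0" "w [f 2, f 4] = 0"
    "det4 (\<lambda>a. f a $ 1) (\<lambda>a. f a $ 2) (\<lambda>a. f a $ 3) (\<lambda>a. f a $ 4) * pf (coef2 w) = 1"
proof -
  obtain f :: "4 \<Rightarrow> real^4" where f: "f 2 = j (f 1)" "f 4 = j (f 3)" "w [f 1, f 2] = -1" "w [f 3, f 4] = -1"
    "w [f 1, f 3] = 0" "w [f 1, f 4] = 0" "w [f 2, f 3] = 0" "w [f 2, f 4] = 0"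
    by (rule adapted_frame)
  have "pf (\<lambda>a b. w [f a, f b]) = 1" using f(3-8) by (simp add: pf_def)
  then have "pf (pullback2 (\<lambda>k a. of_real (f a $ k)) (coef2 w)) = 1"
    unfolding pullback2_coef2[OF alt] .
  then have "det4 (\<lambda>a. f a $ 1) (\<lambda>a. f a $ 2) (\<lambda>a. f a $ 3) (\<lambda>a. f a $ 4) * pf (coef2 w) = 1"
    by (simp add: pf_pullback2[OF alt2_coef2[OF alt]])
  with f show ?thesis by (rule that)
qed

lemma pf_nonzero: "pf (coef2 w) \<noteq> 0"
  by (rule adapted_frame_det) auto

text \<open>An adapted frame is orthonormal, so its matrix transforms \<open>gram\<close> to the
  identity, and its determinant is the inverse of the Pfaffian.\<close>

lemma det_gram: "det gram = (pf (coef2 w))\<^sup>2"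
proof -
  obtain f :: "4 \<Rightarrow> real^4" where f: "f 2 = j (f 1)" "f 4 = j (f 3)" "w [f 1, f 2] = -1" "w [f 3, f 4] = -1"
    "w [f 1, f 3] = 0" "w [f 1, f 4] = 0" "w [f 2, f 3] = 0" "w [f 2, f 4] = 0"
    and d: "det4 (\<lambda>a. f a $ 1) (\<lambda>a. f a $ 2) (\<lambda>a. f a $ 3) (\<lambda>a. f a $ 4) * pf (coef2 w) = 1"
    by (rule adapted_frame_det)
  define E :: "real^4^4" where "E = (\<chi> k a. f a $ k)"
  have col: "column a E = f a" for a by (simp add: column_def E_def vec_eq_iff)
  have j: "j (f 2) = - f 1" "j (f 4) = - f 3" using f(1,2) by (simp_all add: jj)
  have sw: "w [f 2, f 1] = 1" "w [f 4, f 3] = 1" "w [f 3, f 1] = 0" "w [f 4, f 1] = 0"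
    "w [f 3, f 2] = 0" "w [f 4, f 2] = 0"
    using f(3-8) w_swap[of "f 1" "f 2"] w_swap[of "f 3" "f 4"] w_swap[of "f 1" "f 3"]
      w_swap[of "f 1" "f 4"] w_swap[of "f 2" "f 3"] w_swap[of "f 2" "f 4"] by simp_all
  have "(transpose E ** gram ** E) $ a $ b = (mat 1 :: real^4^4) $ a $ b" for a b
  proof -
    have "\<forall>a b. metric w j (f a) (f b) = (mat 1 :: real^4^4) $ a $ b"
      unfolding forall_4 metric_def using f(3-8) sw
      by (simp add: f(1,2)[symmetric] j linear_neg[OF w_linear(1)] w_self mat_def)
    then show ?thesis by (simp add: gram_congruence col)
  qed
  then have "transpose E ** gram ** E = mat 1" by (simp add: vec_eq_iff)
  then have "det E * det gram * det E = 1" by (metis det_I det_mul det_transpose)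
  moreover have "det E * pf (coef2 w) = 1" using d by (simp add: det_4 E_def)
  moreover have "det gram * (det E * pf (coef2 w))\<^sup>2 = (det E * det gram * det E) * (pf (coef2 w))\<^sup>2"
    by (simp add: power2_eq_square)
  ultimately show ?thesis by simp
qed

text \<open>The orientation sign and the square root cancel: w \<and> w is twice the Pfaffian times
  the coordinate determinant, and the Gram determinant is the square of that Pfaffian times that
  determinant. The volume form is thereby a polynomial expression.\<close>

lemma volume_form_eq:
  "volume_form (metric w j) w [u, v, y, z] =
    pf (coef2 w) * det4 (\<lambda>i. u $ i) (\<lambda>i. v $ i) (\<lambda>i. y $ i) (\<lambda>i. z $ i)"
proof -
  define f :: "4 \<Rightarrow> real^4" where "f a = (if a = 1 then u else if a = 2 then v else if a = 3 then y else z)" for a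
  define V :: "real^4^4" where "V = (\<chi> k a. f a $ k)"
  define D where "D = det4 (\<lambda>i. u $ i) (\<lambda>i. v $ i) (\<lambda>i. y $ i) (\<lambda>i. z $ i)"
  have col: "column a V = f a" for a by (simp add: column_def V_def vec_eq_iff)
  have D': "det4 (\<lambda>a. f a $ 1) (\<lambda>a. f a $ 2) (\<lambda>a. f a $ 3) (\<lambda>a. f a $ 4) = D"
    using det4_transpose[of "\<lambda>k a. f a $ k"] by (simp add: D_def f_def)
  have detV: "det V = D" using D' by (simp add: det_4 V_def)
  have "pf (\<lambda>a b. w [f a, f b]) = D * pf (coef2 w)"
    unfolding pullback2_coef2[OF alt, symmetric] by (simp add: pf_pullback2[OF alt2_coef2[OF alt]] D')
  then have wedge: "wedge w w [u, v, y, z] = 2 * (D * pf (coef2 w))"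
    unfolding wedge_self_4[OF alt] by (simp add: pf_def f_def)
  have "gram_det (metric w j) [u, v, y, z] = det (\<chi> a b. metric w j (f a) (f b))"
    unfolding gram_det_4 det_4 by (simp add: f_def det4_def)
  also have "(\<chi> a b. metric w j (f a) (f b)) = transpose V ** gram ** V"
    by (simp add: vec_eq_iff gram_congruence col)
  also have "det \<dots> = (D * pf (coef2 w))\<^sup>2"
    by (simp add: det_mul detV det_gram power2_eq_square)
  finally have "sqrt (gram_det (metric w j) [u, v, y, z]) = \<bar>D * pf (coef2 w)\<bar>" by simp
  then have "volume_form (metric w j) w [u, v, y, z] = sgn (2 * (D * pf (coef2 w))) * \<bar>D * pf (coef2 w)\<bar>"
    unfolding volume_form_def wedge by simp
  also have "\<dots> = D * pf (coef2 w)"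
    using sgn_mult_abs[of "D * pf (coef2 w)"] by (simp add: sgn_mult)
  finally show ?thesis by (simp add: D_def)
qed

end

section \<open>Hodge operator and contraction in coordinates\<close>

context hermitian_space
begin

abbreviation rf :: "4 \<Rightarrow> real^4" where
  "rf \<equiv> reciprocal_frame (metric w j)"

lemma rf_eq: "rf a = matrix_inv gram $ a"
  by (simp add: reciprocal_frame_def gram_def)

lemma gram_inverse: "matrix_inv gram ** gram = mat 1" "gram ** matrix_inv gram = mat 1"
proof -
  have "det gram \<noteq> 0" by (simp add: det_gram pf_nonzero)
  then have "invertible gram" by (simp add: invertible_det_nz)
  then have "gram ** matrix_inv gram = mat 1 \<and> matrix_inv gram ** gram = mat 1"
    unfolding invertible_def matrix_inv_def by (rule someI_ex)
  then show "matrix_inv gram ** gram = mat 1" "gram ** matrix_inv gram = mat 1"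
    by simp_all
qed

lemma metric_rf: "metric w j (axis k 1) (rf l) = (if k = l then 1 else 0)"
proof -
  have sym: "gram $ k $ m = gram $ m $ k" for m
    unfolding gram_def by (simp add: metric_sym)
  have "metric w j (axis k 1) (rf l) = (\<Sum>m\<in>UNIV. matrix_inv gram $ l $ m * gram $ m $ k)"
    unfolding gram_mult_right[symmetric] rf_eq by (simp add: sym mult.commute)
  also have "\<dots> = (matrix_inv gram ** gram) $ l $ k" by (simp add: matrix_matrix_mult_def)
  finally show ?thesis by (simp add: gram_inverse mat_def)
qed

lemma det4_rf: "det4 (\<lambda>m. rf 1 $ m) (\<lambda>m. rf 2 $ m) (\<lambda>m. rf 3 $ m) (\<lambda>m. rf 4 $ m) * (pf (coef2 w))\<^sup>2 = 1"
proof -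
  have "det (matrix_inv gram) * det gram = 1"
    by (metis det_I det_mul gram_inverse(1))
  then show ?thesis unfolding det_gram by (simp add: det_4 rf_eq)
qed

text \<open>By Cramer's rule the \<open>vec3\<close> components are, up to the determinant of the
  reciprocal frame, the coordinates of \<open>v\<close> in that frame. The metric pairing with
  \<open>axis k 1\<close> reads off the \<open>k\<close>-th one, and \<open>det4_rf\<close>
  evaluates the determinant.\<close>

lemma vec3_rf:
  "vec3 (\<lambda>a b c. det4 (\<lambda>m. rf a $ m) (\<lambda>m. rf b $ m) (\<lambda>m. rf c $ m) (\<lambda>m. v $ m)) k * (pf (coef2 w))\<^sup>2
    = metric w j (axis k 1) v"
proof -
  define D where "D = det4 (\<lambda>m. rf 1 $ m) (\<lambda>m. rf 2 $ m) (\<lambda>m. rf 3 $ m) (\<lambda>m. rf 4 $ m)"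
  let ?N = "vec3 (\<lambda>a b c. det4 (\<lambda>m. rf a $ m) (\<lambda>m. rf b $ m) (\<lambda>m. rf c $ m) (\<lambda>m. v $ m))"
  have c: "D * v $ m = (\<Sum>l\<in>UNIV. rf l $ m * ?N l)" for m
    using cramer_vec3[of "\<lambda>a m. rf a $ m" m "\<lambda>m. v $ m"] by (simp add: D_def)
  have "D * metric w j (axis k 1) v = (\<Sum>m\<in>UNIV. gram $ k $ m * (D * v $ m))"
    unfolding gram_mult_right[symmetric] by (simp add: sum_distrib_left mult.left_commute)
  also have "\<dots> = (\<Sum>l\<in>UNIV. (\<Sum>m\<in>UNIV. gram $ k $ m * rf l $ m) * ?N l)"
    unfolding c by (simp add: sum_distrib_left sum_distrib_right mult.assoc) (rule sum.swap)
  also have "\<dots> = (\<Sum>l\<in>UNIV. (if k = l then 1 else 0) * ?N l)"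
    unfolding gram_mult_right metric_rf ..
  also have "\<dots> = ?N k" by (simp add: if_distrib[of "\<lambda>x. x * _"] cong: if_cong)
  finally have "?N k * (pf (coef2 w))\<^sup>2 = (D * (pf (coef2 w))\<^sup>2) * metric w j (axis k 1) v"
    by (simp add: algebra_simps)
  then show ?thesis using det4_rf by (simp add: D_def)
qed

text \<open>The 1/3! of the Hodge formula cancels against the 6 orderings of three indices. The
  volume form contributes the Pfaffian and the raised indices its inverse square, which leaves one
  division by it.\<close>

lemma hodge_3form:
  assumes "alt3 (coef3 a)"
  shows "hodge (metric w j) w a [v] =
    (\<Sum>k\<in>UNIV. vec3 (coef3 a) k * of_real (metric w j (axis k 1) v)) / of_real (pf (coef2 w))"
proof -
  define N where "N a b c = det4 (\<lambda>m. rf a $ m) (\<lambda>m. rf b $ m) (\<lambda>m. rf c $ m) (\<lambda>m. v $ m)" for a b c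
  define M where "M a b c = complex_of_real (N a b c)" for a b c
  have "M = (\<lambda>a b c. det4 (\<lambda>m. of_real (rf a $ m)) (\<lambda>m. of_real (rf b $ m))
      (\<lambda>m. of_real (rf c $ m)) (\<lambda>m. of_real (v $ m)))"
    by (simp add: fun_eq_iff M_def N_def det4_def)
  then have altM: "alt3 M" using alt3_det4[of "\<lambda>a m. of_real (rf a $ m)"] by simp
  have vM: "vec3 M k = of_real (vec3 N k)" for k by (simp add: vec3_def M_def)
  have vN: "vec3 N k = metric w j (axis k 1) v / (pf (coef2 w))\<^sup>2" for k
    using vec3_rf[of v k] pf_nonzero by (simp add: N_def[abs_def] field_simps)
  have "hodge (metric w j) w a [v] = (\<Sum>i\<in>UNIV. \<Sum>k\<in>UNIV. \<Sum>l\<in>UNIV.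
      coef3 a i k l * of_real (volume_form (metric w j) w [rf i, rf k, rf l, v])) / 6"
    by (simp add: hodge_def sum_lists_length_Suc[of _ 2, unfolded eval_nat_numeral, simplified]
        sum_lists_length_Suc[of _ "Suc 0"] sum_lists_length_Suc[of _ 0] coef3_def fact_numeral eval_nat_numeral)
  also have "\<dots> = of_real (pf (coef2 w)) * (\<Sum>i\<in>UNIV. \<Sum>k\<in>UNIV. \<Sum>l\<in>UNIV. coef3 a i k l * M i k l) / 6"
    unfolding volume_form_eq by (simp add: M_def N_def sum_distrib_left mult.left_commute)
  also have "\<dots> = of_real (pf (coef2 w)) * (\<Sum>k\<in>UNIV. vec3 (coef3 a) k * of_real (vec3 N k))"
    unfolding alt3_double_sum[OF assms altM] vM by simp
  also have "\<dots> = (\<Sum>k\<in>UNIV. vec3 (coef3 a) k * of_real (metric w j (axis k 1) v)) / of_real (pf (coef2 w))"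
    unfolding vN using pf_nonzero
    by (simp add: sum_distrib_left sum_divide_distrib field_simps power2_eq_square)
  finally show ?thesis .
qed

lemma metric_zero_complex:
  fixes W :: "4 \<Rightarrow> complex"
  assumes "\<And>v. (\<Sum>k\<in>UNIV. W k * of_real (metric w j (axis k 1) v)) = 0"
  shows "W k = 0"
proof -
  have "(\<Sum>l\<in>UNIV. W l * of_real (metric w j (axis l 1) (rf k))) = W k"
    by (simp add: metric_rf if_distrib[of of_real] if_distrib[of "\<lambda>x. _ * x"] cong: if_cong)
  with assms show ?thesis by metis
qed

text \<open>Injectivity of the Hodge operator in degree three. Together with the next lemma it
  removes the outer Hodge operator from \<open>star_adjoint\<close>.\<close>

lemma hodge_3form_eq_0:
  assumes "alt3 (coef3 a)" "\<And>v. hodge (metric w j) w a [v] = 0"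
  shows "coef3 a i k l = 0"
proof -
  have "vec3 (coef3 a) k / of_real (pf (coef2 w)) = 0" for k
    by (rule metric_zero_complex)
      (use assms(2) in \<open>simp add: hodge_3form[OF assms(1)] flip: sum_divide_distrib\<close>)
  then have z: "vec3 (coef3 a) k = 0" for k using pf_nonzero by simp
  have "coef3 a 1 2 3 = 0" "coef3 a 1 2 4 = 0" "coef3 a 1 3 4 = 0" "coef3 a 2 3 4 = 0"
    using z[of 1] z[of 2] z[of 3] z[of 4] by (simp_all add: vec3_def)
  then have "\<forall>i k l. coef3 a i k l = 0"
    unfolding forall_4 by (simp add: alt3_components[OF assms(1)])
  then show ?thesis by blast
qed

text \<open>Evaluating on three vectors of the reciprocal frame leaves a single term of the sum,
  since a determinant with a repeated row vanishes.\<close>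

lemma hodge_1form_eq_0:
  assumes "\<And>u v z. hodge (metric w j) w a [u, v, z] = 0"
  shows "a [axis i 1] = 0"
proof -
  have h: "hodge (metric w j) w a [u, v, z] = of_real (pf (coef2 w)) *
    (\<Sum>i\<in>UNIV. a [axis i 1] * of_real (det4 (\<lambda>m. rf i $ m) (\<lambda>m. u $ m) (\<lambda>m. v $ m) (\<lambda>m. z $ m)))" for u v z
    by (simp add: hodge_def sum_lists_length_Suc[of _ 0] volume_form_eq sum_distrib_left mult.left_commute)
  define D where "D = det4 (\<lambda>m. rf 1 $ m) (\<lambda>m. rf 2 $ m) (\<lambda>m. rf 3 $ m) (\<lambda>m. rf 4 $ m)"
  have D: "D \<noteq> 0" using det4_rf by (auto simp: D_def)
  have p: "det4 (\<lambda>m. rf 2 $ m) (\<lambda>m. rf 1 $ m) (\<lambda>m. rf 3 $ m) (\<lambda>m. rf 4 $ m) = - D"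
    "det4 (\<lambda>m. rf 3 $ m) (\<lambda>m. rf 1 $ m) (\<lambda>m. rf 2 $ m) (\<lambda>m. rf 4 $ m) = D"
    "det4 (\<lambda>m. rf 4 $ m) (\<lambda>m. rf 1 $ m) (\<lambda>m. rf 2 $ m) (\<lambda>m. rf 3 $ m) = - D"
    unfolding D_def det4_def by (simp_all add: algebra_simps)
  have "\<forall>i. a [axis i 1] = 0"
    unfolding forall_4
    using assms[unfolded h, of "rf 2" "rf 3" "rf 4"] assms[unfolded h, of "rf 1" "rf 3" "rf 4"]
      assms[unfolded h, of "rf 1" "rf 2" "rf 4"] assms[unfolded h, of "rf 1" "rf 2" "rf 3"] D pf_nonzero
    by (simp add: sum_4 det4_repeated p flip: D_def)
  then show ?thesis by blast
qed

text \<open>Compatibility gives \<open>G = J\<^sup>T \<Omega>\<close> for the Gram matrix, so raising both indices turns \<open>\<Omega>\<close> into the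
  transpose of its inverse, which in dimension 4 is its \<open>\<epsilon>\<close>-dual divided by the Pfaffian.\<close>

lemma raised_form:
  "\<forall>a b. w [rf a, rf b] * pf (coef2 w) =
    (if (a, b) = (1, 2) then coef2 w 3 4 else if (a, b) = (1, 3) then - coef2 w 2 4
     else if (a, b) = (1, 4) then coef2 w 2 3 else if (a, b) = (2, 3) then coef2 w 1 4
     else if (a, b) = (2, 4) then - coef2 w 1 3 else if (a, b) = (3, 4) then coef2 w 1 2
     else if (a, b) = (2, 1) then - coef2 w 3 4 else if (a, b) = (3, 1) then coef2 w 2 4
     else if (a, b) = (4, 1) then - coef2 w 2 3 else if (a, b) = (3, 2) then - coef2 w 1 4
     else if (a, b) = (4, 2) then coef2 w 1 3 else if (a, b) = (4, 3) then - coef2 w 1 2 else 0)"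
    (is "\<forall>a b. _ = ?D a b")
proof -
  define D :: "real^4^4" where "D = (\<chi> a b. ?D a b)"
  define \<Omega> :: "real^4^4" where "\<Omega> = (\<chi> a b. coef2 w a b)"
  define P where "P = matrix_inv gram"
  define Jm where "Jm = matrix j"
  note ac = alt2_components[OF alt2_coef2[OF alt]]
  have scale: "(c *\<^sub>R U) ** V = c *\<^sub>R (U ** V)" "U ** (c *\<^sub>R V) = c *\<^sub>R (U ** V)"
    for c and U V :: "real^4^4"
    by (simp_all add: vec_eq_iff matrix_matrix_mult_def sum_distrib_left mult_ac)
  have wO: "w [u, v] = (\<Sum>a\<in>UNIV. \<Sum>b\<in>UNIV. u $ a * v $ b * \<Omega> $ a $ b)" for u v
    using bilinear_expand[of "\<lambda>u v. w [u, v]" u v, OF w_linear(1) w_linear(2)]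
    by (simp add: \<Omega>_def coef2_def)
  have cong: "(V ** \<Omega> ** transpose U) $ a $ b = w [V $ a, U $ b]" for U V :: "real^4^4" and a b
    unfolding wO by (simp add: matrix_mul_assoc[symmetric])
      (simp add: matrix_matrix_mult_def transpose_def sum_distrib_left mult_ac)
  have colJ: "transpose Jm $ a = j (axis a 1)" for a
    by (simp add: Jm_def transpose_def matrix_def vec_eq_iff)
  have id: "mat 1 $ b = (axis b 1 :: real^4)" for b by (simp add: mat_def axis_def vec_eq_iff)
  have G: "gram = transpose Jm ** \<Omega>"
    using cong[of "transpose Jm" "mat 1"]
    by (simp add: vec_eq_iff colJ id gram_def metric_def transpose_mat)
  have GT: "transpose gram = gram"
    by (simp add: vec_eq_iff transpose_def gram_def metric_sym)
  have JOJ: "transpose Jm ** \<Omega> ** Jm = \<Omega>"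
    using cong[of "transpose Jm" "transpose Jm"]
    by (simp add: vec_eq_iff colJ compat \<Omega>_def coef2_def transpose_transpose)
  have ODO: "\<Omega> ** D ** transpose \<Omega> = pf (coef2 w) *\<^sub>R \<Omega>"
    unfolding vec_eq_iff forall_4
    by (simp add: matrix_matrix_mult_def transpose_def sum_4 \<Omega>_def D_def ac pf_def algebra_simps)
  \<comment> \<open>With one factor transposed, G = J^T \<Omega> can be inserted on both sides: the
    middle becomes \<open>ODO\<close> and the outer J are absorbed by \<open>JOJ\<close>.\<close>
  have "gram ** D ** gram = gram ** D ** transpose gram" by (simp add: GT)
  also have "\<dots> = transpose Jm ** (\<Omega> ** D ** transpose \<Omega>) ** Jm"
    unfolding G by (simp add: matrix_transpose_mul transpose_transpose matrix_mul_assoc)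
  also have "\<dots> = pf (coef2 w) *\<^sub>R \<Omega>"
    unfolding ODO using JOJ by (simp add: scale)
  finally have *: "gram ** D ** gram = pf (coef2 w) *\<^sub>R \<Omega>" .
  have PG: "P ** gram = mat 1" "gram ** P = mat 1" unfolding P_def by (rule gram_inverse)+
  have PT: "transpose P = P"
  proof -
    have "transpose P ** gram = mat 1" using PG(2) GT by (metis matrix_transpose_mul transpose_mat)
    then have "transpose P ** gram ** P = P" by simp
    then show ?thesis by (simp add: matrix_mul_assoc[symmetric] PG)
  qed
  have "P ** (gram ** D ** gram) ** P = (P ** gram) ** D ** (gram ** P)"
    by (simp add: matrix_mul_assoc)
  then have D: "pf (coef2 w) *\<^sub>R (P ** \<Omega> ** P) = D"
    unfolding * PG by (simp add: scale)
  have "w [rf a, rf b] * pf (coef2 w) = D $ a $ b" for a b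
    using cong[of P P a b] unfolding PT D[symmetric] by (simp add: rf_eq P_def)
  then show ?thesis unfolding D_def vec_lambda_beta by blast
qed

text \<open>In degree two this is the identity \<omega> \<and> a = \<Lambda>a vol: by
  \<open>raised_form\<close> the raised coefficients of \<open>w\<close> are those which
  \<open>pf_pair\<close> puts in front of \<open>a\<close>. Leaving \<open>vs\<close> free also
  covers a three-form with its last argument fixed.\<close>

lemma contraction_eq:
  fixes a :: "(real^4) list \<Rightarrow> complex"
  assumes "alt2 (\<lambda>i k. a (axis i 1 # axis k 1 # vs))"
  shows "contraction (metric w j) w a vs =
    pf_pair (\<lambda>i k. of_real (coef2 w i k)) (\<lambda>i k. a (axis i 1 # axis k 1 # vs)) / of_real (pf (coef2 w))"
proof -
  have "of_real (pf (coef2 w)) * contraction (metric w j) w a vs =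
    (\<Sum>i\<in>UNIV. \<Sum>k\<in>UNIV. of_real (w [rf i, rf k] * pf (coef2 w)) * a (axis i 1 # axis k 1 # vs)) / 2"
    unfolding contraction_def by (simp add: sum_distrib_left mult_ac)
  also have "(\<Sum>i\<in>UNIV. \<Sum>k\<in>UNIV. of_real (w [rf i, rf k] * pf (coef2 w)) * a (axis i 1 # axis k 1 # vs))
      = 2 * pf_pair (\<lambda>i k. of_real (coef2 w i k)) (\<lambda>i k. a (axis i 1 # axis k 1 # vs))"
    unfolding raised_form[rule_format] sum_4
    by (simp add: pf_pair_def alt2_components[OF assms] algebra_simps)
  finally show ?thesis using pf_nonzero by (simp add: field_simps)
qed

text \<open>On primitive two-forms \<open>J = -*\<close>, which is read off in a frame \<open>u, Ju, v, Jv\<close>.\<close>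

lemma primitive_pairing:
  fixes F :: "(real^4) list \<Rightarrow> complex"
  assumes F: "alternating_form 2 F" and prim: "pf_pair (\<lambda>i k. of_real (coef2 w i k)) (coef2 F) = 0"
  obtains r where "r \<ge> 0"
    "pf_pair (coef2 (\<lambda>vs. F (map j vs))) (\<lambda>a b. cnj (coef2 F a b)) / of_real (pf (coef2 w)) = - of_real r"
    "r = 0 \<Longrightarrow> coef2 F = (\<lambda>a b. 0)"
proof -
  obtain f :: "4 \<Rightarrow> real^4" where f: "f 2 = j (f 1)" "f 4 = j (f 3)" "w [f 1, f 2] = -1" "w [f 3, f 4] = -1"
    "w [f 1, f 3] = 0" "w [f 1, f 4] = 0" "w [f 2, f 3] = 0" "w [f 2, f 4] = 0"
    and d: "det4 (\<lambda>a. f a $ 1) (\<lambda>a. f a $ 2) (\<lambda>a. f a $ 3) (\<lambda>a. f a $ 4) * pf (coef2 w) = 1"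
    by (rule adapted_frame_det)
  define S :: "4 \<Rightarrow> 4 \<Rightarrow> complex" where "S k a = of_real (f a $ k)" for k a
  have jf: "j (f 1) = f 2" "j (f 2) = - f 1" "j (f 3) = f 4" "j (f 4) = - f 3" using f(1,2) by (simp_all add: jj)
  define H where "H vs = F (map j vs)" for vs
  define C where "C vs = cnj (F vs)" for vs
  define \<Omega> where "\<Omega> vs = complex_of_real (w vs)" for vs
  have H: "alternating_form 2 H" unfolding H_def by (rule alternating_form_comp_linear[OF F lin_j])
  have C: "alternating_form 2 C" unfolding C_def
    by (rule alternating_form_linear_comp[OF F]) (rule bounded_linear.linear[OF bounded_linear_cnj])
  have \<Omega>: "alternating_form 2 \<Omega>" unfolding \<Omega>_def
    by (rule alternating_form_linear_comp[OF alt]) (rule bounded_linear.linear[OF bounded_linear_of_real])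
  have detS: "det4 (S 1) (S 2) (S 3) (S 4) = 1 / of_real (pf (coef2 w))"
  proof -
    have "det4 (S 1) (S 2) (S 3) (S 4) =
        of_real (det4 (\<lambda>a. f a $ 1) (\<lambda>a. f a $ 2) (\<lambda>a. f a $ 3) (\<lambda>a. f a $ 4))"
      by (simp add: S_def det4_def)
    also have "det4 (\<lambda>a. f a $ 1) (\<lambda>a. f a $ 2) (\<lambda>a. f a $ 3) (\<lambda>a. f a $ 4) = 1 / pf (coef2 w)"
      using d pf_nonzero by (simp add: field_simps)
    finally show ?thesis by simp
  qed
  have pair: "pf_pair (\<lambda>a b. X [f a, f b]) (\<lambda>a b. Y [f a, f b]) = pf_pair (coef2 X) (coef2 Y) / of_real (pf (coef2 w))"
    if "alternating_form 2 X" "alternating_form 2 Y" for X Y :: "(real^4) list \<Rightarrow> complex"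
    using pf_pair_pullback2[OF alt2_coef2[OF that(1)] alt2_coef2[OF that(2)], of S]
    unfolding pullback2_coef2[OF that(1), of f, folded S_def] pullback2_coef2[OF that(2), of f, folded S_def] detS
    by simp
  have "coef2 \<Omega> = (\<lambda>i k. of_real (coef2 w i k))" by (simp add: coef2_def \<Omega>_def fun_eq_iff)
  then have "pf_pair (\<lambda>a b. \<Omega> [f a, f b]) (\<lambda>a b. F [f a, f b]) = 0"
    unfolding pair[OF \<Omega> F] using prim by simp
  then have "- F [f 3, f 4] - F [f 1, f 2] = 0"
    using f(3-8) by (simp add: pf_pair_def \<Omega>_def)
  then have F34: "F [f 3, f 4] = - F [f 1, f 2]" by algebra
  note Fl = linear_neg[OF alternating_form_2D(1)[OF F]] linear_neg[OF alternating_form_2D(2)[OF F]]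
  have Hf: "H [f 1, f 2] = F [f 1, f 2]" "H [f 3, f 4] = F [f 3, f 4]" "H [f 1, f 3] = F [f 2, f 4]"
    "H [f 2, f 4] = F [f 1, f 3]" "H [f 1, f 4] = - F [f 2, f 3]" "H [f 2, f 3] = - F [f 1, f 4]"
    using alternating_form_2D(4)[OF F, of "f 1" "f 2"] alternating_form_2D(4)[OF F, of "f 3" "f 4"]
    by (simp_all add: H_def jf Fl)
  \<comment> \<open>The coefficient 2 arises because F(f 1, f 2) and F(f 3, f 4), equal up to sign
    by primitivity, contribute the same square. For the rest, J exchanges the index pairs 13 with 24
    and 14 with 23 up to sign, and these are the pairs that \<open>pf_pair\<close>
    multiplies.\<close>
  define r where "r = 2 * (cmod (F [f 1, f 2]))\<^sup>2 + (cmod (F [f 1, f 3]))\<^sup>2 + (cmod (F [f 2, f 4]))\<^sup>2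
    + (cmod (F [f 1, f 4]))\<^sup>2 + (cmod (F [f 2, f 3]))\<^sup>2"
  have "pf_pair (\<lambda>a b. H [f a, f b]) (\<lambda>a b. C [f a, f b]) = - of_real r"
    unfolding pf_pair_def Hf r_def C_def F34 of_real_add of_real_mult complex_norm_square
    by (simp add: algebra_simps)
  moreover have "coef2 C = (\<lambda>a b. cnj (coef2 F a b))" by (simp add: coef2_def C_def fun_eq_iff)
  ultimately have "pf_pair (coef2 (\<lambda>vs. F (map j vs))) (\<lambda>a b. cnj (coef2 F a b)) / of_real (pf (coef2 w)) = - of_real r"
    using pair[OF H C] by (simp add: H_def[abs_def])
  moreover have "r \<ge> 0" by (simp add: r_def)
  moreover have "coef2 F = (\<lambda>a b. 0)" if "r = 0"
  proof -
    have "F [f 1, f 2] = 0" "F [f 1, f 3] = 0" "F [f 2, f 4] = 0" "F [f 1, f 4] = 0" "F [f 2, f 3] = 0"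
      using that unfolding r_def by (simp_all add: add_nonneg_eq_0_iff)
    then have z: "pf_pair (\<lambda>a b. F [f a, f b]) Y = 0" for Y
      using F34 by (simp add: pf_pair_def)
    have z': "pf_pair (coef2 F) Y = 0" if "alt2 Y" for Y
      using pf_pair_pullback2[OF alt2_coef2[OF F] that, of S]
      unfolding pullback2_coef2[OF F, of f, folded S_def] z detS using pf_nonzero by simp
    \<comment> \<open>Elementary two-forms: pairing with \<open>U i k\<close> isolates, up to sign,
      the coefficient at the complementary pair of indices.\<close>
    define U :: "4 \<Rightarrow> 4 \<Rightarrow> 4 \<Rightarrow> 4 \<Rightarrow> complex" where
      "U i k a b = (if a = i \<and> b = k then 1 else if a = k \<and> b = i then -1 else 0)" for i k a b
    have U: "i \<noteq> k \<Longrightarrow> pf_pair (coef2 F) (U i k) = 0" for i k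
      by (rule z') (auto simp: alt2_def U_def)
    have "coef2 F 1 2 = 0" "coef2 F 1 3 = 0" "coef2 F 1 4 = 0" "coef2 F 2 3 = 0" "coef2 F 2 4 = 0" "coef2 F 3 4 = 0"
      using U[of 3 4] U[of 2 4] U[of 2 3] U[of 1 4] U[of 1 3] U[of 1 2] by (simp_all add: pf_pair_def U_def)
    then have "\<forall>a b. coef2 F a b = 0"
      unfolding forall_4 by (simp add: alt2_components[OF alt2_coef2[OF F]])
    then show ?thesis by (simp add: fun_eq_iff)
  qed
  ultimately show ?thesis using that by blast
qed

end

section \<open>The divergence theorem on a compact manifold\<close>

lemma times_differentiable_on_1D:
  assumes "times_differentiable_on 1 S f"
  shows "continuous_on S f" "continuous_on S (\<lambda>x. frechet_derivative f (at x) v)"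
    "x \<in> S \<Longrightarrow> (f has_derivative frechet_derivative f (at x)) (at x)"
  using times_differentiable_on_Suc_D[of 0 S f] times_differentiable_on_has_derivative[of 0 S f x] assms
  by simp_all

text \<open>\<open>R\<close> and the complement of \<open>K\<close> are open and cover the space,
  and on the second of them the extension is zero.\<close>

lemma times_differentiable_on_zero_extension:
  assumes "open R" "compact K" "K \<subseteq> R" "times_differentiable_on k R f" "\<And>x. x \<in> R \<Longrightarrow> x \<notin> K \<Longrightarrow> f x = 0"
  shows "times_differentiable_on k UNIV (\<lambda>x. if x \<in> R then f x else 0)"
proof -
  have "open (- K)" using compact_imp_closed[OF assms(2)] by (simp add: open_Compl)
  moreover have "times_differentiable_on k R (\<lambda>x. if x \<in> R then f x else 0)"
    by (rule times_differentiable_on_cong[OF assms(1) _ assms(4)]) simp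
  moreover have "times_differentiable_on k (- K) (\<lambda>x. if x \<in> R then f x else 0)"
    by (rule times_differentiable_on_cong[OF \<open>open (- K)\<close> _ times_differentiable_on_const[of k _ 0]])
      (use assms(5) in auto)
  ultimately have "times_differentiable_on k (R \<union> - K) (\<lambda>x. if x \<in> R then f x else 0)"
    by (intro times_differentiable_on_Un assms(1))
  moreover have "R \<union> - K = UNIV" using assms(3) by auto
  ultimately show ?thesis by simp
qed

lemma integrable_continuous_compact_support:
  fixes f :: "real^'n \<Rightarrow> real"
  assumes "continuous_on UNIV f" "compact K" "\<And>x. x \<notin> K \<Longrightarrow> f x = 0"
  shows "integrable lborel f"
proof -
  have "integrable lborel (\<lambda>x. indicator K x *\<^sub>R f x)"
    using assms by (intro borel_integrable_compact) (auto intro: continuous_on_subset)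
  moreover have "(\<lambda>x. indicator K x *\<^sub>R f x) = f"
    using assms(3) by (auto simp: fun_eq_iff indicator_def)
  ultimately show ?thesis by simp
qed

lemma absolutely_integrable_compact_support:
  fixes f :: "real^'n \<Rightarrow> real"
  assumes "open R" "continuous_on R f" "compact K" "K \<subseteq> R" "\<And>x. x \<in> R \<Longrightarrow> x \<notin> K \<Longrightarrow> f x = 0"
  shows "f absolutely_integrable_on R"
proof -
  have c: "continuous_on UNIV (\<lambda>x. if x \<in> R then f x else 0)"
    using times_differentiable_on_zero_extension[OF assms(1,3,4), of 0 f] assms by simp
  have "integrable lborel (\<lambda>x. if x \<in> R then f x else 0)"
    by (rule integrable_continuous_compact_support[OF c assms(3)]) (use assms(5) in auto)
  then have "(\<lambda>x. if x \<in> R then f x else 0) absolutely_integrable_on UNIV"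
    by (simp add: set_integrable_def integrable_completion)
  then show ?thesis by (simp add: absolutely_integrable_restrict_UNIV)
qed

text \<open>By translation invariance the difference quotients have integral 0; dominated convergence does the rest.\<close>

lemma integral_derivative_compact_support:
  fixes f :: "real^'n \<Rightarrow> real"
  assumes f: "times_differentiable_on 1 UNIV f" and K: "compact K" "\<And>x. x \<notin> K \<Longrightarrow> f x = 0"
  shows "((\<lambda>x. frechet_derivative f (at x) v) has_integral 0) UNIV"
proof -
  let ?D = "\<lambda>x. frechet_derivative f (at x) v"
  have der: "(f has_derivative frechet_derivative f (at x)) (at x)" for x
    using times_differentiable_on_has_derivative[of 0 UNIV f x] f by simp
  have contf: "continuous_on UNIV f"
    using times_differentiable_on_Suc_D[of 0 UNIV f] f by simp
  have contD: "continuous_on UNIV ?D" using f by simp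
  obtain B where B: "B > 0" "K \<subseteq> cball 0 B"
    using bounded_subset_ballD[OF compact_imp_bounded[OF K(1)], of 0] ball_subset_cball by blast
  have D0: "?D x = 0" if "x \<notin> K" for x
  proof -
    have "open (- K)" using compact_imp_closed[OF K(1)] by (simp add: open_Compl)
    from frechet_derivative_cong_open[OF this, of x f "\<lambda>_. 0"] that K(2) show ?thesis by simp
  qed
  have "compact (?D ` K)" using K(1) contD by (intro compact_continuous_image) (auto intro: continuous_on_subset)
  then obtain M where M: "M > 0" "\<And>x. x \<in> K \<Longrightarrow> norm (?D x) \<le> M"
    using bounded_pos[of "?D ` K"] compact_imp_bounded by blast
  have DM: "\<bar>?D x\<bar> \<le> M" for x using M D0[of x] by (cases "x \<in> K") auto
  have line: "((\<lambda>t. f (x + t *\<^sub>R v)) has_real_derivative ?D (x + t *\<^sub>R v)) (at t)" for x t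
  proof -
    have "((\<lambda>t. x + t *\<^sub>R v) has_derivative (\<lambda>h. h *\<^sub>R v)) (at t)"
      by (auto intro!: derivative_eq_intros)
    from diff_chain_at[OF this der] have "((\<lambda>t. f (x + t *\<^sub>R v)) has_derivative
        (\<lambda>h. frechet_derivative f (at (x + t *\<^sub>R v)) (h *\<^sub>R v))) (at t)"
      by (simp add: o_def)
    moreover have "(\<lambda>h. frechet_derivative f (at (x + t *\<^sub>R v)) (h *\<^sub>R v)) = (*) (?D (x + t *\<^sub>R v))"
      by (simp add: fun_eq_iff linear_cmul[OF has_derivative_linear[OF der]])
    ultimately show ?thesis by (simp add: has_field_derivative_def)
  qed
  define h where "h n = inverse (real (Suc n))" for n
  have h: "0 < h n" "h n \<le> 1" for n by (simp_all add: h_def field_simps)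
  define F where "F n x = (f (x + h n *\<^sub>R v) - f x) / h n" for n x
  have lim: "(\<lambda>n. F n x) \<longlonglongrightarrow> ?D x" for x
  proof -
    have "((\<lambda>t. (f (x + (0 + t) *\<^sub>R v) - f (x + 0 *\<^sub>R v)) / t) \<longlongrightarrow> ?D x) (at 0)"
      using line[of x 0] by (simp add: DERIV_def)
    moreover have "filterlim h (at 0) sequentially"
      using LIMSEQ_inverse_real_of_nat h(1) by (auto simp: filterlim_at h_def[abs_def])
    ultimately have "((\<lambda>n. (f (x + (0 + h n) *\<^sub>R v) - f (x + 0 *\<^sub>R v)) / h n) \<longlongrightarrow> ?D x) sequentially"
      by (rule filterlim_compose)
    then show ?thesis by (simp add: F_def[abs_def])
  qed
  \<comment> \<open>The steps \<open>h n\<close> are at most 1, so beyond radius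
    \<open>B + norm v\<close> both \<open>x\<close> and its translate lie outside the support;
    elsewhere the mean value theorem bounds the quotient by \<open>M\<close>.\<close>
  have bound: "\<bar>F n x\<bar> \<le> M * indicator (cball 0 (B + norm v)) x" for n x
  proof (cases "x \<in> cball 0 (B + norm v)")
    case True
    obtain t where "f (x + h n *\<^sub>R v) - f (x + 0 *\<^sub>R v) = (h n - 0) * ?D (x + t *\<^sub>R v)"
      using MVT2[of 0 "h n" "\<lambda>t. f (x + t *\<^sub>R v)", OF h(1)[of n] line] by metis
    then have "F n x = ?D (x + t *\<^sub>R v)" using h(1)[of n] by (simp add: F_def)
    then show ?thesis using True DM by simp
  next
    case False
    have "norm (h n *\<^sub>R v) \<le> norm v" using h[of n] by (simp add: mult_left_le_one_le)
    then have "norm x - norm v \<le> norm (x + h n *\<^sub>R v)"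
      using norm_triangle_ineq4[of "x + h n *\<^sub>R v" "h n *\<^sub>R v"] by simp
    moreover have "B + norm v < norm x" using False by simp
    moreover have "0 \<le> norm v" by simp
    ultimately have "B < norm x" "B < norm (x + h n *\<^sub>R v)" by linarith+
    then have "x \<notin> K" "x + h n *\<^sub>R v \<notin> K" using B(2) by fastforce+
    then show ?thesis using K(2) False by (simp add: F_def)
  qed
  have intf: "integrable lborel f" by (rule integrable_continuous_compact_support[OF contf K])
  have trans: "integrable lborel (\<lambda>x. f (x + a))" "integral\<^sup>L lborel (\<lambda>x. f (x + a)) = integral\<^sup>L lborel f" for a
  proof -
    have "integrable (distr lborel borel ((+) a)) f" using intf by (simp add: lborel_distr_plus)
    then show "integrable lborel (\<lambda>x. f (x + a))"
      using borel_measurable_continuous_onI[OF contf] by (simp add: integrable_distr_eq add.commute)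
    have "integral\<^sup>L (distr lborel borel ((+) a)) f = integral\<^sup>L lborel (\<lambda>x. f (a + x))"
      using borel_measurable_continuous_onI[OF contf] by (intro integral_distr) auto
    then show "integral\<^sup>L lborel (\<lambda>x. f (x + a)) = integral\<^sup>L lborel f"
      by (simp add: lborel_distr_plus add.commute)
  qed
  have Fint: "integrable lborel (F n)" "integral\<^sup>L lborel (F n) = 0" for n
    unfolding F_def[abs_def] using trans intf by simp_all
  have meas: "?D \<in> borel_measurable lborel" "F n \<in> borel_measurable lborel" for n
    using borel_measurable_continuous_onI[OF contD] Fint(1)[of n] by auto
  have "integrable lborel (\<lambda>x::real^'n. indicator (cball 0 (B + norm v)) x *\<^sub>R M)"
    by (rule borel_integrable_compact) auto
  then have ind: "integrable lborel (\<lambda>x::real^'n. M * indicator (cball 0 (B + norm v)) x)"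
    by (simp add: mult.commute)
  have "integrable lborel ?D"
    by (rule integrable_continuous_compact_support[OF contD K(1) D0])
  moreover have "(\<lambda>n. integral\<^sup>L lborel (F n)) \<longlonglongrightarrow> integral\<^sup>L lborel ?D"
    by (rule integral_dominated_convergence[OF meas ind]) (use lim bound in auto)
  ultimately have "integrable lborel ?D" "(\<lambda>n. integral\<^sup>L lborel (F n)) \<longlonglongrightarrow> integral\<^sup>L lborel ?D"
    by blast+
  then have "integrable lborel ?D" "integral\<^sup>L lborel ?D = 0"
    using Fint(2) LIMSEQ_unique[of "\<lambda>_. 0"] by auto
  then show ?thesis using has_integral_integral_lborel[of ?D] by simp
qed

section \<open>Bump functions and coordinate balls\<close>

lemma positive_part_square_derivative:
  "((\<lambda>t::real. (max 0 t)\<^sup>2) has_real_derivative 2 * max 0 t) (at t)"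
proof -
  consider "t < 0" | "t = 0" | "t > 0" by linarith
  then show ?thesis
  proof cases
    case 1
    have "((\<lambda>t::real. (max 0 t)\<^sup>2) has_real_derivative 0) (at t)"
      by (rule has_field_derivative_transform_within_open[of "\<lambda>_. 0" _ _ "{..<0}"]) (use 1 in auto)
    then show ?thesis using 1 by simp
  next
    case 2
    have "((\<lambda>h::real. (max 0 h)\<^sup>2 / h) \<longlongrightarrow> 0) (at 0)"
    proof (rule Lim_null_comparison)
      show "\<forall>\<^sub>F h in at 0. norm ((max 0 h)\<^sup>2 / h) \<le> \<bar>h::real\<bar>"
        by (rule always_eventually) (auto simp: max_def power2_eq_square)
    qed (auto intro!: tendsto_eq_intros)
    then show ?thesis using 2 by (simp add: DERIV_def)
  next
    case 3
    have "((\<lambda>t::real. (max 0 t)\<^sup>2) has_real_derivative 2 * t) (at t)"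
      by (rule has_field_derivative_transform_within_open[of "\<lambda>t. t\<^sup>2" _ _ "{0<..}"])
        (use 3 in \<open>auto intro!: derivative_eq_intros\<close>)
    then show ?thesis using 3 by simp
  qed
qed

text \<open>Squaring the positive part makes it continuously differentiable, which is all that is
  asked of a partition of unity that gets differentiated once.\<close>

definition bump :: "real^'n \<Rightarrow> real \<Rightarrow> real^'n \<Rightarrow> real" where
  "bump y r z = (max 0 (r\<^sup>2 - (z - y) \<bullet> (z - y)))\<^sup>2"

lemma bump_nonneg: "bump y r z \<ge> 0"
  by (simp add: bump_def)

lemma bump_pos:
  assumes "z \<in> ball y r"
  shows "bump y r z > 0"
proof -
  have "(norm (z - y))\<^sup>2 < r\<^sup>2"
    using assms by (intro power_strict_mono) (simp_all add: dist_norm norm_minus_commute)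
  then show ?thesis
    unfolding bump_def power2_norm_eq_inner[symmetric] by simp
qed

lemma bump_zero: "r \<ge> 0 \<Longrightarrow> z \<notin> cball y r \<Longrightarrow> bump y r z = 0"
  unfolding bump_def power2_norm_eq_inner[symmetric]
  by (simp add: dist_norm norm_minus_commute max_def power_mono)

lemma times_differentiable_on_bump: "times_differentiable_on 1 UNIV (bump y r)"
  unfolding One_nat_def
proof (rule times_differentiable_on_SucI)
  show "(bump y r has_derivative
      (\<lambda>v. 2 * max 0 (r\<^sup>2 - (z - y) \<bullet> (z - y)) * (- (2 * ((z - y) \<bullet> v))))) (at z)" for z
  proof -
    have "((\<lambda>z. r\<^sup>2 - (z - y) \<bullet> (z - y)) has_derivative (\<lambda>v. - (2 * ((z - y) \<bullet> v)))) (at z)"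
      by (auto intro!: derivative_eq_intros simp: inner_commute)
    from diff_chain_at[OF this positive_part_square_derivative[unfolded has_field_derivative_def]]
    show ?thesis by (simp add: o_def bump_def[abs_def])
  qed
  show "times_differentiable_on 0 UNIV (\<lambda>z. 2 * max 0 (r\<^sup>2 - (z - y) \<bullet> (z - y)) * (- (2 * ((z - y) \<bullet> v))))" for v
    by (auto intro!: continuous_intros)
qed simp

abbreviation chart_inv :: "('a, 'n::finite) chart \<Rightarrow> real^'n \<Rightarrow> 'a" where
  "chart_inv c \<equiv> inv_into (fst c) (snd c)"

definition bump_on :: "('a, 'n::finite) chart \<times> (real^'n) \<times> real \<Rightarrow> 'a \<Rightarrow> real" where
  "bump_on i m = (case i of (c, y, r) \<Rightarrow> if m \<in> fst c then bump y r (snd c m) else 0)"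

lemma bump_on_nonneg: "bump_on i m \<ge> 0"
  by (auto simp: bump_on_def bump_nonneg split: prod.split)

text \<open>The sort \<open>wellorder\<close> of the index type is the one under which the change of
  variables theorem is stated.\<close>

locale manifold =
  fixes X :: "'a topology" and A :: "('a, 'n::{finite,wellorder}) chart set"
  assumes manifold: "smooth_manifold X A"
begin

lemma hausdorff: "Hausdorff_space X"
  and atlas_covers: "(\<Union>c\<in>A. fst c) = topspace X"
  and open_domain: "c \<in> A \<Longrightarrow> openin X (fst c)"
  and open_range: "c \<in> A \<Longrightarrow> open (chart_range c)"
  and chart_homeo: "c \<in> A \<Longrightarrow>
    homeomorphic_map (subtopology X (fst c)) (top_of_set (chart_range c)) (snd c)"
  using manifold unfolding smooth_manifold_def by simp_all

lemma transition_smooth: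
  assumes "c \<in> A" "c' \<in> A"
  shows "times_differentiable_on k (overlap c c') (transition c c')"
proof -
  have "\<forall>c\<in>A. \<forall>c'\<in>A. smooth_on (overlap c c') (transition c c')"
    using manifold unfolding smooth_manifold_def by (elim conjE)
  then show ?thesis using assms unfolding smooth_on_def by blast
qed

lemma domain_topspace: "c \<in> A \<Longrightarrow> topspace (subtopology X (fst c)) = fst c"
  using openin_subset[OF open_domain] by (simp add: Int_absorb1)

lemma chart_inj: "c \<in> A \<Longrightarrow> inj_on (snd c) (fst c)"
  using homeomorphic_imp_injective_map[OF chart_homeo, of c] domain_topspace[of c] by simp

lemma chart_inv_left: "c \<in> A \<Longrightarrow> m \<in> fst c \<Longrightarrow> chart_inv c (snd c m) = m"
  by (rule inv_into_f_f[OF chart_inj])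

lemma chart_inv_right: "x \<in> chart_range c \<Longrightarrow> snd c (chart_inv c x) = x"
  by (rule f_inv_into_f)

lemma chart_inv_domain: "x \<in> chart_range c \<Longrightarrow> chart_inv c x \<in> fst c"
  by (rule inv_into_into)

lemma chart_inv_topspace: "c \<in> A \<Longrightarrow> x \<in> chart_range c \<Longrightarrow> chart_inv c x \<in> topspace X"
  by (rule subsetD[OF openin_subset[OF open_domain] chart_inv_domain])

lemma overlap_iff:
  assumes "c \<in> A"
  shows "x \<in> overlap c c' \<longleftrightarrow> x \<in> chart_range c \<and> chart_inv c x \<in> fst c'"
proof
  assume "x \<in> overlap c c'"
  then obtain m where "m \<in> fst c" "m \<in> fst c'" "x = snd c m" by blast
  then show "x \<in> chart_range c \<and> chart_inv c x \<in> fst c'"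
    using chart_inv_left[OF assms] by simp
next
  assume "x \<in> chart_range c \<and> chart_inv c x \<in> fst c'"
  then show "x \<in> overlap c c'"
    using chart_inv_right[of x c] chart_inv_domain[of x c] by (intro image_eqI[of _ _ "chart_inv c x"]) simp_all
qed

lemma overlap_subset: "overlap c c' \<subseteq> chart_range c"
  by blast

lemma open_chart_image:
  assumes "c \<in> A" "openin X W" "W \<subseteq> fst c"
  shows "open (snd c ` W)"
proof -
  have "open_map (subtopology X (fst c)) (top_of_set (chart_range c)) (snd c)"
    by (rule homeomorphic_imp_open_map[OF chart_homeo[OF assms(1)]])
  moreover have "openin (subtopology X (fst c)) W"
    using assms by (simp add: openin_open_subtopology open_domain)
  ultimately have "openin (top_of_set (chart_range c)) (snd c ` W)"
    unfolding open_map_def by blast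
  then show ?thesis using openin_open_eq[OF open_range[OF assms(1)]] by blast
qed

lemma open_overlap: "c \<in> A \<Longrightarrow> c' \<in> A \<Longrightarrow> open (overlap c c')"
  by (intro open_chart_image openin_Int open_domain) auto

text \<open>The Hausdorff axiom enters here: a closed coordinate ball is compact in
  \<open>X\<close>, hence closed, so that its bump function can be extended by zero into every other
  chart.\<close>

lemma closedin_chart_inv_image:
  assumes "c \<in> A" "compact K" "K \<subseteq> chart_range c"
  shows "closedin X (chart_inv c ` K)"
proof -
  obtain g where g: "homeomorphic_maps (subtopology X (fst c)) (top_of_set (chart_range c)) (snd c) g"
    using chart_homeo[OF assms(1)] homeomorphic_map_maps by blast
  then have gc: "continuous_map (top_of_set (chart_range c)) (subtopology X (fst c)) g"
    and gi: "\<And>m. m \<in> fst c \<Longrightarrow> g (snd c m) = m"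
    using domain_topspace[OF assms(1)] unfolding homeomorphic_maps_def by auto
  have "g x = chart_inv c x" if "x \<in> chart_range c" for x
    using gi[OF chart_inv_domain[OF that]] chart_inv_right[OF that] by simp
  then have "g ` K = chart_inv c ` K" using assms(3) by (auto intro!: image_cong)
  moreover have "compactin (subtopology X (fst c)) (g ` K)"
    using assms by (intro image_compactin[OF _ gc]) (simp add: compactin_subtopology)
  ultimately have "compactin X (chart_inv c ` K)" by (simp add: compactin_subtopology)
  then show ?thesis by (rule compactin_imp_closedin[OF hausdorff])
qed

lemma transition_maps:
  assumes "c \<in> A" "c' \<in> A" "x \<in> overlap c c'"
  shows "transition c c' x \<in> overlap c' c" "chart_inv c' (transition c c' x) = chart_inv c x"
    "transition c' c (transition c c' x) = x"
proof -
  have x: "x \<in> chart_range c" "chart_inv c x \<in> fst c'" using assms overlap_iff by blast+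
  show inv: "chart_inv c' (transition c c' x) = chart_inv c x"
    using chart_inv_left[OF assms(2) x(2)] by simp
  show "transition c c' x \<in> overlap c' c"
    using imageI[of "chart_inv c x" "fst c' \<inter> fst c" "snd c'"] x chart_inv_domain[OF x(1)] by simp
  show "transition c' c (transition c c' x) = x"
    using inv x chart_inv_right by simp
qed

lemma transition_image: 
  assumes "c \<in> A" "c' \<in> A"
  shows "transition c c' ` overlap c c' = overlap c' c"
proof
  show "transition c c' ` overlap c c' \<subseteq> overlap c' c"
    using transition_maps(1)[OF assms] by blast
  show "overlap c' c \<subseteq> transition c c' ` overlap c c'"
    using transition_maps(1)[OF assms(2,1)] transition_maps(3)[OF assms(2,1), symmetric] by (rule_tac subsetI) (rule image_eqI)
qed

lemma transition_has_derivative: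
  assumes "c \<in> A" "c' \<in> A" "x \<in> overlap c c'"
  shows "(transition c c' has_derivative frechet_derivative (transition c c') (at x)) (at x)"
  using times_differentiable_on_has_derivative[OF transition_smooth] assms by blast

text \<open>A triple \<open>(c, y, r)\<close> stands for the ball of radius \<open>r\<close> around \<open>y\<close> in the range of \<open>c\<close>.\<close>

definition coordinate_ball where
  "coordinate_ball i \<longleftrightarrow> (case i of (c, y, r) \<Rightarrow> c \<in> A \<and> 0 < r \<and> cball y r \<subseteq> chart_range c)"

lemma bump_on_support_open:
  assumes "coordinate_ball (c', y, r)" "c \<in> A"
  shows "open (snd c ` (fst c - chart_inv c' ` cball y r))"
    and "x \<in> chart_range c \<Longrightarrow> chart_inv c x \<notin> chart_inv c' ` cball y r \<Longrightarrow>
      x \<in> snd c ` (fst c - chart_inv c' ` cball y r)"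
    and "x \<in> snd c ` (fst c - chart_inv c' ` cball y r) \<Longrightarrow> bump_on (c', y, r) (chart_inv c x) = 0"
proof -
  have a: "c' \<in> A" "0 < r" "cball y r \<subseteq> chart_range c'" using assms(1) by (simp_all add: coordinate_ball_def)
  have "closedin X (chart_inv c' ` cball y r)"
    by (rule closedin_chart_inv_image[OF a(1) _ a(3)]) simp
  then show "open (snd c ` (fst c - chart_inv c' ` cball y r))"
    by (intro open_chart_image assms openin_diff open_domain) auto
  show "x \<in> chart_range c \<Longrightarrow> chart_inv c x \<notin> chart_inv c' ` cball y r \<Longrightarrow>
      x \<in> snd c ` (fst c - chart_inv c' ` cball y r)"
    using chart_inv_domain[of x c] chart_inv_right[of x c] by (intro image_eqI[of _ _ "chart_inv c x"]) simp_all
  assume "x \<in> snd c ` (fst c - chart_inv c' ` cball y r)"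
  then obtain m where m: "m \<in> fst c" "m \<notin> chart_inv c' ` cball y r" "x = snd c m" by blast
  have "snd c' m \<notin> cball y r" if "m \<in> fst c'"
    using m(2) chart_inv_left[OF a(1) that] image_eqI[of m "chart_inv c'" "snd c' m" "cball y r"] by auto
  then show "bump_on (c', y, r) (chart_inv c x) = 0"
    using a(2) by (simp add: bump_on_def m(3) chart_inv_left[OF assms(2) m(1)] bump_zero)
qed

text \<open>On the overlap with its own chart the function is a bump composed with a transition map,
  and off the closed coordinate ball it is zero. These two open sets cover the range of
  \<open>c\<close>.\<close>

lemma times_differentiable_on_bump_on:
  assumes "coordinate_ball i" "c \<in> A"
  shows "times_differentiable_on 1 (chart_range c) (\<lambda>x. bump_on i (chart_inv c x))"
proof -
  obtain c' y r where i: "i = (c', y, r)" by (cases i)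
  have c': "c' \<in> A" using assms(1) by (simp add: i coordinate_ball_def)
  note so = bump_on_support_open[OF assms(1)[unfolded i] assms(2)]
  let ?f = "\<lambda>x. bump_on i (chart_inv c x)"
  have "times_differentiable_on 1 (overlap c c') (\<lambda>x. bump y r (transition c c' x))"
    by (rule times_differentiable_on_compose(1)[OF open_overlap[OF assms(2) c'] open_UNIV
          transition_smooth[OF assms(2) c'] times_differentiable_on_bump]) auto
  then have 1: "times_differentiable_on 1 (overlap c c') ?f"
    by (rule times_differentiable_on_cong[OF open_overlap[OF assms(2) c'], rotated])
      (simp add: i bump_on_def overlap_iff[OF assms(2)])
  have 2: "times_differentiable_on 1 (snd c ` (fst c - chart_inv c' ` cball y r)) ?f"
    by (rule times_differentiable_on_cong[OF so(1) _ times_differentiable_on_const[of _ _ 0]])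
      (simp add: i so(3))
  have "chart_range c \<subseteq> overlap c c' \<union> snd c ` (fst c - chart_inv c' ` cball y r)"
  proof
    fix x assume x: "x \<in> chart_range c"
    show "x \<in> overlap c c' \<union> snd c ` (fst c - chart_inv c' ` cball y r)"
    proof (cases "chart_inv c x \<in> fst c'")
      case True
      then show ?thesis using x overlap_iff[OF assms(2)] by blast
    next
      case False
      have "cball y r \<subseteq> chart_range c'"
        using assms(1) by (simp add: i coordinate_ball_def)
      then have "chart_inv c' ` cball y r \<subseteq> fst c'"
        using chart_inv_domain[of _ c'] by (intro image_subsetI) (rule chart_inv_domain, rule subsetD)
      with False have "chart_inv c x \<notin> chart_inv c' ` cball y r" by blast
      then show ?thesis using so(2)[OF x] by blast
    qed
  qed
  then show ?thesis
    using times_differentiable_on_subset[OF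
        times_differentiable_on_Un[OF open_overlap[OF assms(2) c'] so(1) 1 2]] by blast
qed

lemma finite_bump_cover:
  assumes "compact_space X"
  obtains I where "finite I" "\<And>i. i \<in> I \<Longrightarrow> coordinate_ball i"
    "\<And>m. m \<in> topspace X \<Longrightarrow> \<exists>i\<in>I. bump_on i m > 0"
proof -
  define U where "U i = (case i of (c, y, r) \<Rightarrow> chart_inv c ` ball y r)"
    for i :: "('a, 'n) chart \<times> (real, 'n) vec \<times> real"
  have U: "openin X (U i)" "\<And>m. m \<in> U i \<Longrightarrow> bump_on i m > 0" if "coordinate_ball i" for i
  proof -
    obtain c y r where i: "i = (c, y, r)" by (cases i)
    have a: "c \<in> A" "0 < r" "cball y r \<subseteq> chart_range c" using that by (simp_all add: i coordinate_ball_def)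
    have b: "ball y r \<subseteq> chart_range c" using a(3) ball_subset_cball by blast
    have eq: "U i = {m \<in> topspace (subtopology X (fst c)). snd c m \<in> ball y r}"
      unfolding U_def i prod.case domain_topspace[OF a(1)]
    proof (intro set_eqI iffI)
      fix m assume "m \<in> chart_inv c ` ball y r"
      then obtain z where z: "z \<in> ball y r" "m = chart_inv c z" by blast
      then have "z \<in> chart_range c" using b by blast
      from chart_inv_right[OF this] chart_inv_domain[OF this]
      show "m \<in> {m \<in> fst c. snd c m \<in> ball y r}"
        using z by simp
    next
      fix m assume "m \<in> {m \<in> fst c. snd c m \<in> ball y r}"
      then show "m \<in> chart_inv c ` ball y r"
        using chart_inv_left[OF a(1), of m] by (intro image_eqI[of _ _ "snd c m"]) simp_all
    qed
    have "continuous_map (subtopology X (fst c)) (top_of_set (chart_range c)) (snd c)"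
      by (rule homeomorphic_imp_continuous_map[OF chart_homeo[OF a(1)]])
    then have "openin (subtopology X (fst c)) (U i)"
      unfolding eq by (rule openin_continuous_map_preimage) (use b in \<open>auto intro: open_subset\<close>)
    then show "openin X (U i)" using openin_trans_full open_domain[OF a(1)] by blast
    show "bump_on i m > 0" if "m \<in> U i" for m
      using that unfolding eq domain_topspace[OF a(1)] by (auto simp: bump_on_def i intro: bump_pos)
  qed
  have cover: "\<exists>i. coordinate_ball i \<and> m \<in> U i" if m: "m \<in> topspace X" for m
  proof -
    obtain c where c: "c \<in> A" "m \<in> fst c" using m unfolding atlas_covers[symmetric] by blast
    then have "snd c m \<in> chart_range c" by blast
    then obtain r where r: "r > 0" "cball (snd c m) r \<subseteq> chart_range c"
      using open_range[OF c(1)] unfolding open_contains_cball by blast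
    have "coordinate_ball (c, snd c m, r)" using c r by (simp add: coordinate_ball_def)
    moreover have "m \<in> U (c, snd c m, r)"
      using r(1) chart_inv_left[OF c] unfolding U_def prod.case by (intro image_eqI[of _ _ "snd c m"]) simp_all
    ultimately show ?thesis by blast
  qed
  have "topspace X \<subseteq> \<Union>(U ` Collect coordinate_ball)" using cover by blast
  moreover have "compactin X (topspace X)" using assms by (simp add: compact_space_def)
  ultimately obtain \<F> where "finite \<F>" "\<F> \<subseteq> U ` Collect coordinate_ball" "topspace X \<subseteq> \<Union>\<F>"
    using compactinD[of X "topspace X" "U ` Collect coordinate_ball"] U(1) by blast
  then obtain I where I: "finite I" "I \<subseteq> Collect coordinate_ball" "\<F> = U ` I"
    by (metis finite_subset_image)
  show ?thesis
  proof (rule that[OF I(1)])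
    show "\<exists>i\<in>I. bump_on i m > 0" if "m \<in> topspace X" for m
      using that U(2) I \<open>topspace X \<subseteq> \<Union>\<F>\<close> by blast
  qed (use I in blast)
qed

end

section \<open>Divergence of a vector field with respect to a density\<close>

locale flux_field = manifold X A
  for X :: "'a topology" and A :: "('a, 'n::{finite,wellorder}) chart set" +
  fixes \<mu> :: "('a, 'n) chart \<Rightarrow> (real, 'n) vec \<Rightarrow> real"
    and V :: "('a, 'n) chart \<Rightarrow> (real, 'n) vec \<Rightarrow> (real, 'n) vec"
  assumes density_transition: "\<And>c c' x. c \<in> A \<Longrightarrow> c' \<in> A \<Longrightarrow> x \<in> overlap c c' \<Longrightarrow>
      \<mu> c x = \<bar>det (matrix (frechet_derivative (transition c c') (at x)))\<bar> * \<mu> c' (transition c c' x)"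
    and field_transition: "\<And>c c' x. c \<in> A \<Longrightarrow> c' \<in> A \<Longrightarrow> x \<in> overlap c c' \<Longrightarrow>
      frechet_derivative (transition c c') (at x) (V c x) = V c' (transition c c' x)"
    and flux_differentiable: "\<And>c a. c \<in> A \<Longrightarrow>
      times_differentiable_on 1 (chart_range c) (\<lambda>x. \<mu> c x * V c x $ a)"
begin

definition flux_div where
  "flux_div c x = (\<Sum>a\<in>UNIV. frechet_derivative (\<lambda>y. \<mu> c y * V c y $ a) (at x) (axis a 1))"

text \<open>This is \<mu> du(V), a function times a density, so its integral does not depend on the
  chart.\<close>

definition flux_deriv where
  "flux_deriv u c x = \<mu> c x * frechet_derivative (\<lambda>y. u (chart_inv c y)) (at x) (V c x)"

definition C1_function where
  "C1_function u \<longleftrightarrow> (\<forall>c\<in>A. times_differentiable_on 1 (chart_range c) (\<lambda>x. u (chart_inv c x) :: real))"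

lemma C1_functionD:
  assumes "C1_function u" "c \<in> A"
  shows "times_differentiable_on 1 (chart_range c) (\<lambda>x. u (chart_inv c x))"
    "continuous_on (chart_range c) (\<lambda>x. u (chart_inv c x))"
    "x \<in> chart_range c \<Longrightarrow> ((\<lambda>x. u (chart_inv c x)) has_derivative
       frechet_derivative (\<lambda>x. u (chart_inv c x)) (at x)) (at x)"
proof -
  show 1: "times_differentiable_on 1 (chart_range c) (\<lambda>x. u (chart_inv c x))"
    using assms unfolding C1_function_def by blast
  show "continuous_on (chart_range c) (\<lambda>x. u (chart_inv c x))"
    by (rule times_differentiable_on_1D(1)[OF 1])
  show "x \<in> chart_range c \<Longrightarrow> ((\<lambda>x. u (chart_inv c x)) has_derivative
       frechet_derivative (\<lambda>x. u (chart_inv c x)) (at x)) (at x)"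
    by (rule times_differentiable_on_1D(3)[OF 1])
qed

lemma flux_deriv_expand:
  assumes "C1_function u" "c \<in> A" "x \<in> chart_range c"
  shows "flux_deriv u c x = (\<Sum>a\<in>UNIV. (\<mu> c x * V c x $ a) *
    frechet_derivative (\<lambda>y. u (chart_inv c y)) (at x) (axis a 1))"
  unfolding flux_deriv_def
    linear_euclidean_expand[OF has_derivative_linear[OF C1_functionD(3)[OF assms]], of "V c x"]
  by (simp add: sum_distrib_left mult.assoc)

lemma continuous_on_flux_deriv:
  assumes "C1_function u" "c \<in> A"
  shows "continuous_on (chart_range c) (flux_deriv u c)"
proof -
  have 1: "continuous_on (chart_range c) (\<lambda>x. \<mu> c x * V c x $ a)" for a
    by (rule times_differentiable_on_1D(1)[OF flux_differentiable[OF assms(2)]])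
  have 2: "continuous_on (chart_range c) (\<lambda>x. frechet_derivative (\<lambda>y. u (chart_inv c y)) (at x) v)" for v
    by (rule times_differentiable_on_1D(2)[OF C1_functionD(1)[OF assms]])
  have "continuous_on (chart_range c) (\<lambda>x. \<Sum>a\<in>UNIV. (\<mu> c x * V c x $ a) *
    frechet_derivative (\<lambda>y. u (chart_inv c y)) (at x) (axis a 1))"
    by (intro continuous_on_sum continuous_on_mult[OF 1 2])
  moreover have "continuous_on (chart_range c) (flux_deriv u c) \<longleftrightarrow>
      continuous_on (chart_range c) (\<lambda>x. \<Sum>a\<in>UNIV. (\<mu> c x * V c x $ a) *
    frechet_derivative (\<lambda>y. u (chart_inv c y)) (at x) (axis a 1))"
    by (rule continuous_on_cong[OF refl flux_deriv_expand[OF assms]])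
  ultimately show ?thesis by simp
qed

lemma continuous_on_flux_div:
  assumes "c \<in> A"
  shows "continuous_on (chart_range c) (flux_div c)"
  unfolding flux_div_def[abs_def] 
  by (intro continuous_on_sum times_differentiable_on_1D(2)[OF flux_differentiable[OF assms]])

lemma flux_deriv_transition:
  assumes "C1_function u" "c \<in> A" "c' \<in> A" "x \<in> overlap c c'"
  shows "flux_deriv u c x =
    \<bar>det (matrix (frechet_derivative (transition c c') (at x)))\<bar> * flux_deriv u c' (transition c c' x)"
proof -
  let ?T = "transition c c'"
  have Tx: "?T x \<in> chart_range c'" using transition_maps(1)[OF assms(2-4)] by blast
  have "frechet_derivative (\<lambda>y. u (chart_inv c y)) (at x) =
      frechet_derivative (\<lambda>y. u (chart_inv c' (?T y))) (at x)"
    by (rule frechet_derivative_cong_open[OF open_overlap[OF assms(2,3)] assms(4)])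
      (rule arg_cong[where f=u], rule transition_maps(2)[OF assms(2,3), symmetric])
  also have "\<dots> = (\<lambda>v. frechet_derivative (\<lambda>y. u (chart_inv c' y)) (at (?T x)) (frechet_derivative ?T (at x) v))"
    using diff_chain_at[OF transition_has_derivative[OF assms(2-4)] C1_functionD(3)[OF assms(1,3) Tx]]
    unfolding o_def[of "\<lambda>y. u (chart_inv c' y)"] by (intro frechet_derivative_eq) (simp add: o_def)
  finally show ?thesis
    unfolding flux_deriv_def density_transition[OF assms(2-4)] by (simp add: field_transition[OF assms(2-4)])
qed

lemma flux_deriv_eq_0:
  assumes "open S" "x \<in> S" "\<And>y. y \<in> S \<Longrightarrow> u (chart_inv c y) = 0"
  shows "flux_deriv u c x = 0"
  using frechet_derivative_cong_open[OF assms(1,2), of "\<lambda>y. u (chart_inv c y)" "\<lambda>_. 0"] assms(3)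
  by (simp add: flux_deriv_def)

text \<open>Integration by parts: the integrand is the divergence of \<open>u\<close> times the
  flux, and the zero extension of that field is compactly supported on the whole space.\<close>

lemma integral_flux_compact_support:
  assumes u: "C1_function u" and c: "c \<in> A"
    and K: "compact K" "K \<subseteq> chart_range c" "\<And>x. x \<in> chart_range c \<Longrightarrow> x \<notin> K \<Longrightarrow> u (chart_inv c x) = 0"
  shows "integral (chart_range c) (\<lambda>x. u (chart_inv c x) * flux_div c x + flux_deriv u c x) = 0"
proof -
  let ?R = "chart_range c"
  let ?u = "\<lambda>x. u (chart_inv c x)"
  let ?P = "\<lambda>a x. \<mu> c x * V c x $ a"
  let ?Q = "\<lambda>a x. if x \<in> ?R then ?u x * ?P a x else 0"
  have Q1: "times_differentiable_on 1 ?R (\<lambda>x. ?u x * ?P a x)" for a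
    by (intro times_differentiable_on_mult open_range c C1_functionD(1)[OF u] flux_differentiable)
  have Q: "times_differentiable_on 1 UNIV (?Q a)" for a
    by (rule times_differentiable_on_zero_extension[OF open_range[OF c] K(1,2) Q1]) (simp add: K(3))
  have "((\<lambda>x. frechet_derivative (?Q a) (at x) (axis a 1)) has_integral 0) UNIV" for a
    by (rule integral_derivative_compact_support[OF Q K(1)]) (use K(3) in auto)
  then have "((\<lambda>x. \<Sum>a\<in>UNIV. frechet_derivative (?Q a) (at x) (axis a 1)) has_integral (\<Sum>a\<in>(UNIV::'n set). 0)) UNIV"
    by (intro has_integral_sum) auto
  moreover have "(\<Sum>a\<in>UNIV. frechet_derivative (?Q a) (at x) (axis a 1)) =
      (if x \<in> ?R then ?u x * flux_div c x + flux_deriv u c x else 0)" for x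
  proof (cases "x \<in> ?R")
    case True
    have "frechet_derivative (?Q a) (at x) = frechet_derivative (\<lambda>x. ?u x * ?P a x) (at x)" for a
      by (rule frechet_derivative_cong_open[OF open_range[OF c] True]) simp
    also have "frechet_derivative (\<lambda>x. ?u x * ?P a x) (at x) =
        (\<lambda>v. ?u x * frechet_derivative (?P a) (at x) v + frechet_derivative ?u (at x) v * ?P a x)" for a
      by (intro frechet_derivative_eq has_derivative_mult C1_functionD(3)[OF u c True]
          times_differentiable_on_1D(3)[OF flux_differentiable[OF c] True])
    finally show ?thesis
      using True by (simp add: flux_div_def flux_deriv_expand[OF u c True] sum.distrib sum_distrib_left mult.commute)
  next
    case False
    have o: "open (- K)" using compact_imp_closed[OF K(1)] by (simp add: open_Compl)
    have "frechet_derivative (?Q a) (at x) = frechet_derivative (\<lambda>_. 0) (at x)" for a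
      by (rule frechet_derivative_cong_open[OF o]) (use False K in auto)
    then show ?thesis using False by simp
  qed
  ultimately have "((\<lambda>x. if x \<in> ?R then ?u x * flux_div c x + flux_deriv u c x else 0) has_integral 0) UNIV"
    by simp
  then show ?thesis
    unfolding has_integral_restrict_UNIV by (rule integral_unique)
qed

text \<open>The determinant factor of \<open>flux_deriv_transition\<close> is the Jacobian of the
  change of variables. The hypotheses \<open>off\<close> confine both integrals to the overlap,
  where the transition map lives.\<close>

lemma integral_flux_deriv_transition:
  assumes u: "C1_function u" and c: "c \<in> A" "c' \<in> A"
    and int: "(\<lambda>x. v (chart_inv c x) * flux_deriv u c x) absolutely_integrable_on chart_range c"
    and off: "\<And>x. x \<in> chart_range c \<Longrightarrow> x \<notin> overlap c c' \<Longrightarrow> v (chart_inv c x) * flux_deriv u c x = 0"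
      "\<And>x. x \<in> chart_range c' \<Longrightarrow> x \<notin> overlap c' c \<Longrightarrow> v (chart_inv c' x) * flux_deriv u c' x = 0"
  shows "integral (chart_range c) (\<lambda>x. v (chart_inv c x) * flux_deriv u c x) =
    integral (chart_range c') (\<lambda>x. v (chart_inv c' x) * flux_deriv u c' x)"
proof -
  let ?T = "transition c c'" and ?S = "overlap c c'"
  let ?f = "\<lambda>c x. v (chart_inv c x) * flux_deriv u c x"
  \<comment> \<open>The scalar integrand is wrapped in \<open>real^1\<close> to fit the
    vector-valued change of variables theorem.\<close>
  define F where "F c x = (vec (?f c x) :: real^1)" for c x
  let ?G = "\<lambda>x. \<bar>det (matrix (frechet_derivative ?T (at x)))\<bar> *\<^sub>R F c' (?T x)"
  have restrict: "integral (chart_range c) (?f c) = integral (overlap c c') (?f c)"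
    if "\<And>x. x \<in> chart_range c \<Longrightarrow> x \<notin> overlap c c' \<Longrightarrow> ?f c x = 0" for c c'
  proof -
    have "(\<lambda>x. if x \<in> chart_range c then ?f c x else 0) = (\<lambda>x. if x \<in> overlap c c' then ?f c x else 0)"
    proof
      fix x
      show "(if x \<in> chart_range c then ?f c x else 0) = (if x \<in> overlap c c' then ?f c x else 0)"
        using that[of x] overlap_subset[of c c'] by (cases "x \<in> overlap c c'") auto
    qed
    then show ?thesis
      using integral_restrict_UNIV[of "chart_range c" "?f c"] integral_restrict_UNIV[of "overlap c c'" "?f c"]
      by simp
  qed
  have meas: "?S \<in> sets lebesgue"
    using open_overlap[OF c] by (simp add: borel_open)
  have G: "?G x = F c x" if "x \<in> ?S" for x
    unfolding F_def flux_deriv_transition[OF u c that]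
    by (simp only: transition_maps(2)[OF c that]) (simp add: vec_eq_iff)
  have "(F c) absolutely_integrable_on chart_range c"
    unfolding absolutely_integrable_on_1_iff F_def using int by simp
  then have Fint: "(F c) absolutely_integrable_on ?S"
    by (rule set_integrable_subset[OF _ meas overlap_subset])
  have "?G absolutely_integrable_on ?S"
    by (rule set_integrable_cong[OF refl refl, THEN iffD2, OF G Fint])
  then have "integral (?T ` ?S) (F c') = integral ?S ?G"
    using has_derivative_at_withinI[OF transition_has_derivative[OF c]]
      inj_on_inverseI[of ?S "transition c' c" ?T, OF transition_maps(3)[OF c]]
    by (intro integral_change_of_variables[OF meas]) auto
  also have "\<dots> = integral ?S (F c)"
    by (rule integral_cong) (simp only: G)
  finally have "integral (overlap c' c) (F c') = integral ?S (F c)"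
    unfolding transition_image[OF c] .
  then have "integral (overlap c' c) (?f c') = integral ?S (?f c)"
    unfolding F_def integral_on_1_eq by (simp add: vec_eq_iff)
  then show ?thesis
    using restrict[OF off(1)] restrict[OF off(2)] by simp
qed

text \<open>With a partition of unity \<open>\<rho>\<^sub>i\<close> subordinate to coordinate balls, integration by parts turns
  \<open>\<Sum>\<^sub>i \<integral> \<rho>\<^sub>i div V\<close>, computed in the \<open>i\<close>-th chart, into \<open>-\<Sum>\<^sub>i\<^sub>j \<integral> \<rho>\<^sub>j d\<rho>\<^sub>i(V)\<close>. These integrals do not depend
  on the chart, so the sum over \<open>i\<close> can be taken first, and \<open>\<Sum>\<^sub>i d\<rho>\<^sub>i = 0\<close>. In this way the divergence is never
  compared in different charts. A ball around \<open>x0\<close> in the chart \<open>c0\<close> is added to the cover to reach that point.\<close>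

theorem flux_div_eq_0:
  assumes cpt: "compact_space X" and nonneg: "\<And>c x. c \<in> A \<Longrightarrow> x \<in> chart_range c \<Longrightarrow> flux_div c x \<ge> 0"
    and c0: "c0 \<in> A" "x0 \<in> chart_range c0"
  shows "flux_div c0 x0 = 0"
proof -
  obtain I0 where I0: "finite I0" "\<And>i. i \<in> I0 \<Longrightarrow> coordinate_ball i"
    "\<And>m. m \<in> topspace X \<Longrightarrow> \<exists>i\<in>I0. bump_on i m > 0"
    by (rule finite_bump_cover[OF cpt]) blast
  obtain r0 where r0: "r0 > 0" "cball x0 r0 \<subseteq> chart_range c0"
    using open_range[OF c0(1)] c0(2) unfolding open_contains_cball by blast
  define i0 where "i0 = (c0, x0, r0)"
  define I where "I = insert i0 I0"
  have finI: "finite I" using I0(1) by (simp add: I_def)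
  have ball: "coordinate_ball i" if "i \<in> I" for i
  proof (cases "i = i0")
    case True
    then show ?thesis using c0(1) r0 by (simp add: i0_def coordinate_ball_def)
  next
    case False
    then show ?thesis using that by (intro I0(2)) (simp add: I_def)
  qed
  define s where "s m = (\<Sum>i\<in>I. bump_on i m)" for m
  have s_pos: "s m > 0" if m: "m \<in> topspace X" for m
  proof -
    obtain i where "i \<in> I0" "bump_on i m > 0" using I0(3)[OF m] by blast
    then show ?thesis
      unfolding s_def using finI by (intro sum_pos2[of _ i]) (auto simp: I_def bump_on_nonneg)
  qed
  define \<rho> where "\<rho> i m = bump_on i m / s m" for i :: "('a, 'n) chart \<times> (real, 'n) vec \<times> real" and m
  have chi_sum: "(\<Sum>i\<in>I. \<rho> i m) = 1" if "m \<in> topspace X" for m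
    using s_pos[OF that] unfolding \<rho>_def sum_divide_distrib[symmetric] s_def[symmetric] by simp
  have chi_C1: "C1_function (\<rho> i)" if "i \<in> I" for i
    unfolding C1_function_def
  proof
    fix c assume c: "c \<in> A"
    have "s (chart_inv c x) \<noteq> 0" if "x \<in> chart_range c" for x
      using s_pos[OF chart_inv_topspace[OF c that]] by simp
    then show "times_differentiable_on 1 (chart_range c) (\<lambda>x. \<rho> i (chart_inv c x))"
      unfolding \<rho>_def s_def
      by (intro times_differentiable_on_divide times_differentiable_on_sum
          times_differentiable_on_bump_on[OF ball c] open_range[OF c] that)
  qed
  define C where "C i = fst i" for i :: "('a, 'n) chart \<times> (real, 'n) vec \<times> real"
  define K where "K i = cball (fst (snd i)) (snd (snd i))" for i :: "('a, 'n) chart \<times> (real, 'n) vec \<times> real"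
  have CA: "C i \<in> A" and K: "compact (K i)" "K i \<subseteq> chart_range (C i)" if "i \<in> I" for i
    using ball[OF that] by (auto simp: coordinate_ball_def C_def K_def split: prod.splits)
  have chi_zero: "\<rho> i (chart_inv (C i) x) = 0" if "i \<in> I" "x \<in> chart_range (C i)" "x \<notin> K i" for i x
    using ball[OF that(1)] that(3) chart_inv_right[OF that(2)]
    by (auto simp: \<rho>_def bump_on_def coordinate_ball_def C_def K_def bump_zero split: prod.splits)
  have chi_off: "\<rho> i m = 0" if "m \<notin> fst (C i)" for i m
    using that by (auto simp: \<rho>_def bump_on_def C_def split: prod.splits)
  have fd_zero: "flux_deriv (\<rho> i) (C i) x = 0" if "i \<in> I" "x \<in> chart_range (C i)" "x \<notin> K i" for i x
    by (rule flux_deriv_eq_0[of "chart_range (C i) - K i"])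
      (use that chi_zero open_range[OF CA[OF that(1)]] compact_imp_closed[OF K(1)[OF that(1)]] in auto)
  \<comment> \<open>A derivative is involved, so vanishing at one point is not enough: the function
    is zero on the open complement of its closed ball, which contains the point.\<close>
  have fd_off: "flux_deriv (\<rho> i) c x = 0" if "i \<in> I" "c \<in> A" "x \<in> chart_range c" "chart_inv c x \<notin> fst (C i)" for i c x
  proof -
    obtain c' y r where i: "i = (c', y, r)" by (cases i)
    note b = ball[OF that(1), unfolded i]
    have "cball y r \<subseteq> chart_range c'" using b by (simp add: coordinate_ball_def)
    then have "chart_inv c' ` cball y r \<subseteq> fst c'"
      by (intro image_subsetI) (rule chart_inv_domain, rule subsetD)
    then have "chart_inv c x \<notin> chart_inv c' ` cball y r" using that(4) by (auto simp: i C_def)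
    note S = bump_on_support_open(1)[OF b that(2)] bump_on_support_open(2)[OF b that(2,3) this]
    have "\<rho> i (chart_inv c z) = 0" if "z \<in> snd c ` (fst c - chart_inv c' ` cball y r)" for z
      using bump_on_support_open(3)[OF b \<open>c \<in> A\<close> that] by (simp add: \<rho>_def i)
    then show ?thesis by (rule flux_deriv_eq_0[OF S])
  qed
  note cont = C1_functionD(2)[OF chi_C1] continuous_on_flux_deriv[OF chi_C1] continuous_on_flux_div
  note abs_int = absolutely_integrable_compact_support[OF open_range[OF CA] _ K]
  have int1: "(\<lambda>x. \<rho> i (chart_inv (C i) x) * flux_div (C i) x) absolutely_integrable_on chart_range (C i)" if "i \<in> I" for i
    by (rule abs_int[OF that _ that that]) (use that chi_zero in \<open>auto intro!: continuous_on_mult cont CA\<close>)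
  have int2: "flux_deriv (\<rho> i) (C i) absolutely_integrable_on chart_range (C i)" if "i \<in> I" for i
    by (rule abs_int[OF that _ that that]) (use that fd_zero in \<open>auto intro!: cont CA\<close>)
  have int3: "(\<lambda>x. \<rho> j (chart_inv (C i) x) * flux_deriv (\<rho> i) (C i) x) absolutely_integrable_on chart_range (C i)"
    if "i \<in> I" "j \<in> I" for i j
    by (rule abs_int[OF that(1) _ that(1) that(1)]) (use that fd_zero in \<open>auto intro!: continuous_on_mult cont CA\<close>)
  have int4: "(\<lambda>x. \<rho> j (chart_inv (C j) x) * flux_deriv (\<rho> i) (C j) x) absolutely_integrable_on chart_range (C j)"
    if "i \<in> I" "j \<in> I" for i j
    by (rule abs_int[OF that(2) _ that(2) that(2)]) (use that chi_zero in \<open>auto intro!: continuous_on_mult cont CA\<close>)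
  note integrable = set_lebesgue_integral_eq_integral(1)
  have stokes: "integral (chart_range (C i)) (\<lambda>x. \<rho> i (chart_inv (C i) x) * flux_div (C i) x)
      + integral (chart_range (C i)) (flux_deriv (\<rho> i) (C i)) = 0" if "i \<in> I" for i
    using integral_flux_compact_support[OF chi_C1[OF that] CA[OF that] K[OF that] chi_zero[OF that]]
      integral_add[OF integrable[OF int1[OF that]] integrable[OF int2[OF that]]] by simp
  \<comment> \<open>Insert the sum of all \<rho>, which is 1, and move the \<open>j\<close>-th
    summand to the chart of \<open>j\<close>, where its support is compact.\<close>
  have split: "integral (chart_range (C i)) (flux_deriv (\<rho> i) (C i)) =
      (\<Sum>j\<in>I. integral (chart_range (C j)) (\<lambda>x. \<rho> j (chart_inv (C j) x) * flux_deriv (\<rho> i) (C j) x))"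
    if i: "i \<in> I" for i
  proof -
    have "integral (chart_range (C i)) (flux_deriv (\<rho> i) (C i)) =
      integral (chart_range (C i)) (\<lambda>x. \<Sum>j\<in>I. \<rho> j (chart_inv (C i) x) * flux_deriv (\<rho> i) (C i) x)"
      by (rule integral_cong)
        (simp only: sum_distrib_right[symmetric] chi_sum[OF chart_inv_topspace[OF CA[OF i]]] mult_1_left)
    also have "\<dots> = (\<Sum>j\<in>I. integral (chart_range (C i)) (\<lambda>x. \<rho> j (chart_inv (C i) x) * flux_deriv (\<rho> i) (C i) x))"
      by (rule integral_sum[OF finI]) (rule integrable[OF int3[OF i]])
    also have "\<dots> = (\<Sum>j\<in>I. integral (chart_range (C j)) (\<lambda>x. \<rho> j (chart_inv (C j) x) * flux_deriv (\<rho> i) (C j) x))"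
    proof (rule sum.cong[OF refl], rule integral_flux_deriv_transition[OF chi_C1[OF i] CA[OF i] CA int3[OF i]])
      fix j x assume j: "j \<in> I"
      show "\<rho> j (chart_inv (C i) x) * flux_deriv (\<rho> i) (C i) x = 0"
        if "x \<in> chart_range (C i)" "x \<notin> overlap (C i) (C j)"
        using that overlap_iff[OF CA[OF i]] chi_off by (metis mult_zero_left)
      show "\<rho> j (chart_inv (C j) x) * flux_deriv (\<rho> i) (C j) x = 0"
        if "x \<in> chart_range (C j)" "x \<notin> overlap (C j) (C i)"
        using that overlap_iff[OF CA[OF j]] fd_off[OF i CA[OF j]] by (metis mult_zero_right)
    qed
    finally show ?thesis .
  qed
  have cancel: "(\<Sum>i\<in>I. integral (chart_range (C j)) (\<lambda>x. \<rho> j (chart_inv (C j) x) * flux_deriv (\<rho> i) (C j) x)) = 0"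
    if j: "j \<in> I" for j
  proof -
    have z: "(\<Sum>i\<in>I. flux_deriv (\<rho> i) (C j) x) = 0" if x: "x \<in> chart_range (C j)" for x
    proof -
      have "((\<lambda>y. \<Sum>i\<in>I. \<rho> i (chart_inv (C j) y)) has_derivative
        (\<lambda>v. \<Sum>i\<in>I. frechet_derivative (\<lambda>y. \<rho> i (chart_inv (C j) y)) (at x) v)) (at x)"
        by (rule has_derivative_sum) (rule C1_functionD(3)[OF chi_C1 CA[OF j] x])
      then have "frechet_derivative (\<lambda>y. \<Sum>i\<in>I. \<rho> i (chart_inv (C j) y)) (at x) =
        (\<lambda>v. \<Sum>i\<in>I. frechet_derivative (\<lambda>y. \<rho> i (chart_inv (C j) y)) (at x) v)"
        by (rule frechet_derivative_eq)
      moreover have "frechet_derivative (\<lambda>y. \<Sum>i\<in>I. \<rho> i (chart_inv (C j) y)) (at x) = frechet_derivative (\<lambda>y. 1) (at x)"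
        by (rule frechet_derivative_cong_open[OF open_range[OF CA[OF j]] x])
          (rule chi_sum[OF chart_inv_topspace[OF CA[OF j]]])
      ultimately have "(\<Sum>i\<in>I. frechet_derivative (\<lambda>y. \<rho> i (chart_inv (C j) y)) (at x) v) = 0" for v
        by (metis frechet_derivative_const)
      then show ?thesis by (simp add: flux_deriv_def sum_distrib_left[symmetric])
    qed
    have "(\<Sum>i\<in>I. integral (chart_range (C j)) (\<lambda>x. \<rho> j (chart_inv (C j) x) * flux_deriv (\<rho> i) (C j) x)) =
      integral (chart_range (C j)) (\<lambda>x. \<Sum>i\<in>I. \<rho> j (chart_inv (C j) x) * flux_deriv (\<rho> i) (C j) x)"
      by (rule integral_sum[OF finI, symmetric]) (rule integrable[OF int4[OF _ j]])
    also have "\<dots> = integral (chart_range (C j)) (\<lambda>x. 0)"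
      by (rule integral_cong) (simp only: sum_distrib_left[symmetric] z mult_zero_right)
    finally show ?thesis by simp
  qed
  have "(\<Sum>i\<in>I. integral (chart_range (C i)) (flux_deriv (\<rho> i) (C i))) =
      (\<Sum>j\<in>I. \<Sum>i\<in>I. integral (chart_range (C j)) (\<lambda>x. \<rho> j (chart_inv (C j) x) * flux_deriv (\<rho> i) (C j) x))"
    by (simp only: split sum.cong[OF refl split]) (rule sum.swap)
  also have "\<dots> = 0" by (simp only: cancel sum.cong[OF refl cancel] sum.neutral_const)
  finally have "(\<Sum>i\<in>I. integral (chart_range (C i)) (flux_deriv (\<rho> i) (C i))) = 0" .
  moreover have "(\<Sum>i\<in>I. integral (chart_range (C i)) (\<lambda>x. \<rho> i (chart_inv (C i) x) * flux_div (C i) x)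
      + integral (chart_range (C i)) (flux_deriv (\<rho> i) (C i))) = 0"
    by (rule sum.neutral) (use stokes in blast)
  ultimately have total: "(\<Sum>i\<in>I. integral (chart_range (C i)) (\<lambda>x. \<rho> i (chart_inv (C i) x) * flux_div (C i) x)) = 0"
    by (simp add: sum.distrib)
  have chi_nonneg: "\<rho> i m \<ge> 0" if "m \<in> topspace X" for i m
    using s_pos[OF that] bump_on_nonneg[of i m] by (simp add: \<rho>_def)
  have term_nonneg: "\<rho> i (chart_inv (C i) x) * flux_div (C i) x \<ge> 0" if "i \<in> I" "x \<in> chart_range (C i)" for i x
    using chi_nonneg[OF chart_inv_topspace[OF CA[OF that(1)] that(2)]] nonneg[OF CA[OF that(1)] that(2)]
    by (rule mult_nonneg_nonneg)
  have "integral (chart_range (C i)) (\<lambda>x. \<rho> i (chart_inv (C i) x) * flux_div (C i) x) \<ge> 0" if "i \<in> I" for i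
    by (rule integral_nonneg[OF integrable[OF int1[OF that]]]) (rule term_nonneg[OF that])
  \<comment> \<open>The integrals are nonnegative with sum zero, so each vanishes, in particular the
    one over the chart of the added ball.\<close>
  then have zero: "integral (chart_range (C i0)) (\<lambda>x. \<rho> i0 (chart_inv (C i0) x) * flux_div (C i0) x) = 0"
    using total finI by (subst (asm) sum_nonneg_eq_0_iff) (auto simp: I_def)
  have i0: "i0 \<in> I" "C i0 = c0" by (simp_all add: I_def i0_def C_def)
  let ?f = "\<lambda>x. \<rho> i0 (chart_inv c0 x) * flux_div c0 x"
  \<comment> \<open>On a closed box a continuous nonnegative function with integral zero vanishes
    pointwise, which reaches \<open>x0\<close> itself.\<close>
  obtain a b where ab: "x0 \<in> box a b" "cbox a b \<subseteq> chart_range c0"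
    by (rule open_contains_cbox[OF open_range[OF c0(1)] c0(2)])
  have contf: "continuous_on (chart_range c0) ?f"
    by (intro continuous_on_mult cont i0 c0)
  have contf': "continuous_on (cbox a b) ?f" by (rule continuous_on_subset[OF contf ab(2)])
  have nn: "0 \<le> ?f x" if "x \<in> chart_range c0" for x
    using term_nonneg[OF i0(1), of x] that unfolding i0 by blast
  have fi: "?f integrable_on chart_range c0" using integrable[OF int1[OF i0(1)]] by (simp only: i0)
  have "integral (cbox a b) ?f \<le> integral (chart_range c0) ?f"
    by (rule integral_subset_le[OF ab(2) integrable_continuous[OF contf'] fi]) (intro ballI nn)
  moreover have "0 \<le> integral (cbox a b) ?f"
    by (rule integral_nonneg[OF integrable_continuous[OF contf']]) (intro nn subsetD[OF ab(2)])
  ultimately have "integral (cbox a b) ?f = 0" using zero by (simp only: i0)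
  then have "(?f has_integral 0) (cbox a b)"
    using integrable_integral[OF integrable_continuous[OF contf']] by simp
  moreover have "box a b \<noteq> {}" "x0 \<in> cbox a b" using ab(1) box_subset_cbox by blast+
  ultimately have "?f x0 = 0"
    using nn ab(2) box_subset_cbox[of a b] by (intro has_integral_0_cbox_imp_0[OF contf']) blast+
  moreover have "\<rho> i0 (chart_inv c0 x0) > 0"
  proof -
    have "bump x0 r0 x0 > 0" using r0(1) by (intro bump_pos) simp
    then show ?thesis
      using s_pos[OF chart_inv_topspace[OF c0]] chart_inv_domain[OF c0(2)] chart_inv_right[OF c0(2)]
      by (simp add: \<rho>_def i0_def bump_on_def)
  qed
  ultimately show ?thesis by simp
qed

end

section \<open>Exterior derivative of tensorial forms\<close>

lemma ext_d_1: "ext_d \<alpha> c x [v] = frechet_derivative (\<lambda>y. \<alpha> c y []) (at x) v"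
  by (simp add: ext_d_def)

lemma ext_d_2: "ext_d \<alpha> c x [u, v] =
    frechet_derivative (\<lambda>y. \<alpha> c y [v]) (at x) u - frechet_derivative (\<lambda>y. \<alpha> c y [u]) (at x) v"
  by (simp add: ext_d_def numeral_2_eq_2)

lemma ext_d_3: "ext_d \<alpha> c x [u, v, w] =
    frechet_derivative (\<lambda>y. \<alpha> c y [v, w]) (at x) u - frechet_derivative (\<lambda>y. \<alpha> c y [u, w]) (at x) v
    + frechet_derivative (\<lambda>y. \<alpha> c y [u, v]) (at x) w"
  by (simp add: ext_d_def numeral_3_eq_3)

lemma ext_d_4: "ext_d \<alpha> c x [u, v, w, z] =
    frechet_derivative (\<lambda>y. \<alpha> c y [v, w, z]) (at x) u - frechet_derivative (\<lambda>y. \<alpha> c y [u, w, z]) (at x) v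
    + frechet_derivative (\<lambda>y. \<alpha> c y [u, v, z]) (at x) w - frechet_derivative (\<lambda>y. \<alpha> c y [u, v, w]) (at x) z"
  by (simp add: ext_d_def eval_nat_numeral)

lemma ext_d_cong:
  assumes "open S" "x \<in> S" "\<And>y vs. y \<in> S \<Longrightarrow> \<alpha> c y vs = \<beta> c y vs"
  shows "ext_d \<alpha> c x vs = ext_d \<beta> c x vs"
proof -
  have "frechet_derivative (\<lambda>y. \<alpha> c y us) (at x) = frechet_derivative (\<lambda>y. \<beta> c y us) (at x)" for us
    by (rule frechet_derivative_cong_open[OF assms(1,2)]) (rule assms(3))
  then show ?thesis by (simp add: ext_d_def)
qed

lemma ext_d_eq_0:
  assumes "open S" "x \<in> S" "\<And>y us. y \<in> S \<Longrightarrow> length us = length vs - 1 \<Longrightarrow> \<alpha> c y us = 0"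
  shows "ext_d \<alpha> c x vs = 0"
proof -
  have "frechet_derivative (\<lambda>y. \<alpha> c y (take i vs @ drop (Suc i) vs)) (at x) = frechet_derivative (\<lambda>y. 0) (at x)"
    if "i < length vs" for i
    by (rule frechet_derivative_cong_open[OF assms(1,2)]) (rule assms(3), use that in auto)
  then show ?thesis by (simp add: ext_d_def)
qed

text \<open>Two mean value steps: along \<open>u\<close> for the difference of \<open>f\<close> on
  two parallel segments, then along \<open>v\<close>. The second difference is symmetric in
  \<open>u\<close> and \<open>v\<close>, which is what equates the mixed derivatives in the next
  lemma.\<close>

lemma second_difference:
  fixes f :: "real^'n \<Rightarrow> real"
  assumes f: "times_differentiable_on 2 S f" and "s > 0"
    and sub: "\<And>a b. 0 \<le> a \<Longrightarrow> a \<le> s \<Longrightarrow> 0 \<le> b \<Longrightarrow> b \<le> s \<Longrightarrow> x + a *\<^sub>R u + b *\<^sub>R v \<in> S"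
  obtains a b where "0 < a" "a < s" "0 < b" "b < s"
    "f (x + s *\<^sub>R u + s *\<^sub>R v) - f (x + s *\<^sub>R u) - f (x + s *\<^sub>R v) + f x =
     s * s * frechet_derivative (\<lambda>y. frechet_derivative f (at y) u) (at (x + a *\<^sub>R u + b *\<^sub>R v)) v"
proof -
  let ?fu = "\<lambda>y. frechet_derivative f (at y) u"
  have d1: "(f has_derivative frechet_derivative f (at y)) (at y)" if "y \<in> S" for y
    using times_differentiable_on_has_derivative[of 1 S f y] f that by (simp add: numeral_2_eq_2)
  have d2: "(?fu has_derivative frechet_derivative ?fu (at y)) (at y)" if "y \<in> S" for y
    using times_differentiable_on_has_derivative[of 0 S ?fu y] f that by (simp add: numeral_2_eq_2)
  have line: "((\<lambda>t. g (p + t *\<^sub>R w)) has_real_derivative frechet_derivative g (at (p + t *\<^sub>R w)) w) (at t)"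
    if g: "(g has_derivative frechet_derivative g (at (p + t *\<^sub>R w))) (at (p + t *\<^sub>R w))"
    for g :: "real^'n \<Rightarrow> real" and p w t
  proof -
    have "((\<lambda>t. p + t *\<^sub>R w) has_derivative (\<lambda>h. h *\<^sub>R w)) (at t)"
      by (auto intro!: derivative_eq_intros)
    from diff_chain_at[OF this g] have "((\<lambda>t. g (p + t *\<^sub>R w)) has_derivative
        (\<lambda>h. frechet_derivative g (at (p + t *\<^sub>R w)) (h *\<^sub>R w))) (at t)"
      by (simp add: o_def)
    moreover have "(\<lambda>h. frechet_derivative g (at (p + t *\<^sub>R w)) (h *\<^sub>R w)) = (*) (frechet_derivative g (at (p + t *\<^sub>R w)) w)"
      by (simp add: fun_eq_iff linear_cmul[OF has_derivative_linear[OF g]])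
    ultimately show ?thesis by (simp add: has_field_derivative_def)
  qed
  have "((\<lambda>t. f ((x + s *\<^sub>R v) + t *\<^sub>R u) - f (x + t *\<^sub>R u)) has_real_derivative
      ?fu ((x + s *\<^sub>R v) + t *\<^sub>R u) - ?fu (x + t *\<^sub>R u)) (at t)" if "0 \<le> t" "t \<le> s" for t
  proof (rule DERIV_diff[OF line[OF d1] line[OF d1]])
    show "x + s *\<^sub>R v + t *\<^sub>R u \<in> S" using sub[of t s] that \<open>s > 0\<close> by (simp add: algebra_simps)
    show "x + t *\<^sub>R u \<in> S" using sub[of t 0] that \<open>s > 0\<close> by simp
  qed
  from MVT2[OF \<open>s > 0\<close> this] obtain a where a: "0 < a" "a < s"
    "(f ((x + s *\<^sub>R v) + s *\<^sub>R u) - f (x + s *\<^sub>R u)) - (f ((x + s *\<^sub>R v) + 0 *\<^sub>R u) - f (x + 0 *\<^sub>R u)) =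
      (s - 0) * (?fu ((x + s *\<^sub>R v) + a *\<^sub>R u) - ?fu (x + a *\<^sub>R u))"
    by blast
  have "((\<lambda>t. ?fu ((x + a *\<^sub>R u) + t *\<^sub>R v)) has_real_derivative
      frechet_derivative ?fu (at ((x + a *\<^sub>R u) + t *\<^sub>R v)) v) (at t)" if "0 \<le> t" "t \<le> s" for t
    by (rule line[OF d2]) (use sub a that in auto)
  from MVT2[OF \<open>s > 0\<close> this] obtain b where b: "0 < b" "b < s"
    "?fu ((x + a *\<^sub>R u) + s *\<^sub>R v) - ?fu ((x + a *\<^sub>R u) + 0 *\<^sub>R v) =
      (s - 0) * frechet_derivative ?fu (at ((x + a *\<^sub>R u) + b *\<^sub>R v)) v"
    by blast
  show ?thesis
  proof (rule that[OF a(1,2) b(1,2)])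
    have "x + s *\<^sub>R v + a *\<^sub>R u = x + a *\<^sub>R u + s *\<^sub>R v" "x + s *\<^sub>R v + s *\<^sub>R u = x + s *\<^sub>R u + s *\<^sub>R v"
      by simp_all
    then show "f (x + s *\<^sub>R u + s *\<^sub>R v) - f (x + s *\<^sub>R u) - f (x + s *\<^sub>R v) + f x =
     s * s * frechet_derivative ?fu (at (x + a *\<^sub>R u + b *\<^sub>R v)) v"
      using a(3) b(3) by (simp add: algebra_simps)
  qed
qed

lemma frechet_derivative_commute:
  fixes f :: "real^'n \<Rightarrow> real"
  assumes S: "open S" "x \<in> S" and f: "times_differentiable_on 2 S f"
  shows "frechet_derivative (\<lambda>y. frechet_derivative f (at y) u) (at x) v =
    frechet_derivative (\<lambda>y. frechet_derivative f (at y) v) (at x) u"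
    (is "?F u v x = ?F v u x")
proof (rule ccontr)
  assume ne: "?F u v x \<noteq> ?F v u x"
  \<comment> \<open>Half the gap between the two mixed derivatives: values within less than
    \<open>e\<close> of one and of the other cannot coincide.\<close>
  define e where "e = \<bar>?F u v x - ?F v u x\<bar> / 2"
  have e: "e > 0" using ne by (simp add: e_def)
  have cont: "continuous_on S (\<lambda>x. ?F u v x)" for u v
    using f by (simp add: numeral_2_eq_2)
  have near: "\<exists>d>0. \<forall>y. dist y x < d \<longrightarrow> y \<in> S \<and> \<bar>?F u v y - ?F u v x\<bar> < e" for u v
  proof -
    obtain d1 where d1: "d1 > 0" "ball x d1 \<subseteq> S" using S unfolding open_contains_ball by blast
    obtain d2 where d2: "d2 > 0" "\<forall>y\<in>S. dist y x < d2 \<longrightarrow> dist (?F u v y) (?F u v x) < e"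
      using cont[of u v] S(2) e unfolding continuous_on_iff by blast
    show ?thesis
    proof (intro exI[of _ "min d1 d2"] conjI allI impI)
      fix y assume y: "dist y x < min d1 d2"
      then have "y \<in> S" using d1(2) by (auto simp: dist_commute)
      then show "y \<in> S" "\<bar>?F u v y - ?F u v x\<bar> < e" using d2(2) y by (auto simp: dist_real_def)
    qed (use d1 d2 in auto)
  qed
  obtain d where d: "d > 0" "\<And>y. dist y x < d \<Longrightarrow> y \<in> S \<and> \<bar>?F u v y - ?F u v x\<bar> < e"
    using near by blast
  obtain d' where d': "d' > 0" "\<And>y. dist y x < d' \<Longrightarrow> y \<in> S \<and> \<bar>?F v u y - ?F v u x\<bar> < e"
    using near by blast
  \<comment> \<open>Small enough for the parallelogram on \<open>s *\<^sub>R u\<close> and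
    \<open>s *\<^sub>R v\<close> to stay in both neighbourhoods; the summand 1 keeps the denominator
    positive.\<close>
  define s where "s = min d d' / (norm u + norm v + 1)"
  have pos: "norm u + norm v + 1 > 0" using norm_ge_zero[of u] norm_ge_zero[of v] by linarith
  have s: "s > 0" using d(1) d'(1) pos by (simp add: s_def)
  have small: "dist (x + a *\<^sub>R u + b *\<^sub>R v) x < min d d'" if "0 \<le> a" "a \<le> s" "0 \<le> b" "b \<le> s" for a b
  proof -
    have "dist (x + a *\<^sub>R u + b *\<^sub>R v) x = norm (a *\<^sub>R u + b *\<^sub>R v)" by (simp add: dist_norm add.assoc)
    also have "\<dots> \<le> a * norm u + b * norm v"
      using norm_triangle_ineq[of "a *\<^sub>R u" "b *\<^sub>R v"] that by simp
    also have "\<dots> \<le> s * norm u + s * norm v" using that by (intro add_mono mult_right_mono) auto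
    also have "\<dots> < s * (norm u + norm v + 1)" using s by (simp add: algebra_simps)
    also have "\<dots> = min d d'" using pos by (simp add: s_def)
    finally show ?thesis .
  qed
  obtain a b where ab: "0 < a" "a < s" "0 < b" "b < s"
    "f (x + s *\<^sub>R u + s *\<^sub>R v) - f (x + s *\<^sub>R u) - f (x + s *\<^sub>R v) + f x = s * s * ?F u v (x + a *\<^sub>R u + b *\<^sub>R v)"
    by (rule second_difference[OF f s, of x u v]) (use small d(2) in auto)
  have small': "dist (x + a *\<^sub>R v + b *\<^sub>R u) x < min d d'" if "0 \<le> a" "a \<le> s" "0 \<le> b" "b \<le> s" for a b
  proof -
    have "x + a *\<^sub>R v + b *\<^sub>R u = x + b *\<^sub>R u + a *\<^sub>R v" by simp
    then show ?thesis using small[OF that(3,4,1,2)] by metis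
  qed
  obtain a' b' where ab': "0 < a'" "a' < s" "0 < b'" "b' < s"
    "f (x + s *\<^sub>R v + s *\<^sub>R u) - f (x + s *\<^sub>R v) - f (x + s *\<^sub>R u) + f x = s * s * ?F v u (x + a' *\<^sub>R v + b' *\<^sub>R u)"
    by (rule second_difference[OF f s, of x v u]) (use small' d(2) in auto)
  have eq: "x + s *\<^sub>R v + s *\<^sub>R u = x + s *\<^sub>R u + s *\<^sub>R v" by simp
  from ab(5) ab'(5)[unfolded eq] have "s * s * ?F u v (x + a *\<^sub>R u + b *\<^sub>R v) = s * s * ?F v u (x + a' *\<^sub>R v + b' *\<^sub>R u)"
    by linarith
  then have "?F u v (x + a *\<^sub>R u + b *\<^sub>R v) = ?F v u (x + a' *\<^sub>R v + b' *\<^sub>R u)" using s by simp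
  moreover have "\<bar>?F u v (x + a *\<^sub>R u + b *\<^sub>R v) - ?F u v x\<bar> < e"
    using d(2) small[of a b] ab by simp
  moreover have "\<bar>?F v u (x + a' *\<^sub>R v + b' *\<^sub>R u) - ?F v u x\<bar> < e"
    using d'(2) small'[of a' b'] ab' by simp
  ultimately have "\<bar>?F u v x - ?F v u x\<bar> < 2 * e" by linarith
  then show False by (simp add: e_def)
qed

lemma linear_frechet_derivative_param:
  assumes "open S" "x \<in> S" "\<And>y. y \<in> S \<Longrightarrow> linear (\<lambda>v. g y v)" "\<And>v. (\<lambda>y. g y v) differentiable (at x)"
  shows "linear (\<lambda>v. frechet_derivative (\<lambda>y. g y v) (at x) u)"
proof (rule linearI)
  have D: "((\<lambda>y. g y v) has_derivative frechet_derivative (\<lambda>y. g y v) (at x)) (at x)" for v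
    using assms(4) frechet_derivative_works by blast
  show "frechet_derivative (\<lambda>y. g y (v + w)) (at x) u =
      frechet_derivative (\<lambda>y. g y v) (at x) u + frechet_derivative (\<lambda>y. g y w) (at x) u" for v w
  proof -
    have "frechet_derivative (\<lambda>y. g y (v + w)) (at x) = frechet_derivative (\<lambda>y. g y v + g y w) (at x)"
      by (rule frechet_derivative_cong_open[OF assms(1,2)]) (rule linear_add[OF assms(3)])
    then show ?thesis by (simp add: frechet_derivative_eq[OF has_derivative_add[OF D D]])
  qed
  show "frechet_derivative (\<lambda>y. g y (r *\<^sub>R v)) (at x) u = r *\<^sub>R frechet_derivative (\<lambda>y. g y v) (at x) u" for r v
  proof -
    have "frechet_derivative (\<lambda>y. g y (r *\<^sub>R v)) (at x) = frechet_derivative (\<lambda>y. r *\<^sub>R g y v) (at x)"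
      by (rule frechet_derivative_cong_open[OF assms(1,2)]) (rule linear_cmul[OF assms(3)])
    then show ?thesis by (simp add: frechet_derivative_eq[OF has_derivative_scaleR_right[OF D]])
  qed
qed

text \<open>\<open>h z\<close> is a one-form at \<open>z\<close>, and \<open>g\<close> is its
  pullback along \<open>T\<close> evaluated on a fixed \<open>v\<close>. The product rule separates
  the second derivatives of \<open>T\<close>, which are symmetric in \<open>u\<close> and
  \<open>v\<close> and so drop out of an exterior derivative, from the pulled-back derivative of
  \<open>h\<close>.\<close>

lemma frechet_derivative_pullback:
  fixes T :: "real^'n \<Rightarrow> real^'n" and h :: "real^'n \<Rightarrow> real^'n \<Rightarrow> 'b::real_normed_vector"
  assumes S: "open S" "x \<in> S" and T: "times_differentiable_on 2 S T"
    and U: "open U" "T ` S \<subseteq> U"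
    and g: "\<And>y. y \<in> S \<Longrightarrow> g y = h (T y) (frechet_derivative T (at y) v)"
    and h: "\<And>z. z \<in> U \<Longrightarrow> linear (h z)" "\<And>w. (\<lambda>z. h z w) differentiable (at (T x))"
  shows "frechet_derivative g (at x) u =
    (\<Sum>m\<in>UNIV. frechet_derivative (\<lambda>y. frechet_derivative (\<lambda>z. T z $ m) (at y) v) (at x) u *\<^sub>R h (T x) (axis m 1))
    + frechet_derivative (\<lambda>z. h z (frechet_derivative T (at x) v)) (at (T x)) (frechet_derivative T (at x) u)"
proof -
  let ?T' = "\<lambda>y. frechet_derivative T (at y)"
  let ?t = "\<lambda>m y. frechet_derivative (\<lambda>z. T z $ m) (at y) v"
  have T1: "(T has_derivative ?T' y) (at y)" if "y \<in> S" for y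
    using times_differentiable_on_has_derivative[of 1 S T y] T that by (simp add: numeral_2_eq_2)
  have Tm: "times_differentiable_on 2 S (\<lambda>z. T z $ m)" for m
    by (rule times_differentiable_on_bounded_linear[OF S(1) T bounded_linear_vec_nth])
  have comp: "?T' y v $ m = ?t m y" if "y \<in> S" for y m
    using frechet_derivative_eq[OF bounded_linear.has_derivative[OF bounded_linear_vec_nth T1[OF that]]] by simp
  have t: "(?t m has_derivative frechet_derivative (?t m) (at x)) (at x)" for m
    using times_differentiable_on_has_derivative[of 0 S "?t m" x] Tm[of m] S(2) by (simp add: numeral_2_eq_2)
  have hT: "((\<lambda>y. h (T y) w) has_derivative (\<lambda>u. frechet_derivative (\<lambda>z. h z w) (at (T x)) (?T' x u))) (at x)" for w
    using diff_chain_at[OF T1[OF S(2)] h(2)[of w, unfolded frechet_derivative_works]] by (simp add: o_def)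
  have "frechet_derivative g (at x) = frechet_derivative (\<lambda>y. \<Sum>m\<in>UNIV. ?t m y *\<^sub>R h (T y) (axis m 1)) (at x)"
  proof (rule frechet_derivative_cong_open[OF S])
    fix y assume y: "y \<in> S"
    then have "linear (h (T y))" using U(2) by (intro h(1)) blast
    from linear_euclidean_expand[OF this, of "?T' y v"]
    show "g y = (\<Sum>m\<in>UNIV. ?t m y *\<^sub>R h (T y) (axis m 1))"
      by (simp add: g[OF y] comp[OF y])
  qed
  also have "\<dots> = (\<lambda>u. \<Sum>m\<in>UNIV. ?t m x *\<^sub>R frechet_derivative (\<lambda>z. h z (axis m 1)) (at (T x)) (?T' x u)
      + frechet_derivative (?t m) (at x) u *\<^sub>R h (T x) (axis m 1))"
    by (intro frechet_derivative_eq has_derivative_sum has_derivative_scaleR t hT)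
  also have "\<dots> = (\<lambda>u. (\<Sum>m\<in>UNIV. frechet_derivative (?t m) (at x) u *\<^sub>R h (T x) (axis m 1))
      + frechet_derivative (\<lambda>z. h z (?T' x v)) (at (T x)) (?T' x u))"
  proof
    fix u
    have "linear (\<lambda>w. frechet_derivative (\<lambda>z. h z w) (at (T x)) (?T' x u))"
      by (rule linear_frechet_derivative_param[OF U(1) _ h]) (use U(2) S(2) in auto)
    from linear_euclidean_expand[OF this, of "?T' x v"]
    show "(\<Sum>m\<in>UNIV. ?t m x *\<^sub>R frechet_derivative (\<lambda>z. h z (axis m 1)) (at (T x)) (?T' x u)
      + frechet_derivative (?t m) (at x) u *\<^sub>R h (T x) (axis m 1)) =
      (\<Sum>m\<in>UNIV. frechet_derivative (?t m) (at x) u *\<^sub>R h (T x) (axis m 1))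
      + frechet_derivative (\<lambda>z. h z (?T' x v)) (at (T x)) (?T' x u)"
      by (simp add: sum.distrib comp[OF S(2)])
  qed
  finally show ?thesis by simp
qed

text \<open>The algebraic half of \<open>smooth_form\<close>, for the forms built in the proof.
  Regularity is counted separately by \<open>differentiable_form\<close>, because each exterior
  derivative consumes one order.\<close>

definition tensorial where
  "tensorial A k b \<longleftrightarrow> (\<forall>c\<in>A. \<forall>x\<in>chart_range c. alternating_form k (b c x)) \<and>
     (\<forall>c\<in>A. \<forall>c'\<in>A. \<forall>x\<in>overlap c c'. \<forall>vs. length vs = k \<longrightarrow>
        b c x vs = b c' (transition c c' x) (map (frechet_derivative (transition c c') (at x)) vs))"

definition differentiable_form where
  "differentiable_form A r b \<longleftrightarrow>
    (\<forall>c\<in>A. \<forall>vs. times_differentiable_on r (chart_range c) (\<lambda>x. b c x vs))"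

lemma alternating_form_1_iff:
  "alternating_form 1 f \<longleftrightarrow> (\<forall>vs. length vs \<noteq> 1 \<longrightarrow> f vs = 0) \<and> linear (\<lambda>v. f [v])"
proof -
  have "(\<forall>vs i. length vs = 1 \<and> i < 1 \<longrightarrow> linear (\<lambda>v. f (vs[i := v]))) \<longleftrightarrow> linear (\<lambda>v. f [v])"
    by (auto simp: length_Suc_conv dest: spec[of _ "[0]"])
  then show ?thesis unfolding alternating_form_def by auto
qed

context manifold
begin

lemma alternating_ext_d:
  assumes b: "tensorial A 1 b" "differentiable_form A 1 b" and c: "c \<in> A" "x \<in> chart_range c"
  shows "alternating_form 2 (ext_d b c x)"
proof -
  have b1: "alternating_form 1 (b c y)" if "y \<in> chart_range c" for y
    using b(1) c(1) that unfolding tensorial_def by blast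
  have D: "((\<lambda>y. b c y vs) has_derivative frechet_derivative (\<lambda>y. b c y vs) (at x)) (at x)" for vs
    using b(2) c unfolding differentiable_form_def by (intro times_differentiable_on_1D(3)[OF _ c(2)]) blast
  have lin1: "linear (\<lambda>u. frechet_derivative (\<lambda>y. b c y [v]) (at x) u)" for v
    by (rule has_derivative_linear[OF D])
  have lin2: "linear (\<lambda>v. frechet_derivative (\<lambda>y. b c y [v]) (at x) u)" for u
  proof (rule linear_frechet_derivative_param[OF open_range[OF c(1)] c(2)])
    show "linear (\<lambda>v. b c y [v])" if "y \<in> chart_range c" for y
      using b1[OF that] unfolding alternating_form_1_iff by blast
  qed (use D in \<open>auto simp: differentiable_def\<close>)
  have "ext_d b c x vs = 0" if "length vs \<noteq> 2" for vs
  proof (rule ext_d_eq_0[OF open_range[OF c(1)] c(2)])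
    fix y and us :: "(real, 'n) vec list" assume "y \<in> chart_range c" "length us = length vs - 1"
    then show "b c y us = 0" using b1[of y] that unfolding alternating_form_1_iff by auto
  qed
  moreover have "linear (\<lambda>v. ext_d b c x (vs[i := v]))" if l: "length vs = 2" "i < 2" for vs i
  proof -
    obtain p q where vs: "vs = [p, q]" using l(1) by (auto simp: length_Suc_conv numeral_2_eq_2)
    consider "i = 0" | "i = 1" using l(2) by linarith
    then show ?thesis
      by cases (simp_all add: vs ext_d_2 linear_compose_sub lin1 lin2)
  qed
  moreover have "ext_d b c x vs = 0" if l: "length vs = 2" "i < j" "j < 2" "vs ! i = vs ! j" for vs i j
  proof -
    obtain p q where vs: "vs = [p, q]" using l(1) by (auto simp: length_Suc_conv numeral_2_eq_2)
    have "i = 0" "j = 1" using l by auto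
    then show ?thesis using l(4) by (simp add: vs ext_d_2)
  qed
  ultimately show ?thesis unfolding alternating_form_def by blast
qed

lemma differentiable_ext_d:
  assumes "tensorial A 1 b" "differentiable_form A (Suc r) b"
  shows "differentiable_form A r (ext_d b)"
  unfolding differentiable_form_def
proof (intro ballI allI)
  fix c vs assume c: "c \<in> A"
  have "times_differentiable_on r (chart_range c) (\<lambda>x. frechet_derivative (\<lambda>y. b c y us) (at x) v)" for us v
    using assms(2) c unfolding differentiable_form_def by simp
  then show "times_differentiable_on r (chart_range c) (\<lambda>x. ext_d b c x vs)"
    unfolding ext_d_def
    by (intro times_differentiable_on_sum times_differentiable_on_mult times_differentiable_on_const open_range c)
qed

text \<open>The second derivatives of the transition map cancel by symmetry.\<close>

lemma tensorial_ext_d: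
  fixes b :: "('a, 'n) chart \<Rightarrow> (real, 'n) vec \<Rightarrow> (real, 'n) vec list \<Rightarrow> 'b::real_normed_field"
  assumes b: "tensorial A 1 b" "differentiable_form A 1 b"
  shows "tensorial A 2 (ext_d b)"
  unfolding tensorial_def
proof (intro conjI ballI allI impI)
  show "alternating_form 2 (ext_d b c x)" if "c \<in> A" "x \<in> chart_range c" for c x
    by (rule alternating_ext_d[OF b that])
next
  fix c c' x and vs :: "(real, 'n) vec list"
  assume c: "c \<in> A" "c' \<in> A" "x \<in> overlap c c'" and "length vs = 2"
  then obtain u v where vs: "vs = [u, v]" by (auto simp: length_Suc_conv numeral_2_eq_2)
  let ?T = "transition c c'"
  let ?Q = "\<lambda>u v. (\<Sum>m\<in>UNIV. frechet_derivative (\<lambda>y. frechet_derivative (\<lambda>z. ?T z $ m) (at y) v) (at x) u *\<^sub>R b c' (?T x) [axis m 1])"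
  have Tx: "?T x \<in> chart_range c'" using transition_maps(1)[OF c] by blast
  have D: "frechet_derivative (\<lambda>y. b c y [v]) (at x) u = ?Q u v +
      frechet_derivative (\<lambda>z. b c' z [frechet_derivative ?T (at x) v]) (at (?T x)) (frechet_derivative ?T (at x) u)" for u v
  proof (rule frechet_derivative_pullback[OF open_overlap[OF c(1,2)] c(3) transition_smooth[OF c(1,2)]
        open_range[OF c(2)], where h = "\<lambda>z w. b c' z [w]"])
    show "?T ` overlap c c' \<subseteq> chart_range c'"
      unfolding transition_image[OF c(1,2)] by (rule overlap_subset)
    show "b c y [v] = b c' (?T y) [frechet_derivative ?T (at y) v]" if "y \<in> overlap c c'" for y
    proof -
      have "b c y [v] = b c' (?T y) (map (frechet_derivative ?T (at y)) [v])"
        using b(1) c(1,2) that unfolding tensorial_def by (metis length_Cons list.size(3) One_nat_def)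
      then show ?thesis by simp
    qed
    show "linear (\<lambda>w. b c' z [w])" if "z \<in> chart_range c'" for z
      using b(1) c(2) that unfolding tensorial_def alternating_form_1_iff by blast
    show "(\<lambda>z. b c' z [w]) differentiable at (?T x)" for w
      using b(2) c(2) Tx unfolding differentiable_form_def by (metis times_differentiable_on_1D(3) differentiableI)
  qed
  have "?Q u v = ?Q v u"
  proof (rule sum.cong[OF refl])
    fix m
    have "times_differentiable_on 2 (overlap c c') (\<lambda>z. ?T z $ m)"
      by (rule times_differentiable_on_bounded_linear[OF open_overlap[OF c(1,2)] transition_smooth[OF c(1,2)]
            bounded_linear_vec_nth])
    from frechet_derivative_commute[OF open_overlap[OF c(1,2)] c(3) this]
    show "frechet_derivative (\<lambda>y. frechet_derivative (\<lambda>z. ?T z $ m) (at y) v) (at x) u *\<^sub>R b c' (?T x) [axis m 1] =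
      frechet_derivative (\<lambda>y. frechet_derivative (\<lambda>z. ?T z $ m) (at y) u) (at x) v *\<^sub>R b c' (?T x) [axis m 1]"
      by (simp only:)
  qed
  then show "ext_d b c x vs = ext_d b c' (?T x) (map (frechet_derivative ?T (at x)) vs)"
    unfolding vs list.map ext_d_2 D by simp
qed

end

section \<open>Almost Kaehler four-manifolds\<close>

lemma cross_has_derivative:
  fixes X :: "4 \<Rightarrow> 4 \<Rightarrow> 'a::real_normed_vector \<Rightarrow> 'b::real_normed_field"
  assumes "\<And>k l. (X k l has_derivative DX k l) (at x)" "\<And>m. (b m has_derivative DB m) (at x)"
  shows "((\<lambda>y. cross (\<lambda>k l. X k l y) (\<lambda>m. b m y) a) has_derivative
    (\<lambda>v. cross (\<lambda>k l. X k l x) (\<lambda>m. DB m v) a + cross (\<lambda>k l. DX k l v) (\<lambda>m. b m x) a)) (at x)"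
proof -
  have "\<forall>a. ((\<lambda>y. cross (\<lambda>k l. X k l y) (\<lambda>m. b m y) a) has_derivative
    (\<lambda>v. cross (\<lambda>k l. X k l x) (\<lambda>m. DB m v) a + cross (\<lambda>k l. DX k l v) (\<lambda>m. b m x) a)) (at x)"
    unfolding forall_4 cross_def by simp (auto intro!: derivative_eq_intros assms simp: algebra_simps)
  then show ?thesis by blast
qed

text \<open>The divergence of \<open>cross X b\<close> is the coefficient of d(X \<and> b), so this
  is the Leibniz rule. The last sum is dX \<and> b, which disappears for closed X.\<close>

lemma div_cross:
  fixes X :: "4 \<Rightarrow> 4 \<Rightarrow> real^4 \<Rightarrow> 'b::real_normed_field"
  assumes "\<And>k l. (X k l has_derivative DX k l) (at x)" "\<And>m. (b m has_derivative DB m) (at x)"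
  shows "(\<Sum>a\<in>UNIV. frechet_derivative (\<lambda>y. cross (\<lambda>k l. X k l y) (\<lambda>m. b m y) a) (at x) (axis a 1)) =
    pf_pair (\<lambda>k l. X k l x) (\<lambda>k l. DB l (axis k 1) - DB k (axis l 1))
    + (\<Sum>m\<in>UNIV. vec3 (\<lambda>i k l. DX k l (axis i 1) - DX i l (axis k 1) + DX i k (axis l 1)) m * b m x)"
  unfolding frechet_derivative_eq[OF cross_has_derivative[OF assms]]
  unfolding sum_4 cross_def pf_pair_def vec3_def by (simp add: algebra_simps)

lemma times_differentiable_on_cross:
  fixes X :: "4 \<Rightarrow> 4 \<Rightarrow> 'a::real_normed_vector \<Rightarrow> 'b::real_normed_field"
  assumes "open S" "\<And>k l. times_differentiable_on r S (X k l)" "\<And>m. times_differentiable_on r S (b m)"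
  shows "times_differentiable_on r S (\<lambda>y. cross (\<lambda>k l. X k l y) (\<lambda>m. b m y) a)"
proof -
  have "\<forall>a. times_differentiable_on r S (\<lambda>y. cross (\<lambda>k l. X k l y) (\<lambda>m. b m y) a)"
    unfolding forall_4 cross_def
    by (simp add: times_differentiable_on_add times_differentiable_on_diff times_differentiable_on_mult
        times_differentiable_on_minus assms)
  then show ?thesis by blast
qed

text \<open>A continuous function without zeros has locally constant sign, so the sign behaves like
  a constant under differentiation.\<close>

lemma sgn_mult_local:
  fixes p f :: "real^'n \<Rightarrow> real"
  assumes S: "open S" and p: "continuous_on S p" "\<And>x. x \<in> S \<Longrightarrow> p x \<noteq> 0"
    and f: "times_differentiable_on 1 S f"
  shows "times_differentiable_on 1 S (\<lambda>x. sgn (p x) * f x)"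
    and "x \<in> S \<Longrightarrow> frechet_derivative (\<lambda>x. sgn (p x) * f x) (at x) v = sgn (p x) * frechet_derivative f (at x) v"
proof -
  define P where "P s = {x \<in> S. sgn (p x) = s}" for s :: real
  have P: "open (P 1)" "open (P (-1))"
  proof -
    have "P 1 = S \<inter> p -` {0<..}" "P (-1) = S \<inter> p -` {..<0}"
      by (auto simp: P_def sgn_1_pos sgn_1_neg)
    then show "open (P 1)" "open (P (-1))"
      using continuous_open_preimage[OF p(1) S] by simp_all
  qed
  have SP: "S = P 1 \<union> P (-1)"
    using p(2) by (auto simp: P_def sgn_if)
  have "times_differentiable_on 1 (P s) (\<lambda>x. sgn (p x) * f x)" if "open (P s)" for s
  proof (rule times_differentiable_on_cong[OF that])
    show "times_differentiable_on 1 (P s) (\<lambda>x. s * f x)"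
      by (intro times_differentiable_on_mult that times_differentiable_on_const times_differentiable_on_subset[OF f])
        (auto simp: P_def)
  qed (simp add: P_def)
  then show "times_differentiable_on 1 S (\<lambda>x. sgn (p x) * f x)"
    unfolding SP by (intro times_differentiable_on_Un P) (use P in auto)
  assume x: "x \<in> S"
  then obtain s where s: "x \<in> P s" "open (P s)" using SP P by blast
  have "frechet_derivative (\<lambda>x. sgn (p x) * f x) (at x) = frechet_derivative (\<lambda>x. s * f x) (at x)"
    by (rule frechet_derivative_cong_open[OF s(2,1)]) (simp add: P_def)
  also have "\<dots> = (\<lambda>v. s * frechet_derivative f (at x) v)"
    by (intro frechet_derivative_eq has_derivative_mult_right times_differentiable_on_1D(3)[OF f x])
  finally show "frechet_derivative (\<lambda>x. sgn (p x) * f x) (at x) v = sgn (p x) * frechet_derivative f (at x) v"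
    using s(1) by (simp add: P_def)
qed

section \<open>Transformation laws and the pairing of closed with exact forms\<close>

locale almost_kaehler_4 =
  fixes X :: "'a topology" and A :: "('a, 4) chart set"
    and J :: "('a, 4) chart \<Rightarrow> real^4 \<Rightarrow> real^4 \<Rightarrow> real^4" and \<omega> :: "('a, 4, real) form"
  assumes almost_kaehler: "almost_kaehler X A J \<omega>"

sublocale almost_kaehler_4 \<subseteq> manifold X A
  using almost_kaehler unfolding almost_kaehler_def by unfold_locales blast

context almost_kaehler_4
begin

lemma symplectic: "symplectic_form A \<omega>" and almost_complex: "almost_complex_structure A J"
  using almost_kaehler unfolding almost_kaehler_def by simp_all

lemma tensorial_omega: "tensorial A 2 \<omega>"
  and differentiable_omega: "differentiable_form A r \<omega>"
  and closed_omega: "c \<in> A \<Longrightarrow> x \<in> chart_range c \<Longrightarrow> ext_d \<omega> c x vs = 0"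
proof -
  have "smooth_form A 2 \<omega>" "form_zero A (ext_d \<omega>)"
    using symplectic unfolding symplectic_form_def by simp_all
  then show "tensorial A 2 \<omega>" "differentiable_form A r \<omega>"
    "c \<in> A \<Longrightarrow> x \<in> chart_range c \<Longrightarrow> ext_d \<omega> c x vs = 0"
    unfolding smooth_form_def tensorial_def differentiable_form_def smooth_on_def form_zero_def
    by blast+
qed

lemma hermitian:
  assumes c: "c \<in> A" "x \<in> chart_range c"
  shows "hermitian_space (\<omega> c x) (J c x)"
proof (rule hermitian_space.intro)
  show "alternating_form 2 (\<omega> c x)" using tensorial_omega c unfolding tensorial_def by blast
  show "linear (J c x)"
    using almost_complex c unfolding almost_complex_structure_def by blast
  show "J c x (J c x v) = - v" for v
    using almost_complex c unfolding almost_complex_structure_def by blast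
  show "\<omega> c x [J c x u, J c x v] = \<omega> c x [u, v]" for u v
    using almost_kaehler c unfolding almost_kaehler_def by blast
  show "\<omega> c x [J c x u, u] > 0" if "u \<noteq> 0" for u
    using almost_kaehler c that unfolding almost_kaehler_def metric_def by blast
qed

lemma J_differentiable: "c \<in> A \<Longrightarrow> times_differentiable_on r (chart_range c) (\<lambda>x. J c x v)"
  using almost_complex unfolding almost_complex_structure_def smooth_on_def by blast

lemma J_transition: "c \<in> A \<Longrightarrow> c' \<in> A \<Longrightarrow> x \<in> overlap c c' \<Longrightarrow>
    frechet_derivative (transition c c') (at x) (J c x v) =
    J c' (transition c c' x) (frechet_derivative (transition c c') (at x) v)"
  using almost_complex unfolding almost_complex_structure_def by blast

text \<open>By \<open>volume_form_eq\<close> the volume form is \<open>pfw\<close> times the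
  coordinate four-form: the absolute value is the Riemannian density, the sign is the orientation of
  the chart.\<close>

definition pfw :: "('a, 4) chart \<Rightarrow> real^4 \<Rightarrow> real" where
  "pfw c x = pf (coef2 (\<omega> c x))"

lemma pfw_nonzero: "c \<in> A \<Longrightarrow> x \<in> chart_range c \<Longrightarrow> pfw c x \<noteq> 0"
  unfolding pfw_def by (rule hermitian_space.pf_nonzero[OF hermitian])

lemma differentiable_formD:
  "differentiable_form A r b \<Longrightarrow> c \<in> A \<Longrightarrow> times_differentiable_on r (chart_range c) (\<lambda>x. b c x vs)"
  unfolding differentiable_form_def by blast

lemma pfw_differentiable: "c \<in> A \<Longrightarrow> times_differentiable_on r (chart_range c) (pfw c)"
  unfolding pfw_def[abs_def] pf_def coef2_def
  by (intro times_differentiable_on_add times_differentiable_on_diff times_differentiable_on_mult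
      differentiable_formD[OF differentiable_omega] open_range)

lemma tensorialD:
  assumes "tensorial A k b" "c \<in> A"
  shows "x \<in> chart_range c \<Longrightarrow> alternating_form k (b c x)"
    "c' \<in> A \<Longrightarrow> x \<in> overlap c c' \<Longrightarrow> length vs = k \<Longrightarrow>
      b c x vs = b c' (transition c c' x) (map (frechet_derivative (transition c c') (at x)) vs)"
  using assms unfolding tensorial_def by blast+

lemma coef2_transition:
  fixes F :: "('a, 4, 'b::{real_normed_field}) form"
  assumes "tensorial A 2 F" "c \<in> A" "c' \<in> A" "x \<in> overlap c c'"
  shows "coef2 (F c x) =
    pullback2 (\<lambda>k a. of_real (frechet_derivative (transition c c') (at x) (axis a 1) $ k))
      (coef2 (F c' (transition c c' x)))"
proof -
  let ?S = "frechet_derivative (transition c c') (at x)"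
  have Tx: "transition c c' x \<in> chart_range c'" using transition_maps(1)[OF assms(2-4)] by blast
  have "pullback2 (\<lambda>k a. of_real (?S (axis a 1) $ k)) (coef2 (F c' (transition c c' x)))
    = (\<lambda>a b. F c' (transition c c' x) [?S (axis a 1), ?S (axis b 1)])"
    by (rule pullback2_coef2[OF tensorialD(1)[OF assms(1,3) Tx]])
  then show ?thesis
    by (simp add: fun_eq_iff coef2_def tensorialD(2)[OF assms])
qed

lemma det_transition:
  "of_real (det (matrix S)) = det4 (\<lambda>a. of_real (S (axis a 1) $ 1)) (\<lambda>a. of_real (S (axis a 1) $ 2))
    (\<lambda>a. of_real (S (axis a 1) $ 3)) (\<lambda>a. of_real (S (axis a 1) $ 4) :: 'b::real_normed_field)"
  for S :: "real^4 \<Rightarrow> real^4"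
  by (simp add: det_4 matrix_def det4_def)

lemma pf_pair_transition:
  fixes F G :: "('a, 4, 'b::{real_normed_field}) form"
  assumes "tensorial A 2 F" "tensorial A 2 G" and c: "c \<in> A" "c' \<in> A" "x \<in> overlap c c'"
  shows "pf_pair (coef2 (F c x)) (coef2 (G c x)) =
    of_real (det (matrix (frechet_derivative (transition c c') (at x)))) *
    pf_pair (coef2 (F c' (transition c c' x))) (coef2 (G c' (transition c c' x)))"
proof -
  have "transition c c' x \<in> chart_range c'" using transition_maps(1)[OF c] by blast
  then have "alt2 (coef2 (F c' (transition c c' x)))" "alt2 (coef2 (G c' (transition c c' x)))"
    using tensorialD(1)[OF assms(1) c(2)] tensorialD(1)[OF assms(2) c(2)] by (simp_all add: alt2_coef2)
  then show ?thesis
    unfolding coef2_transition[OF assms(1) c] coef2_transition[OF assms(2) c]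
    by (simp add: pf_pair_pullback2 det_transition)
qed

lemma pfw_transition:
  assumes c: "c \<in> A" "c' \<in> A" "x \<in> overlap c c'"
  shows "pfw c x = det (matrix (frechet_derivative (transition c c') (at x))) * pfw c' (transition c c' x)"
  using pf_pair_transition[OF tensorial_omega tensorial_omega c] by (simp add: pf_pair_self pfw_def)

text \<open>The vector of H \<and> b acquires the same determinant as the Pfaffian, so its quotient
  by \<open>pfw\<close> is a vector field. The law is tested against each coordinate covector
  through \<open>cross_pair\<close>.\<close>

lemma cross_transition:
  fixes H b :: "('a, 4, 'b::{real_normed_field}) form"
  assumes H: "tensorial A 2 H" and b: "tensorial A 1 b" and c: "c \<in> A" "c' \<in> A" "x \<in> overlap c c'"
  shows "(\<Sum>a\<in>UNIV. of_real (frechet_derivative (transition c c') (at x) (axis a 1) $ i) *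
      cross (coef2 (H c x)) (\<lambda>m. b c x [axis m 1]) a) =
    of_real (det (matrix (frechet_derivative (transition c c') (at x)))) *
      cross (coef2 (H c' (transition c c' x))) (\<lambda>m. b c' (transition c c' x) [axis m 1]) i"
proof -
  let ?T = "transition c c'"
  define S where "S k a = (of_real (frechet_derivative ?T (at x) (axis a 1) $ k) :: 'b)" for k a
  have Tx: "?T x \<in> chart_range c'" using transition_maps(1)[OF c] by blast
  define b' where "b' m = b c' (?T x) [axis m 1]" for m
  have bm: "b c x [axis l 1] = (\<Sum>m\<in>UNIV. S m l * b' m)" for l
  proof -
    have "linear (\<lambda>v. b c' (?T x) [v])"
      using tensorialD(1)[OF b c(2) Tx] unfolding alternating_form_1_iff by blast
    from linear_expand_of_real[OF this, of "frechet_derivative ?T (at x) (axis l 1)"]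
    show ?thesis using tensorialD(2)[OF b c, of "[axis l 1]"] by (simp add: S_def b'_def)
  qed
  \<comment> \<open>The wedge of the \<open>i\<close>-th coordinate covector with \<open>b\<close>
    in the second chart; pairing \<open>H\<close> with its pullback produces the left side.\<close>
  define Y where "Y k m = (if k = i then b' m else 0) - (if m = i then b' k else 0)" for k m
  have altY: "alt2 Y" by (simp add: alt2_def Y_def)
  have pull: "pullback2 S Y = (\<lambda>k l. S i k * b c x [axis l 1] - S i l * b c x [axis k 1])"
  proof (intro ext)
    fix k l
    have "pullback2 S Y k l = (\<Sum>p\<in>UNIV. \<Sum>q\<in>UNIV. S p k * S q l * (if p = i then b' q else 0))
       - (\<Sum>p\<in>UNIV. \<Sum>q\<in>UNIV. S p k * S q l * (if q = i then b' p else 0))"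
      by (simp add: pullback2_def Y_def right_diff_distrib sum_subtractf)
    also have "(\<Sum>p\<in>UNIV. \<Sum>q\<in>UNIV. S p k * S q l * (if p = i then b' q else 0)) = S i k * (\<Sum>q\<in>UNIV. S q l * b' q)"
      by (subst sum.swap) (simp add: if_distrib[of "\<lambda>x. _ * x"] sum_distrib_left mult.assoc cong: if_cong)
    also have "(\<Sum>p\<in>UNIV. \<Sum>q\<in>UNIV. S p k * S q l * (if q = i then b' p else 0)) = S i l * (\<Sum>p\<in>UNIV. S p k * b' p)"
      by (simp add: if_distrib[of "\<lambda>x. _ * x"] sum_distrib_left mult_ac cong: if_cong)
    finally show "pullback2 S Y k l = S i k * b c x [axis l 1] - S i l * b c x [axis k 1]"
      by (simp add: bm)
  qed
  have "(\<Sum>a\<in>UNIV. S i a * cross (coef2 (H c x)) (\<lambda>m. b c x [axis m 1]) a) =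
      pf_pair (coef2 (H c x)) (pullback2 S Y)"
    by (simp add: cross_pair pull)
  also have "\<dots> = det4 (S 1) (S 2) (S 3) (S 4) * pf_pair (coef2 (H c' (?T x))) Y"
    unfolding coef2_transition[OF H c, folded S_def]
    by (rule pf_pair_pullback2[OF alt2_coef2[OF tensorialD(1)[OF H c(2) Tx]] altY])
  also have "pf_pair (coef2 (H c' (?T x))) Y = cross (coef2 (H c' (?T x))) b' i"
  proof -
    have "Y = (\<lambda>k l. of_bool (k = i) * b' l - of_bool (l = i) * b' k)"
      by (simp add: Y_def fun_eq_iff)
    then have "pf_pair (coef2 (H c' (?T x))) Y =
        (\<Sum>a\<in>UNIV. of_bool (a = i) * cross (coef2 (H c' (?T x))) b' a)"
      by (simp add: cross_pair)
    then show ?thesis by (simp add: of_bool_def if_distrib[of "\<lambda>x. x * _"] cong: if_cong)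
  qed
  finally show ?thesis
    unfolding det_transition by (simp add: S_def[abs_def] b'_def[abs_def])
qed

text \<open>The charts need not be compatible with the orientation: the density is \<open>|pfw|\<close>, and the locally constant
  sign of \<open>pfw\<close> is carried along.\<close>

theorem exact_pairing_eq_0:
  fixes H b :: "('a, 4, complex) form"
  assumes cpt: "compact_space X"
    and H: "tensorial A 2 H" "differentiable_form A 1 H"
    and closed: "\<And>c x u v w. c \<in> A \<Longrightarrow> x \<in> chart_range c \<Longrightarrow> coef3 (ext_d H c x) u v w = 0"
    and b: "tensorial A 1 b" "differentiable_form A 1 b"
    and nonneg: "\<And>c x. c \<in> A \<Longrightarrow> x \<in> chart_range c \<Longrightarrow>
      \<exists>r\<ge>0. pf_pair (coef2 (H c x)) (coef2 (ext_d b c x)) / of_real (pfw c x) = of_real r"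
    and c0: "c0 \<in> A" "x0 \<in> chart_range c0"
  shows "pf_pair (coef2 (H c0 x0)) (coef2 (ext_d b c0 x0)) = 0"
proof -
  let ?C = "\<lambda>c x. cross (coef2 (H c x)) (\<lambda>m. b c x [axis m 1])"
  define \<mu> where "\<mu> c x = \<bar>pfw c x\<bar>" for c x
  \<comment> \<open>The real part makes the field real. No information is lost, because
    \<open>nonneg\<close> says that the pairing divided by \<open>pfw\<close> is a real
    number.\<close>
  define V where "V c x = (\<chi> a. Re (?C c x a) / pfw c x)" for c x
  have cont: "continuous_on (chart_range c) (pfw c)" if "c \<in> A" for c
    using pfw_differentiable[OF that, of 0] by simp
  have C1: "times_differentiable_on 1 (chart_range c) (\<lambda>x. ?C c x a)" if "c \<in> A" for c a
    unfolding coef2_def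
    by (rule times_differentiable_on_cross[OF open_range[OF that]])
      (rule differentiable_formD[OF H(2) that] differentiable_formD[OF b(2) that])+
  have R1: "times_differentiable_on 1 (chart_range c) (\<lambda>x. Re (?C c x a))" if "c \<in> A" for c a
    by (rule times_differentiable_on_bounded_linear[OF open_range[OF that] C1[OF that] bounded_linear_Re])
  have flux: "\<mu> c x * V c x $ a = sgn (pfw c x) * Re (?C c x a)" if "c \<in> A" "x \<in> chart_range c" for c x a
    using pfw_nonzero[OF that] by (simp add: \<mu>_def V_def sgn_if)
  have sl: "times_differentiable_on 1 (chart_range c) (\<lambda>x. sgn (pfw c x) * Re (?C c x a))"
    "x \<in> chart_range c \<Longrightarrow> frechet_derivative (\<lambda>x. sgn (pfw c x) * Re (?C c x a)) (at x) v =
      sgn (pfw c x) * frechet_derivative (\<lambda>x. Re (?C c x a)) (at x) v" if c: "c \<in> A" for c x a v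
    using sgn_mult_local[OF open_range[OF c] cont[OF c] pfw_nonzero[OF c] R1[OF c]] by blast+
  interpret flux_field X A \<mu> V
  proof
    fix c c' x assume c: "c \<in> A" "c' \<in> A" "x \<in> overlap c c'"
    let ?S = "frechet_derivative (transition c c') (at x)"
    have x: "x \<in> chart_range c" "transition c c' x \<in> chart_range c'"
      using c(3) transition_maps(1)[OF c] by blast+
    show "\<mu> c x = \<bar>det (matrix ?S)\<bar> * \<mu> c' (transition c c' x)"
      unfolding \<mu>_def pfw_transition[OF c] by (simp add: abs_mult)
    have d: "det (matrix ?S) \<noteq> 0" using pfw_nonzero[OF c(1) x(1)] pfw_transition[OF c] by auto
    have linS: "linear ?S" by (rule has_derivative_linear[OF transition_has_derivative[OF c]])
    show "?S (V c x) = V c' (transition c c' x)"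
    proof (rule vec_eq_iff[THEN iffD2], rule allI)
      fix i
      have "?S (V c x) $ i = (\<Sum>a\<in>UNIV. V c x $ a * ?S (axis a 1) $ i)"
        using linear_euclidean_expand[OF linS, of "V c x"] by simp
      also have "\<dots> = Re (\<Sum>a\<in>UNIV. of_real (?S (axis a 1) $ i) * ?C c x a) / pfw c x"
        by (simp add: V_def sum_divide_distrib mult.commute)
      also have "\<dots> = V c' (transition c c' x) $ i"
        unfolding cross_transition[OF H(1) b(1) c] pfw_transition[OF c] using d by (simp add: V_def)
      finally show "?S (V c x) $ i = V c' (transition c c' x) $ i" .
    qed
  next
    fix c a assume c: "c \<in> A"
    show "times_differentiable_on 1 (chart_range c) (\<lambda>x. \<mu> c x * V c x $ a)"
      by (rule times_differentiable_on_cong[OF open_range[OF c] _ sl(1)[OF c, where a = a]]) (simp add: flux c)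
  qed
  have div: "flux_div c x = sgn (pfw c x) * Re (pf_pair (coef2 (H c x)) (coef2 (ext_d b c x)))"
    if c: "c \<in> A" "x \<in> chart_range c" for c x
  proof -
    have "frechet_derivative (\<lambda>y. \<mu> c y * V c y $ a) (at x) = frechet_derivative (\<lambda>y. sgn (pfw c y) * Re (?C c y a)) (at x)" for a
      by (rule frechet_derivative_cong_open[OF open_range[OF c(1)] c(2)]) (rule flux[OF c(1)])
    then have 1: "flux_div c x = sgn (pfw c x) * (\<Sum>a\<in>UNIV. frechet_derivative (\<lambda>y. Re (?C c y a)) (at x) (axis a 1))"
      by (simp add: flux_div_def sl(2)[OF c] sum_distrib_left)
    have 2: "frechet_derivative (\<lambda>y. Re (?C c y a)) (at x) = (\<lambda>v. Re (frechet_derivative (\<lambda>y. ?C c y a) (at x) v))" for a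
      by (intro frechet_derivative_eq bounded_linear.has_derivative[OF bounded_linear_Re]
          times_differentiable_on_1D(3)[OF C1[OF c(1)] c(2)])
    have 3: "(\<Sum>a\<in>UNIV. frechet_derivative (\<lambda>y. ?C c y a) (at x) (axis a 1)) =
        pf_pair (coef2 (H c x)) (coef2 (ext_d b c x)) + (\<Sum>m\<in>UNIV. vec3 (coef3 (ext_d H c x)) m * b c x [axis m 1])"
    proof -
      have DH: "((\<lambda>y. coef2 (H c y) k l) has_derivative frechet_derivative (\<lambda>y. H c y [axis k 1, axis l 1]) (at x)) (at x)" for k l
        unfolding coef2_def by (rule times_differentiable_on_1D(3)[OF differentiable_formD[OF H(2) c(1)] c(2)])
      have DB: "((\<lambda>y. b c y [axis m 1]) has_derivative frechet_derivative (\<lambda>y. b c y [axis m 1]) (at x)) (at x)" for m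
        by (rule times_differentiable_on_1D(3)[OF differentiable_formD[OF b(2) c(1)] c(2)])
      show ?thesis
        using div_cross[OF DH DB] by (simp add: coef2_def[of "ext_d b c x", abs_def] coef3_def[abs_def] ext_d_2 ext_d_3)
    qed
    have 4: "(\<Sum>m\<in>UNIV. vec3 (coef3 (ext_d H c x)) m * b c x [axis m 1]) = 0"
      by (simp add: vec3_def sum_4 closed[OF c])
    show ?thesis unfolding 1 2 Re_sum[symmetric] 3 4 by simp
  qed
  have pos: "flux_div c x = r * \<bar>pfw c x\<bar>" if c: "c \<in> A" "x \<in> chart_range c"
    and r: "pf_pair (coef2 (H c x)) (coef2 (ext_d b c x)) / of_real (pfw c x) = of_real r" for c x r
  proof -
    have "pf_pair (coef2 (H c x)) (coef2 (ext_d b c x)) = of_real (r * pfw c x)"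
      using r pfw_nonzero[OF c] by (simp add: field_simps)
    then show ?thesis unfolding div[OF c] by (simp add: sgn_if)
  qed
  have "flux_div c x \<ge> 0" if c: "c \<in> A" "x \<in> chart_range c" for c x
    using nonneg[OF c] pos[OF c] by auto
  from flux_div_eq_0[OF cpt this c0] have z: "flux_div c0 x0 = 0" .
  obtain r where r: "pf_pair (coef2 (H c0 x0)) (coef2 (ext_d b c0 x0)) / of_real (pfw c0 x0) = of_real r"
    using nonneg[OF c0] by blast
  with pos[OF c0 r] z pfw_nonzero[OF c0] show ?thesis by simp
qed

end

section \<open>Closedness of three-forms obtained by wedging with \<omega>\<close>

lemma det4_expand_last:
  "det4 u v w A = (\<Sum>a\<in>UNIV. A a * det4 u v w (\<lambda>i. if i = a then 1 else 0))"
  unfolding sum_4 det4_def by (simp add: algebra_simps)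

text \<open>Five vectors in a space of dimension four, here u, v, w, z and the \<open>a\<close>-th
  basis vector, satisfy an alternating linear relation with their determinants as
  coefficients.\<close>

lemma det4_exchange:
  "det4 v w z (\<lambda>i. if i = a then 1 else 0) * u k - det4 u w z (\<lambda>i. if i = a then 1 else 0) * v k
    + det4 u v z (\<lambda>i. if i = a then 1 else 0) * w k - det4 u v w (\<lambda>i. if i = a then 1 else 0) * z k
    = (if a = k then - det4 u v w z else 0)"
proof -
  have "\<forall>a k. det4 v w z (\<lambda>i. if i = a then 1 else 0) * u k - det4 u w z (\<lambda>i. if i = a then 1 else 0) * v k
    + det4 u v z (\<lambda>i. if i = a then 1 else 0) * w k - det4 u v w (\<lambda>i. if i = a then 1 else 0) * z k
    = (if a = k then - det4 u v w z else 0)"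
    unfolding forall_4 det4_def by (simp add: algebra_simps)
  then show ?thesis by blast
qed

text \<open>With \<open>M a k\<close> the derivative of the component B a in direction
  \<open>k\<close>, the left side is the exterior derivative of the three-form
  \<open>det4 _ _ _ B\<close> and the trace is the divergence of B.\<close>

lemma det4_trace:
  "det4 v w z (\<lambda>a. \<Sum>k\<in>UNIV. u k * M a k) - det4 u w z (\<lambda>a. \<Sum>k\<in>UNIV. v k * M a k)
    + det4 u v z (\<lambda>a. \<Sum>k\<in>UNIV. w k * M a k) - det4 u v w (\<lambda>a. \<Sum>k\<in>UNIV. z k * M a k)
    = - det4 u v w z * (\<Sum>a\<in>UNIV. M a a)"
proof -
  let ?e = "\<lambda>a i. if i = a then 1 else 0"
  have "det4 v w z (\<lambda>a. \<Sum>k\<in>UNIV. u k * M a k) - det4 u w z (\<lambda>a. \<Sum>k\<in>UNIV. v k * M a k)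
    + det4 u v z (\<lambda>a. \<Sum>k\<in>UNIV. w k * M a k) - det4 u v w (\<lambda>a. \<Sum>k\<in>UNIV. z k * M a k)
    = (\<Sum>a\<in>UNIV. \<Sum>k\<in>UNIV. M a k * (det4 v w z (?e a) * u k - det4 u w z (?e a) * v k
    + det4 u v z (?e a) * w k - det4 u v w (?e a) * z k))"
    unfolding det4_expand_last[of v w z "\<lambda>a. \<Sum>k\<in>UNIV. u k * M a k"]
      det4_expand_last[of u w z "\<lambda>a. \<Sum>k\<in>UNIV. v k * M a k"]
      det4_expand_last[of u v z "\<lambda>a. \<Sum>k\<in>UNIV. w k * M a k"]
      det4_expand_last[of u v w "\<lambda>a. \<Sum>k\<in>UNIV. z k * M a k"]
    by (simp add: sum_distrib_right sum_subtractf[symmetric] sum.distrib[symmetric])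
      (simp add: algebra_simps)
  also have "\<dots> = (\<Sum>a\<in>UNIV. M a a * (- det4 u v w z))"
    unfolding det4_exchange by (simp add: if_distrib[of "\<lambda>x. _ * x"] cong: if_cong)
  finally show ?thesis unfolding sum_distrib_right[symmetric] by (simp only: mult.commute)
qed

lemma pf_pair_sum_right:
  "pf_pair X (\<lambda>i k. \<Sum>l\<in>I. s l * N i k l) = (\<Sum>l\<in>I. s l * pf_pair X (\<lambda>i k. N i k l))"
  unfolding pf_pair_def
  by (simp add: sum_distrib_left sum.distrib[symmetric] sum_subtractf[symmetric] algebra_simps)

text \<open>J preserves the form and therefore its nonzero Pfaffian.\<close>

lemma (in hermitian_space) det_j: "det (matrix j) = 1"
proof -
  have "coef2 w = pullback2 (\<lambda>k a. of_real (j (axis a 1) $ k)) (coef2 w)"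
    unfolding pullback2_coef2[OF alt, of "\<lambda>a. j (axis a 1)"] by (simp add: compat coef2_def[abs_def])
  from arg_cong[OF this, of pf] have "pf (coef2 w) = det (matrix j) * pf (coef2 w)"
    by (simp add: pf_pullback2[OF alt2_coef2[OF alt]] det_4 matrix_def)
  then show ?thesis using pf_nonzero by simp
qed

lemma hodge_zero: "(\<And>vs. a vs = 0) \<Longrightarrow> hodge g w a vs = 0"
  by (simp add: hodge_def)

lemma contraction_zero: "(\<And>i k. a (axis i 1 # axis k 1 # vs) = 0) \<Longrightarrow> contraction g w a vs = 0"
  by (simp add: contraction_def)

context almost_kaehler_4
begin

abbreviation \<Omega> :: "('a, 4, complex) form" where
  "\<Omega> \<equiv> \<lambda>c x vs. complex_of_real (\<omega> c x vs)"

lemma tensorial_Omega: "tensorial A 2 \<Omega>"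
proof -
  have "alternating_form 2 (\<Omega> c x)" if "c \<in> A" "x \<in> chart_range c" for c x
    by (rule alternating_form_linear_comp[OF tensorialD(1)[OF tensorial_omega that]])
      (rule bounded_linear.linear[OF bounded_linear_of_real])
  then show ?thesis
    using tensorialD(2)[OF tensorial_omega] unfolding tensorial_def by simp
qed

lemma differentiable_Omega: "differentiable_form A r \<Omega>"
  unfolding differentiable_form_def
  by (intro ballI allI times_differentiable_on_of_real open_range differentiable_formD[OF differentiable_omega])

lemma coef2_Omega: "coef2 (\<Omega> c x) = (\<lambda>k l. complex_of_real (coef2 (\<omega> c x) k l))"
  by (simp add: coef2_def fun_eq_iff)

lemma alt2_Omega: "c \<in> A \<Longrightarrow> x \<in> chart_range c \<Longrightarrow> alt2 (coef2 (\<Omega> c x))"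
  by (rule alt2_coef2[OF tensorialD(1)[OF tensorial_Omega]])

lemma pf_Omega: "pf (coef2 (\<Omega> c x)) = of_real (pfw c x)"
  by (simp add: pf_def pfw_def coef2_def)

lemma Omega_derivative:
  assumes "c \<in> A" "x \<in> chart_range c"
  shows "((\<lambda>y. \<Omega> c y vs) has_derivative (\<lambda>v. of_real (frechet_derivative (\<lambda>y. \<omega> c y vs) (at x) v))) (at x)"
  by (rule bounded_linear.has_derivative[OF bounded_linear_of_real
        times_differentiable_on_1D(3)[OF differentiable_formD[OF differentiable_omega assms(1)] assms(2)]])

lemma closed_Omega:
  assumes "c \<in> A" "x \<in> chart_range c"
  shows "ext_d \<Omega> c x [u, v, w] = 0"
proof -
  have "ext_d \<Omega> c x [u, v, w] = of_real (ext_d \<omega> c x [u, v, w])"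
    by (simp add: ext_d_3 frechet_derivative_eq[OF Omega_derivative[OF assms]])
  then show ?thesis by (simp add: closed_omega[OF assms])
qed

lemma div_cross_Omega:
  fixes e :: "('a, 4, complex) form"
  assumes e: "differentiable_form A 1 e" and c: "c \<in> A" "x \<in> chart_range c"
  shows "(\<Sum>a\<in>UNIV. frechet_derivative (\<lambda>y. cross (coef2 (\<Omega> c y)) (\<lambda>m. e c y [axis m 1]) a) (at x) (axis a 1)) =
    pf_pair (coef2 (\<Omega> c x)) (coef2 (ext_d e c x))"
proof -
  have DH: "((\<lambda>y. coef2 (\<Omega> c y) k l) has_derivative
      frechet_derivative (\<lambda>y. \<Omega> c y [axis k 1, axis l 1]) (at x)) (at x)" for k l
    unfolding coef2_def
    by (rule times_differentiable_on_1D(3)[OF differentiable_formD[OF differentiable_Omega c(1)] c(2)])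
  have DB: "((\<lambda>y. e c y [axis m 1]) has_derivative frechet_derivative (\<lambda>y. e c y [axis m 1]) (at x)) (at x)" for m
    by (rule times_differentiable_on_1D(3)[OF differentiable_formD[OF e c(1)] c(2)])
  have "(\<Sum>a\<in>UNIV. frechet_derivative (\<lambda>y. cross (coef2 (\<Omega> c y)) (\<lambda>m. e c y [axis m 1]) a) (at x) (axis a 1)) =
    pf_pair (coef2 (\<Omega> c x)) (coef2 (ext_d e c x)) + (\<Sum>m\<in>UNIV. vec3 (coef3 (ext_d \<Omega> c x)) m * e c x [axis m 1])"
    using div_cross[OF DH DB] by (simp add: coef2_def[of "ext_d e c x", abs_def] coef3_def[abs_def] ext_d_2 ext_d_3)
  then show ?thesis by (simp add: vec3_def sum_4 coef3_def closed_Omega[OF c])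
qed

text \<open>Up to sign \<gamma> is s times \<omega> \<and> e, and \<omega> is closed, so d\<gamma>
  is a nonzero multiple of \<omega> \<and> de. It serves \<alpha> with e = \<beta>, s = 1 and
  J\<alpha> with e = \<eta>, s = -1.\<close>

lemma closed_3form_iff:
  fixes \<gamma> e :: "('a, 4, complex) form"
  assumes c: "c \<in> A" "x \<in> chart_range c"
    and \<gamma>: "\<And>y. y \<in> chart_range c \<Longrightarrow> alternating_form 3 (\<gamma> c y)"
    and v3: "\<And>y a. y \<in> chart_range c \<Longrightarrow>
      vec3 (coef3 (\<gamma> c y)) a = s * cross (coef2 (\<Omega> c y)) (\<lambda>m. e c y [axis m 1]) a"
    and e: "differentiable_form A 1 e" and s: "s \<noteq> 0"
  shows "(\<forall>vs. ext_d \<gamma> c x vs = 0) \<longleftrightarrow> pf_pair (coef2 (\<Omega> c x)) (coef2 (ext_d e c x)) = 0"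
proof -
  define B where "B a y = s * cross (coef2 (\<Omega> c y)) (\<lambda>m. e c y [axis m 1]) a" for a y
  define DB where "DB a = frechet_derivative (B a) (at x)" for a
  have C1: "times_differentiable_on 1 (chart_range c) (\<lambda>y. cross (coef2 (\<Omega> c y)) (\<lambda>m. e c y [axis m 1]) a)" for a
    unfolding coef2_def
    by (rule times_differentiable_on_cross[OF open_range[OF c(1)]])
      (rule differentiable_formD[OF differentiable_Omega c(1)] differentiable_formD[OF e c(1)])+
  note C1' = times_differentiable_on_1D(3)[OF C1 c(2)]
  have Bd: "(B a has_derivative (\<lambda>v. s * frechet_derivative (\<lambda>y. cross (coef2 (\<Omega> c y)) (\<lambda>m. e c y [axis m 1]) a) (at x) v)) (at x)" for a
    unfolding B_def by (rule has_derivative_mult_right[OF C1'])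
  have DB: "(B a has_derivative DB a) (at x)" for a
    using Bd[of a] frechet_derivative_eq[OF Bd[of a]] by (simp add: DB_def)
  have tr: "(\<Sum>a\<in>UNIV. DB a (axis a 1)) = s * pf_pair (coef2 (\<Omega> c x)) (coef2 (ext_d e c x))"
    unfolding DB_def frechet_derivative_eq[OF Bd] div_cross_Omega[OF e c, symmetric]
    by (simp add: sum_distrib_left)
  let ?r = "\<lambda>u i. complex_of_real (u $ i)"
  have D3: "frechet_derivative (\<lambda>y. \<gamma> c y [u, v, w]) (at x) z =
      det4 (?r u) (?r v) (?r w) (\<lambda>a. \<Sum>k\<in>UNIV. ?r z k * DB a (axis k 1))" for u v w z
  proof -
    have "frechet_derivative (\<lambda>y. \<gamma> c y [u, v, w]) (at x) =
      frechet_derivative (\<lambda>y. \<Sum>a\<in>UNIV. B a y * det4 (?r u) (?r v) (?r w) (\<lambda>i. if i = a then 1 else 0)) (at x)"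
    proof (rule frechet_derivative_cong_open[OF open_range[OF c(1)] c(2)])
      fix y assume y: "y \<in> chart_range c"
      have "vec3 (coef3 (\<gamma> c y)) = (\<lambda>a. B a y)" using v3[OF y] by (simp add: B_def fun_eq_iff)
      then show "\<gamma> c y [u, v, w] = (\<Sum>a\<in>UNIV. B a y * det4 (?r u) (?r v) (?r w) (\<lambda>i. if i = a then 1 else 0))"
        by (simp add: alternating_form_3_det4[OF \<gamma>[OF y]] det4_expand_last[of _ _ _ "\<lambda>a. B a y"])
    qed
    also have "\<dots> = (\<lambda>z. \<Sum>a\<in>UNIV. DB a z * det4 (?r u) (?r v) (?r w) (\<lambda>i. if i = a then 1 else 0))"
      by (intro frechet_derivative_eq has_derivative_sum has_derivative_mult_left DB)
    finally have "frechet_derivative (\<lambda>y. \<gamma> c y [u, v, w]) (at x) z = det4 (?r u) (?r v) (?r w) (\<lambda>a. DB a z)"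
      by (simp add: det4_expand_last[of _ _ _ "\<lambda>a. DB a z"])
    moreover have "DB a z = (\<Sum>k\<in>UNIV. ?r z k * DB a (axis k 1))" for a
      by (rule linear_expand_of_real[OF has_derivative_linear[OF DB]])
    ultimately show ?thesis by simp
  qed
  have d4: "ext_d \<gamma> c x [u, v, w, z] = - det4 (?r u) (?r v) (?r w) (?r z) * (\<Sum>a\<in>UNIV. DB a (axis a 1))" for u v w z
    unfolding ext_d_4 D3 by (rule det4_trace)
  have other: "ext_d \<gamma> c x vs = 0" if l: "length vs \<noteq> 4" for vs
  proof (rule ext_d_eq_0[OF open_range[OF c(1)] c(2)])
    fix y and us :: "(real^4) list"
    assume y: "y \<in> chart_range c" and "length us = length vs - 1"
    then have "length us \<noteq> 3" using l by linarith
    then show "\<gamma> c y us = 0" using \<gamma>[OF y] unfolding alternating_form_def by blast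
  qed
  show ?thesis
  proof
    assume "\<forall>vs. ext_d \<gamma> c x vs = 0"
    then have "ext_d \<gamma> c x [axis 1 1, axis 2 1, axis 3 1, axis 4 1] = 0" by blast
    then show "pf_pair (coef2 (\<Omega> c x)) (coef2 (ext_d e c x)) = 0"
      unfolding d4 tr using s by (simp add: det4_def axis_def)
  next
    assume z: "pf_pair (coef2 (\<Omega> c x)) (coef2 (ext_d e c x)) = 0"
    show "\<forall>vs. ext_d \<gamma> c x vs = 0"
    proof
      fix vs show "ext_d \<gamma> c x vs = 0"
      proof (cases "length vs = 4")
        case True
        then obtain u v w y where "vs = [u, v, w, y]"
          by (auto simp: length_Suc_conv eval_nat_numeral)
        then show ?thesis using z by (simp add: d4 tr)
      qed (rule other)
    qed
  qed
qed

end

section \<open>The action of J on forms over the manifold\<close>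

lemma tensorial_1I:
  fixes b :: "('a, 'n::finite, 'b::real_vector) form"
  assumes "\<And>c x vs. c \<in> A \<Longrightarrow> x \<in> chart_range c \<Longrightarrow> length vs \<noteq> 1 \<Longrightarrow> b c x vs = 0"
    "\<And>c x. c \<in> A \<Longrightarrow> x \<in> chart_range c \<Longrightarrow> linear (\<lambda>v. b c x [v])"
    "\<And>c c' x v. c \<in> A \<Longrightarrow> c' \<in> A \<Longrightarrow> x \<in> overlap c c' \<Longrightarrow>
      b c x [v] = b c' (transition c c' x) [frechet_derivative (transition c c') (at x) v]"
  shows "tensorial A 1 b"
  unfolding tensorial_def alternating_form_1_iff
proof (intro conjI ballI allI impI)
  fix c c' x and vs :: "(real, 'n) vec list"
  assume h: "c \<in> A" "c' \<in> A" "x \<in> overlap c c'" and "length vs = 1"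
  then obtain v where "vs = [v]" by (auto simp: length_Suc_conv)
  then show "b c x vs = b c' (transition c c' x) (map (frechet_derivative (transition c c') (at x)) vs)"
    using assms(3)[OF h] by simp
qed (use assms in blast)+

context almost_kaehler_4
begin

lemma transition_linear: "c \<in> A \<Longrightarrow> c' \<in> A \<Longrightarrow> x \<in> overlap c c' \<Longrightarrow>
    linear (frechet_derivative (transition c c') (at x))"
  by (rule has_derivative_linear[OF transition_has_derivative])

lemma differentiable_J_component:
  "c \<in> A \<Longrightarrow> times_differentiable_on r (chart_range c) (\<lambda>x. J c x v $ k)"
  by (rule times_differentiable_on_bounded_linear[OF open_range J_differentiable bounded_linear_vec_nth])

text \<open>By \<open>J_act_eq\<close> this is the action \<open>J_op\<close>, rid of the sum over
  bidegrees.\<close>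

definition J_twist :: "('a, 4, complex) form \<Rightarrow> ('a, 4, complex) form" where
  "J_twist F c x vs = F c x (map (J c x) vs)"

lemma tensorial_J_twist:
  assumes "tensorial A k F"
  shows "tensorial A k (J_twist F)"
  unfolding tensorial_def
proof (intro conjI ballI allI impI)
  show "alternating_form k (J_twist F c x)" if "c \<in> A" "x \<in> chart_range c" for c x
    unfolding J_twist_def
    by (rule alternating_form_comp_linear[OF tensorialD(1)[OF assms that] hermitian_space.lin_j[OF hermitian[OF that]]])
next
  fix c c' x and vs :: "(real^4) list"
  assume c: "c \<in> A" "c' \<in> A" "x \<in> overlap c c'" and l: "length vs = k"
  have "J_twist F c x vs = F c' (transition c c' x) (map (frechet_derivative (transition c c') (at x)) (map (J c x) vs))"
    unfolding J_twist_def by (rule tensorialD(2)[OF assms c]) (simp add: l)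
  also have "map (frechet_derivative (transition c c') (at x)) (map (J c x) vs) =
      map (J c' (transition c c' x)) (map (frechet_derivative (transition c c') (at x)) vs)"
    by (simp only: map_map) (rule map_cong[OF refl], simp only: comp_apply J_transition[OF c, simplified comp_apply])
  finally show "J_twist F c x vs = J_twist F c' (transition c c' x) (map (frechet_derivative (transition c c') (at x)) vs)"
    unfolding J_twist_def .
qed

text \<open>Regularity of J and of F is given on constant vectors, whereas the argument Jv varies;
  it is therefore expanded in the standard basis.\<close>

lemma differentiable_J_twist_1:
  assumes "tensorial A 1 F" "differentiable_form A r F"
  shows "differentiable_form A r (J_twist F)"
  unfolding differentiable_form_def
proof (intro ballI allI)
  fix c and vs :: "(real^4) list" assume c: "c \<in> A"
  have F: "alternating_form 1 (F c x)" if "x \<in> chart_range c" for x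
    by (rule tensorialD(1)[OF assms(1) c that])
  show "times_differentiable_on r (chart_range c) (\<lambda>x. J_twist F c x vs)"
  proof (cases "length vs = 1")
    case False
    then show ?thesis
      using F unfolding alternating_form_1_iff J_twist_def
      by (intro times_differentiable_on_cong[OF open_range[OF c] _ times_differentiable_on_const[of _ _ 0]]) simp
  next
    case True
    then obtain v where v: "vs = [v]" by (auto simp: length_Suc_conv)
    have eq: "(\<Sum>k\<in>UNIV. of_real (J c x v $ k) * F c x [axis k 1]) = J_twist F c x vs" if "x \<in> chart_range c" for x
      using F[OF that] linear_expand_of_real[of "\<lambda>u. F c x [u]" "J c x v"]
      unfolding alternating_form_1_iff J_twist_def v by simp
    show ?thesis
      by (rule times_differentiable_on_cong[OF open_range[OF c] eq])
        (assumption, intro times_differentiable_on_sum times_differentiable_on_mult times_differentiable_on_of_real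
          open_range[OF c] differentiable_J_component[OF c] differentiable_formD[OF assms(2) c])
  qed
qed

lemma differentiable_J_twist_2:
  assumes "tensorial A 2 F" "differentiable_form A r F"
  shows "differentiable_form A r (J_twist F)"
  unfolding differentiable_form_def
proof (intro ballI allI)
  fix c and vs :: "(real^4) list" assume c: "c \<in> A"
  have F: "alternating_form 2 (F c x)" if "x \<in> chart_range c" for x
    by (rule tensorialD(1)[OF assms(1) c that])
  show "times_differentiable_on r (chart_range c) (\<lambda>x. J_twist F c x vs)"
  proof (cases "length vs = 2")
    case False
    then have "J_twist F c x vs = 0" if "x \<in> chart_range c" for x
      using F[OF that] unfolding alternating_form_def J_twist_def by simp
    then show ?thesis
      by (intro times_differentiable_on_cong[OF open_range[OF c] _ times_differentiable_on_const[of _ _ 0]]) simp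
  next
    case True
    then obtain u v where v: "vs = [u, v]" by (auto simp: length_Suc_conv numeral_2_eq_2)
    have eq: "(\<Sum>k\<in>UNIV. \<Sum>l\<in>UNIV. of_real (J c x u $ k) * of_real (J c x v $ l) * F c x [axis k 1, axis l 1])
        = J_twist F c x vs" if "x \<in> chart_range c" for x
      using bilinear_expand[of "\<lambda>u v. F c x [u, v]" "J c x u" "J c x v", OF alternating_form_2D(1,2)[OF F[OF that]]]
      unfolding J_twist_def v by simp
    show ?thesis
      by (rule times_differentiable_on_cong[OF open_range[OF c] eq])
        (assumption, intro times_differentiable_on_sum times_differentiable_on_mult times_differentiable_on_of_real
          open_range[OF c] differentiable_J_component[OF c] differentiable_formD[OF assms(2) c])
  qed
qed

text \<open>Differentiating the alternation of \<open>H\<close> in its two arguments gives that of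
  dH. This is what \<open>hodge_3form_eq_0\<close> asks of the form d(J d\<beta>).\<close>

lemma alt3_ext_d:
  assumes "tensorial A 2 H" "differentiable_form A 1 H" and c: "c \<in> A" "x \<in> chart_range c"
  shows "alt3 (coef3 (ext_d H c x))"
proof -
  have D: "((\<lambda>y. H c y vs) has_derivative frechet_derivative (\<lambda>y. H c y vs) (at x)) (at x)" for vs
    by (rule times_differentiable_on_1D(3)[OF differentiable_formD[OF assms(2) c(1)] c(2)])
  have sw: "frechet_derivative (\<lambda>y. H c y [v, u]) (at x) = (\<lambda>w. - frechet_derivative (\<lambda>y. H c y [u, v]) (at x) w)" for u v
  proof -
    have "frechet_derivative (\<lambda>y. H c y [v, u]) (at x) = frechet_derivative (\<lambda>y. - H c y [u, v]) (at x)"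
      by (rule frechet_derivative_cong_open[OF open_range[OF c(1)] c(2)])
        (rule alternating_form_2D(4)[OF tensorialD(1)[OF assms(1) c(1)]])
    also have "\<dots> = (\<lambda>w. - frechet_derivative (\<lambda>y. H c y [u, v]) (at x) w)"
      by (rule frechet_derivative_eq[OF has_derivative_minus[OF D]])
    finally show ?thesis .
  qed
  have z: "frechet_derivative (\<lambda>y. H c y [u, u]) (at x) w = 0" for u w
  proof -
    have "frechet_derivative (\<lambda>y. H c y [u, u]) (at x) = frechet_derivative (\<lambda>y. 0) (at x)"
      by (rule frechet_derivative_cong_open[OF open_range[OF c(1)] c(2)])
        (rule alternating_form_2D(3)[OF tensorialD(1)[OF assms(1) c(1)]])
    then show ?thesis by simp
  qed
  let ?D = "\<lambda>u v w. frechet_derivative (\<lambda>y. H c y [axis u 1, axis v 1]) (at x) (axis w 1)"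
  have s1: "?D v u w = - ?D u v w" for u v w by (rule fun_cong[OF sw])
  have s2: "?D u u w = 0" for u w by (rule z)
  have e: "coef3 (ext_d H c x) u v w = ?D v w u - ?D u w v + ?D u v w" for u v w
    by (simp add: coef3_def ext_d_3)
  show ?thesis
    unfolding alt3_def e
  proof (intro conjI allI)
    fix u v w
    show "?D u v u - ?D u v u + ?D u u v = 0" "?D u u v - ?D v u u + ?D v u u = 0"
      by (simp_all only: s2 diff_self add_0 diff_0 add.left_inverse)
    show "?D v u u - ?D u u v + ?D u v u = 0"
      by (simp only: s1[of u v u] s2) simp
    show "?D u w v - ?D v w u + ?D v u w = - (?D v w u - ?D u w v + ?D u v w)"
      by (simp only: s1[of u v w]) simp
    show "?D w v u - ?D u v w + ?D u w v = - (?D v w u - ?D u w v + ?D u v w)"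
      by (simp only: s1[of v w u]) simp
  qed
qed

section \<open>The one-forms attached to a three-form\<close>

context
  fixes \<alpha> :: "('a, 4, complex) form"
  assumes \<alpha>: "smooth_form A 3 \<alpha>"
begin

lemma tensorial_alpha: "tensorial A 3 \<alpha>"
  and differentiable_alpha: "differentiable_form A r \<alpha>"
  using \<alpha> unfolding smooth_form_def tensorial_def differentiable_form_def smooth_on_def by blast+

text \<open>\<open>sharp\<close> is the vector field \<open>W\<close> of the introduction; the two lemmas \<open>star_alpha\<close> and \<open>Lambda_alpha\<close>
  identify \<open>\<eta>\<close> with \<open>*\<alpha>\<close> and \<open>\<beta>\<close> with \<open>-\<Lambda>\<alpha>\<close>.\<close>

definition sharp :: "('a, 4) chart \<Rightarrow> real^4 \<Rightarrow> 4 \<Rightarrow> complex" where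
  "sharp c x k = vec3 (coef3 (\<alpha> c x)) k / of_real (pfw c x)"

definition \<beta> :: "('a, 4, complex) form" where
  "\<beta> c x vs = (if length vs = 1 then \<Sum>k\<in>UNIV. sharp c x k * \<Omega> c x [axis k 1, hd vs] else 0)"

definition \<eta> :: "('a, 4, complex) form" where
  "\<eta> c x vs = - J_twist \<beta> c x vs"

lemma differentiable_sharp:
  assumes "c \<in> A"
  shows "times_differentiable_on r (chart_range c) (\<lambda>x. sharp c x k)"
proof -
  note t = differentiable_formD[OF differentiable_alpha assms]
  have "times_differentiable_on r (chart_range c) (\<lambda>x. vec3 (coef3 (\<alpha> c x)) k)"
    unfolding vec3_def coef3_def
    by (cases "k = 1"; cases "k = 2"; cases "k = 3")
      (simp_all add: t times_differentiable_on_minus open_range assms)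
  then show ?thesis
    unfolding sharp_def
    by (intro times_differentiable_on_divide times_differentiable_on_of_real open_range[OF assms]
        pfw_differentiable assms) (simp_all add: pfw_nonzero[OF assms])
qed

lemma differentiable_beta: "differentiable_form A r \<beta>"
  unfolding differentiable_form_def
proof (intro ballI allI)
  fix c and vs :: "(real^4) list" assume c: "c \<in> A"
  have "times_differentiable_on r (chart_range c) (\<lambda>x. \<Sum>k\<in>UNIV. sharp c x k * \<Omega> c x [axis k 1, hd vs])"
    by (intro times_differentiable_on_sum times_differentiable_on_mult open_range differentiable_sharp
        differentiable_formD[OF differentiable_Omega] c)
  then show "times_differentiable_on r (chart_range c) (\<lambda>x. \<beta> c x vs)"
    unfolding \<beta>_def by (cases "length vs = 1") (simp_all only: simp_thms if_True if_False times_differentiable_on_const)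
qed

text \<open>Numerator and denominator of \<open>sharp\<close> both acquire the determinant of the
  transition map, so the quotient is a vector field.\<close>

lemma sharp_transition:
  assumes c: "c \<in> A" "c' \<in> A" "x \<in> overlap c c'"
  shows "(\<Sum>k\<in>UNIV. of_real (frechet_derivative (transition c c') (at x) (axis k 1) $ m) * sharp c x k) = sharp c' (transition c c' x) m"
proof -
  let ?S = "frechet_derivative (transition c c') (at x)"
  have x: "x \<in> chart_range c" "transition c c' x \<in> chart_range c'"
    using c(3) transition_maps(1)[OF c] by blast+
  have d: "det (matrix ?S) \<noteq> 0" using pfw_nonzero[OF c(1) x(1)] pfw_transition[OF c] by auto
  have "(\<Sum>k\<in>UNIV. of_real (?S (axis k 1) $ m) * vec3 (coef3 (\<alpha> c x)) k) =
      of_real (det (matrix ?S)) * vec3 (coef3 (\<alpha> c' (transition c c' x))) m"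
  proof (rule vec3_pullback[OF tensorialD(1)[OF tensorial_alpha c(2) x(2)] transition_linear[OF c]])
    show "\<alpha> c x [u, v, w] = \<alpha> c' (transition c c' x) [?S u, ?S v, ?S w]" for u v w
      using tensorialD(2)[OF tensorial_alpha c, of "[u, v, w]"] by simp
  qed
  then have "(\<Sum>k\<in>UNIV. of_real (?S (axis k 1) $ m) * sharp c x k) =
      of_real (det (matrix ?S)) * vec3 (coef3 (\<alpha> c' (transition c c' x))) m / of_real (pfw c x)"
    by (simp add: sharp_def sum_divide_distrib[symmetric])
  then show ?thesis unfolding pfw_transition[OF c] sharp_def[of c'] using d by simp
qed

lemma tensorial_beta: "tensorial A 1 \<beta>"
proof (rule tensorial_1I)
  show "\<beta> c x vs = 0" if "length vs \<noteq> 1" for c x vs using that by (simp add: \<beta>_def)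
  show "linear (\<lambda>v. \<beta> c x [v])" if "c \<in> A" "x \<in> chart_range c" for c x
  proof -
    have l: "linear (\<lambda>v. \<Omega> c x [u, v])" for u
      by (rule alternating_form_2D(2)[OF tensorialD(1)[OF tensorial_Omega that]])
    show ?thesis
      by (rule linearI)
        (simp_all add: \<beta>_def linear_add[OF l] linear_cmul[OF l] distrib_left sum.distrib scaleR_sum_right)
  qed
next
  fix c c' x v assume c: "c \<in> A" "c' \<in> A" "x \<in> overlap c c'"
  let ?S = "frechet_derivative (transition c c') (at x)"
  let ?y = "transition c c' x"
  have y: "?y \<in> chart_range c'" using transition_maps(1)[OF c] by blast
  have l: "linear (\<lambda>u. \<Omega> c' ?y [u, ?S v])"
    by (rule alternating_form_2D(1)[OF tensorialD(1)[OF tensorial_Omega c(2) y]])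
  have "\<beta> c x [v] = (\<Sum>k\<in>UNIV. sharp c x k * \<Omega> c' ?y [?S (axis k 1), ?S v])"
    using tensorialD(2)[OF tensorial_Omega c, of "[axis k 1, v]" for k] by (simp add: \<beta>_def)
  also have "\<dots> = (\<Sum>k\<in>UNIV. sharp c x k * (\<Sum>m\<in>UNIV. of_real (?S (axis k 1) $ m) * \<Omega> c' ?y [axis m 1, ?S v]))"
    by (rule sum.cong[OF refl]) (rule arg_cong[OF linear_expand_of_real[OF l]])
  also have "\<dots> = (\<Sum>m\<in>UNIV. (\<Sum>k\<in>UNIV. of_real (?S (axis k 1) $ m) * sharp c x k) * \<Omega> c' ?y [axis m 1, ?S v])"
    by (simp only: sum_distrib_left sum_distrib_right mult_ac) (rule sum.swap)
  also have "\<dots> = \<beta> c' ?y [?S v]"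
    unfolding sharp_transition[OF c] by (simp add: \<beta>_def)
  finally show "\<beta> c x [v] = \<beta> c' ?y [?S v]" .
qed

lemma tensorial_eta: "tensorial A 1 \<eta>"
proof (rule tensorial_1I)
  note J = tensorial_J_twist[OF tensorial_beta]
  show "\<eta> c x vs = 0" if "length vs \<noteq> 1" for c x vs
    using that by (simp add: \<eta>_def J_twist_def \<beta>_def)
  show "linear (\<lambda>v. \<eta> c x [v])" if "c \<in> A" "x \<in> chart_range c" for c x
    using tensorialD(1)[OF J that] unfolding alternating_form_1_iff \<eta>_def by (intro linear_compose_neg) blast
  show "\<eta> c x [v] = \<eta> c' (transition c c' x) [frechet_derivative (transition c c') (at x) v]"
    if "c \<in> A" "c' \<in> A" "x \<in> overlap c c'" for c c' x v
    using tensorialD(2)[OF J that, of "[v]"] by (simp add: \<eta>_def)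
qed

lemma differentiable_eta: "differentiable_form A r \<eta>"
  using differentiable_J_twist_1[OF tensorial_beta differentiable_beta[of r]]
  unfolding differentiable_form_def \<eta>_def by (intro ballI allI times_differentiable_on_minus open_range) blast+

lemma eta_apply:
  assumes "c \<in> A" "x \<in> chart_range c"
  shows "\<eta> c x [v] = (\<Sum>k\<in>UNIV. sharp c x k * of_real (metric (\<omega> c x) (J c x) (axis k 1) v))"
  by (simp add: \<eta>_def J_twist_def \<beta>_def metric_def hermitian_space.w_j_left[OF hermitian[OF assms]] sum_negf)

lemma J_twist_eta:
  assumes "c \<in> A" "x \<in> chart_range c"
  shows "\<eta> c x (map (J c x) vs) = \<beta> c x vs"
proof (cases "length vs = 1")
  case True
  then obtain v where v: "vs = [v]" by (auto simp: length_Suc_conv)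
  have "linear (\<lambda>v. \<beta> c x [v])"
    using tensorialD(1)[OF tensorial_beta assms] unfolding alternating_form_1_iff by blast
  from linear_neg[OF this] show ?thesis
    by (simp add: v \<eta>_def J_twist_def hermitian_space.jj[OF hermitian[OF assms]])
next
  case False
  then show ?thesis by (simp add: \<eta>_def J_twist_def \<beta>_def)
qed

lemma star_alpha:
  assumes "c \<in> A" "x \<in> chart_range c"
  shows "star J \<omega> \<alpha> c x vs = \<eta> c x vs"
proof (cases "length vs = 1")
  case True
  then obtain v where v: "vs = [v]" by (auto simp: length_Suc_conv)
  show ?thesis
    unfolding v star_def hermitian_space.hodge_3form[OF hermitian[OF assms]
        alt3_coef3[OF tensorialD(1)[OF tensorial_alpha assms]]] eta_apply[OF assms]
    by (simp add: sharp_def pfw_def sum_divide_distrib)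
next
  case False
  have "\<alpha> c x (map (\<lambda>i. axis i 1) is) = 0" if "length is = 4 - length vs" for "is"
  proof -
    have "length (map (\<lambda>i. axis i 1 :: real^4) is) \<noteq> 3" using False that by simp
    then show ?thesis
      using tensorialD(1)[OF tensorial_alpha assms] unfolding alternating_form_def by blast
  qed
  then have "star J \<omega> \<alpha> c x vs = 0" by (simp add: star_def hodge_def)
  with False show ?thesis by (simp add: \<eta>_def J_twist_def \<beta>_def)
qed

lemma Lambda_alpha:
  assumes "c \<in> A" "x \<in> chart_range c"
  shows "dual_lefschetz J \<omega> \<alpha> c x vs = - \<beta> c x vs"
proof (cases "length vs = 1")
  case True
  then obtain v where v: "vs = [v]" by (auto simp: length_Suc_conv)
  note al = tensorialD(1)[OF tensorial_alpha assms]
  have l: "\<alpha> c x [axis i 1, axis k 1, v] = (\<Sum>l\<in>UNIV. of_real (v $ l) * coef3 (\<alpha> c x) i k l)" for i k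
    unfolding coef3_def by (rule linear_expand_of_real[OF alternating_form_3D(3)[OF al]])
  have "alt2 (\<lambda>i k. \<alpha> c x (axis i 1 # axis k 1 # [v]))"
    unfolding alt2_def by (intro conjI allI alternating_form_3D[OF al])
  from hermitian_space.contraction_eq[OF hermitian[OF assms] this]
  have "dual_lefschetz J \<omega> \<alpha> c x vs =
      pf_pair (coef2 (\<Omega> c x)) (\<lambda>i k. \<alpha> c x [axis i 1, axis k 1, v]) / of_real (pfw c x)"
    by (simp add: dual_lefschetz_def v coef2_Omega pfw_def)
  also have "pf_pair (coef2 (\<Omega> c x)) (\<lambda>i k. \<alpha> c x [axis i 1, axis k 1, v]) =
      - (\<Sum>k\<in>UNIV. vec3 (coef3 (\<alpha> c x)) k * (\<Sum>l\<in>UNIV. of_real (v $ l) * coef2 (\<Omega> c x) k l))"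
    unfolding l pf_pair_sum_right pf_pair_alt3[OF alt2_Omega[OF assms] alt3_coef3[OF al]]
    by (simp add: sum_negf sum_distrib_left mult_ac) (rule sum.swap)
  finally have "dual_lefschetz J \<omega> \<alpha> c x vs = - (\<Sum>k\<in>UNIV. vec3 (coef3 (\<alpha> c x)) k *
      (\<Sum>l\<in>UNIV. of_real (v $ l) * coef2 (\<Omega> c x) k l)) / of_real (pfw c x)" .
  moreover have "(\<Sum>l\<in>UNIV. of_real (v $ l) * coef2 (\<Omega> c x) k l) = \<Omega> c x [axis k 1, v]" for k
    unfolding coef2_def
    by (rule linear_expand_of_real[OF alternating_form_2D(2)[OF tensorialD(1)[OF tensorial_Omega assms]], symmetric])
  ultimately show ?thesis by (simp add: v \<beta>_def sharp_def sum_divide_distrib)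
next
  case False
  have "\<alpha> c x (axis i 1 # axis k 1 # vs) = 0" for i k
  proof -
    have "length (axis i 1 # axis k 1 # vs :: (real^4) list) \<noteq> 3" using False by simp
    then show ?thesis
      using tensorialD(1)[OF tensorial_alpha assms] unfolding alternating_form_def by blast
  qed
  then show ?thesis using False by (simp add: dual_lefschetz_def contraction_zero \<beta>_def)
qed

text \<open>Up to sign this says \<alpha> = \<omega> \<and> \<beta>; the factor 1 stands for the
  \<open>s\<close> of \<open>closed_3form_iff\<close>.\<close>

lemma alpha_cross:
  assumes "c \<in> A" "x \<in> chart_range c"
  shows "vec3 (coef3 (\<alpha> c x)) a = 1 * cross (coef2 (\<Omega> c x)) (\<lambda>m. \<beta> c x [axis m 1]) a"
  using cross_interior[OF alt2_Omega[OF assms], of "sharp c x" a] pfw_nonzero[OF assms]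
  by (simp add: \<beta>_def coef2_def[of "\<Omega> c x", symmetric] pf_Omega sharp_def)

text \<open>J has determinant 1, so by \<open>vec3_pullback\<close> it maps the vector of J\<alpha>
  to that of \<alpha>; the former is thus -JW times the Pfaffian. On the other side \<eta> =
  \<omega>(JW, _), to which \<open>cross_interior\<close> applies.\<close>

lemma J_alpha_cross:
  assumes "c \<in> A" "x \<in> chart_range c"
  shows "vec3 (coef3 (J_op J \<alpha> c x)) a = - 1 * cross (coef2 (\<Omega> c x)) (\<lambda>m. \<eta> c x [axis m 1]) a"
proof -
  interpret P: hermitian_space "\<omega> c x" "J c x" by (rule hermitian[OF assms])
  let ?J = "\<lambda>l m. complex_of_real (J c x (axis l 1) $ m)"
  let ?A = "vec3 (coef3 (\<alpha> c x))" and ?A' = "vec3 (coef3 (J_op J \<alpha> c x))"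
  have A: "(\<Sum>l\<in>UNIV. ?J l m * ?A' l) = ?A m" for m
    using vec3_pullback[OF tensorialD(1)[OF tensorial_alpha assms] P.lin_j, of "J_op J \<alpha> c x" m]
    by (simp add: J_op_def J_act_eq P.det_j)
  have JJ: "(\<Sum>m\<in>UNIV. ?J m a * ?J l m) = (if a = l then -1 else 0)" for l
  proof -
    have "J c x (J c x (axis l 1)) $ a = (\<Sum>m\<in>UNIV. J c x (axis l 1) $ m * J c x (axis m 1) $ a)"
      using linear_euclidean_expand[OF P.lin_j, of "J c x (axis l 1)"] by simp
    moreover have "J c x (J c x (axis l 1)) $ a = (if a = l then -1 else 0)" by (simp add: P.jj axis_def)
    ultimately have "(\<Sum>m\<in>UNIV. J c x (axis m 1) $ a * J c x (axis l 1) $ m) = (if a = l then -1 else 0)"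
      by (simp add: mult.commute)
    from arg_cong[OF this, of complex_of_real] show ?thesis by simp
  qed
  have "(\<Sum>m\<in>UNIV. ?J m a * ?A m) = (\<Sum>l\<in>UNIV. (\<Sum>m\<in>UNIV. ?J m a * ?J l m) * ?A' l)"
    unfolding A[symmetric] by (simp only: sum_distrib_left sum_distrib_right mult.assoc) (rule sum.swap)
  also have "\<dots> = - ?A' a"
    unfolding JJ by (simp add: if_distrib[of "\<lambda>x. x * _"] cong: if_cong)
  finally have A': "(\<Sum>m\<in>UNIV. ?J m a * ?A m) = - ?A' a" .
  have "\<eta> c x [axis m 1] = (\<Sum>l\<in>UNIV. (\<Sum>k\<in>UNIV. ?J k l * sharp c x k) * coef2 (\<Omega> c x) l m)" for m
  proof -
    have "\<eta> c x [axis m 1] = (\<Sum>k\<in>UNIV. sharp c x k * \<Omega> c x [J c x (axis k 1), axis m 1])"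
      unfolding eta_apply[OF assms] metric_def ..
    also have "\<dots> = (\<Sum>k\<in>UNIV. sharp c x k * (\<Sum>l\<in>UNIV. ?J k l * coef2 (\<Omega> c x) l m))"
      unfolding coef2_def
      by (rule sum.cong[OF refl]) (rule arg_cong[OF linear_expand_of_real[OF
            alternating_form_2D(1)[OF tensorialD(1)[OF tensorial_Omega assms]]]])
    also have "\<dots> = (\<Sum>l\<in>UNIV. (\<Sum>k\<in>UNIV. ?J k l * sharp c x k) * coef2 (\<Omega> c x) l m)"
      by (simp only: sum_distrib_left sum_distrib_right mult_ac) (rule sum.swap)
    finally show ?thesis .
  qed
  then have "cross (coef2 (\<Omega> c x)) (\<lambda>m. \<eta> c x [axis m 1]) a = of_real (pfw c x) * (\<Sum>k\<in>UNIV. ?J k a * sharp c x k)"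
    by (simp add: cross_interior[OF alt2_Omega[OF assms]] pf_Omega)
  also have "\<dots> = (\<Sum>m\<in>UNIV. ?J m a * ?A m)"
    using pfw_nonzero[OF assms] by (simp add: sharp_def sum_distrib_left)
  finally show ?thesis using A' by simp
qed

lemma closed_alpha_iff:
  assumes "c \<in> A" "x \<in> chart_range c"
  shows "(\<forall>vs. ext_d \<alpha> c x vs = 0) \<longleftrightarrow> pf_pair (coef2 (\<Omega> c x)) (coef2 (ext_d \<beta> c x)) = 0"
  by (rule closed_3form_iff[where \<gamma> = \<alpha> and e = \<beta> and s = 1, OF assms
        tensorialD(1)[OF tensorial_alpha assms(1)] alpha_cross[OF assms(1)] differentiable_beta]) auto

text \<open>The inverse of J is injective on forms, so d^c\<alpha> = 0 means that J\<alpha> is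
  closed, and J\<alpha> is \<omega> \<and> \<eta> up to sign.\<close>

lemma d_c_alpha_iff:
  assumes "c \<in> A" "x \<in> chart_range c"
  shows "(\<forall>vs. d_c J \<alpha> c x vs = 0) \<longleftrightarrow> pf_pair (coef2 (\<Omega> c x)) (coef2 (ext_d \<eta> c x)) = 0"
proof -
  have alt: "alternating_form 3 (J_op J \<alpha> c y)" if "y \<in> chart_range c" for y
    using tensorialD(1)[OF tensorial_J_twist[OF tensorial_alpha] assms(1) that]
    by (simp add: J_op_def[abs_def] J_act_eq[abs_def] J_twist_def[abs_def])
  have dc: "d_c J \<alpha> c x vs = (-1) ^ length vs * ext_d (J_op J \<alpha>) c x (map (J c x) vs)" for vs
    by (simp add: d_c_def J_inv_op_def J_inv_act_eq)
  have "(\<forall>vs. d_c J \<alpha> c x vs = 0) \<longleftrightarrow> (\<forall>vs. ext_d (J_op J \<alpha>) c x vs = 0)"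
  proof
    assume h: "\<forall>vs. d_c J \<alpha> c x vs = 0"
    show "\<forall>vs. ext_d (J_op J \<alpha>) c x vs = 0"
    proof
      fix vs
      have "map (J c x) (map (\<lambda>v. - J c x v) vs) = vs"
        using linear_neg[OF hermitian_space.lin_j[OF hermitian[OF assms]]] hermitian_space.jj[OF hermitian[OF assms]]
        by (simp add: o_def)
      then show "ext_d (J_op J \<alpha>) c x vs = 0"
        using h[rule_format, of "map (\<lambda>v. - J c x v) vs"] by (simp only: dc) simp
    qed
  qed (simp add: dc)
  also have "\<dots> \<longleftrightarrow> pf_pair (coef2 (\<Omega> c x)) (coef2 (ext_d \<eta> c x)) = 0"
    by (rule closed_3form_iff[where \<gamma> = "J_op J \<alpha>" and e = \<eta> and s = "- 1", OF assms
          alt J_alpha_cross[OF assms(1)] differentiable_eta]) auto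
  finally show ?thesis .
qed

lemma ext_d_beta_alternating: "c \<in> A \<Longrightarrow> x \<in> chart_range c \<Longrightarrow> alternating_form 2 (ext_d \<beta> c x)"
  by (rule alternating_ext_d[OF tensorial_beta differentiable_beta])

definition J_d_beta :: "('a, 4, complex) form" where
  "J_d_beta = J_twist (ext_d \<beta>)"

lemma tensorial_J_d_beta: "tensorial A 2 J_d_beta"
  unfolding J_d_beta_def by (rule tensorial_J_twist[OF tensorial_ext_d[OF tensorial_beta differentiable_beta]])

lemma differentiable_J_d_beta: "differentiable_form A 1 J_d_beta"
  unfolding J_d_beta_def
  by (rule differentiable_J_twist_2[OF tensorial_ext_d[OF tensorial_beta differentiable_beta]
        differentiable_ext_d[OF tensorial_beta differentiable_beta]])

text \<open>J\<eta> = \<beta> leaves the inverse of J applied to d\<beta>. On two-forms J is its own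
  inverse, which appears here as the sign (-1)^2.\<close>

lemma d_c_star_alpha:
  assumes "c \<in> A" "x \<in> chart_range c"
  shows "d_c J (star J \<omega> \<alpha>) c x vs = J_d_beta c x vs"
proof -
  have "J_op J (star J \<omega> \<alpha>) c y us = \<beta> c y us" if "y \<in> chart_range c" for y us
    by (simp add: J_op_def J_act_eq star_alpha[OF assms(1) that] J_twist_eta[OF assms(1) that])
  then have "ext_d (J_op J (star J \<omega> \<alpha>)) c x us = ext_d \<beta> c x us" for us
    by (rule ext_d_cong[OF open_range[OF assms(1)] assms(2)])
  then have "d_c J (star J \<omega> \<alpha>) c x vs = (-1) ^ length vs * J_d_beta c x vs"
    by (simp add: d_c_def J_inv_op_def J_inv_act_eq J_d_beta_def J_twist_def)
  moreover have "J_d_beta c x vs = 0" if "length vs \<noteq> 2"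
    using tensorialD(1)[OF tensorial_J_d_beta assms] that unfolding alternating_form_def by blast
  ultimately show ?thesis by (cases "length vs = 2") simp_all
qed

lemma star_adjoint_d_c:
  assumes "c \<in> A" "x \<in> chart_range c"
  shows "star_adjoint J \<omega> (\<lambda>\<beta>. ext_d (d_c J \<beta>)) \<alpha> c x vs =
    - hodge (metric (\<omega> c x) (J c x)) (\<omega> c x) (ext_d J_d_beta c x) vs"
proof -
  have "ext_d (d_c J (star J \<omega> \<alpha>)) c x us = ext_d J_d_beta c x us" for us
    by (rule ext_d_cong[OF open_range[OF assms(1)] assms(2)]) (rule d_c_star_alpha[OF assms(1)])
  then have "ext_d (d_c J (star J \<omega> \<alpha>)) c x = ext_d J_d_beta c x" by (rule ext)
  then show ?thesis by (simp add: star_adjoint_def star_def)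
qed

text \<open>For closed \<alpha> only d\<Lambda>\<alpha> remains of the commutator.\<close>

lemma d_Lambda_alpha:
  assumes "c \<in> A" "x \<in> chart_range c" "\<And>us. ext_d \<alpha> c x us = 0"
  shows "d_Lambda J \<omega> \<alpha> c x vs = - ext_d \<beta> c x vs"
proof -
  have D: "((\<lambda>y. \<beta> c y us) has_derivative frechet_derivative (\<lambda>y. \<beta> c y us) (at x)) (at x)" for us
    by (rule times_differentiable_on_1D(3)[OF differentiable_formD[OF differentiable_beta assms(1)] assms(2)])
  have "ext_d (dual_lefschetz J \<omega> \<alpha>) c x vs = ext_d (\<lambda>c x vs. - \<beta> c x vs) c x vs"
    by (rule ext_d_cong[OF open_range[OF assms(1)] assms(2)]) (rule Lambda_alpha[OF assms(1)])
  also have "\<dots> = - ext_d \<beta> c x vs"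
    by (simp add: ext_d_def frechet_derivative_eq[OF has_derivative_minus[OF D]] sum_negf)
  finally show ?thesis
    by (simp add: d_Lambda_def dual_lefschetz_def[of J \<omega> "ext_d \<alpha>"] contraction_zero assms(3))
qed

text \<open>The quotient is the formula of \<open>contraction_eq\<close> for a two-form and an empty
  list of remaining arguments.\<close>

definition Lambda_d_eta :: "('a, 4) chart \<Rightarrow> real^4 \<Rightarrow> complex" where
  "Lambda_d_eta c x = pf_pair (coef2 (\<Omega> c x)) (coef2 (ext_d \<eta> c x)) / of_real (pfw c x)"

lemma differentiable_Lambda_d_eta:
  assumes "c \<in> A"
  shows "times_differentiable_on r (chart_range c) (Lambda_d_eta c)"
  unfolding Lambda_d_eta_def[abs_def] pf_pair_def coef2_def
  by (intro times_differentiable_on_divide times_differentiable_on_add times_differentiable_on_diff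
      times_differentiable_on_mult times_differentiable_on_of_real open_range pfw_differentiable assms
      differentiable_formD[OF differentiable_Omega]
      differentiable_formD[OF differentiable_ext_d[OF tensorial_eta differentiable_eta]])
    (simp add: pfw_nonzero[OF assms])

lemma Lambda_d_eta_transition:
  assumes c: "c \<in> A" "c' \<in> A" "x \<in> overlap c c'"
  shows "Lambda_d_eta c x = Lambda_d_eta c' (transition c c' x)"
proof -
  have "x \<in> chart_range c" using c(3) by blast
  then have "pfw c x \<noteq> 0" by (rule pfw_nonzero[OF c(1)])
  then show ?thesis
    unfolding Lambda_d_eta_def pf_pair_transition[OF tensorial_Omega tensorial_ext_d[OF tensorial_eta differentiable_eta] c]
      pfw_transition[OF c] by simp
qed

text \<open>\<Lambda>\<eta> vanishes for reasons of degree, which leaves -\<Lambda>d\<eta>; being a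
  function, it lives on the empty list.\<close>

lemma d_Lambda_star_alpha:
  assumes "c \<in> A" "x \<in> chart_range c"
  shows "d_Lambda J \<omega> (star J \<omega> \<alpha>) c x vs = (if vs = [] then - Lambda_d_eta c x else 0)"
proof -
  have alt: "alternating_form 2 (ext_d \<eta> c x)"
    by (rule alternating_ext_d[OF tensorial_eta differentiable_eta assms])
  have "dual_lefschetz J \<omega> (star J \<omega> \<alpha>) c y us = 0" if "y \<in> chart_range c" for y us
    unfolding dual_lefschetz_def
    by (rule contraction_zero) (simp add: star_alpha[OF assms(1) that] \<eta>_def J_twist_def \<beta>_def)
  then have 1: "ext_d (dual_lefschetz J \<omega> (star J \<omega> \<alpha>)) c x vs = 0"
    by (intro ext_d_eq_0[OF open_range[OF assms(1)] assms(2)])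
  have "ext_d (star J \<omega> \<alpha>) c x us = ext_d \<eta> c x us" for us
    by (rule ext_d_cong[OF open_range[OF assms(1)] assms(2)]) (rule star_alpha[OF assms(1)])
  then have "ext_d (star J \<omega> \<alpha>) c x = ext_d \<eta> c x" by (rule ext)
  then have 2: "dual_lefschetz J \<omega> (ext_d (star J \<omega> \<alpha>)) c x vs =
      contraction (metric (\<omega> c x) (J c x)) (\<omega> c x) (ext_d \<eta> c x) vs"
    by (simp add: dual_lefschetz_def)
  show ?thesis
  proof (cases "vs = []")
    case True
    have "alt2 (\<lambda>i k. ext_d \<eta> c x [axis i 1, axis k 1])"
      using alt2_coef2[OF alt] by (simp add: coef2_def[abs_def])
    from hermitian_space.contraction_eq[OF hermitian[OF assms] this] show ?thesis
      unfolding d_Lambda_def 1 2 by (simp add: True Lambda_d_eta_def pfw_def coef2_Omega coef2_def[abs_def])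
  next
    case False
    have "ext_d \<eta> c x (axis i 1 # axis k 1 # vs) = 0" for i k
    proof -
      have "length (axis i 1 # axis k 1 # vs :: (real^4) list) \<noteq> 2" using False by simp
      then show ?thesis using alt unfolding alternating_form_def by blast
    qed
    then show ?thesis unfolding d_Lambda_def 1 2 by (simp add: contraction_zero False)
  qed
qed

lemma star_adjoint_d_Lambda:
  "star_adjoint J \<omega> (\<lambda>\<beta>. ext_d (d_Lambda J \<omega> \<beta>)) \<alpha> c x vs =
    - hodge (metric (\<omega> c x) (J c x)) (\<omega> c x) (ext_d (d_Lambda J \<omega> (star J \<omega> \<alpha>)) c x) vs"
  by (simp add: star_adjoint_def star_def)

lemma ext_d_d_Lambda_star_alpha:
  assumes "c \<in> A" "x \<in> chart_range c"
  shows "ext_d (d_Lambda J \<omega> (star J \<omega> \<alpha>)) c x [v] = - frechet_derivative (Lambda_d_eta c) (at x) v"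
proof -
  have "frechet_derivative (\<lambda>y. d_Lambda J \<omega> (star J \<omega> \<alpha>) c y []) (at x) = frechet_derivative (\<lambda>y. - Lambda_d_eta c y) (at x)"
    by (rule frechet_derivative_cong_open[OF open_range[OF assms(1)] assms(2)])
      (simp add: d_Lambda_star_alpha[OF assms(1)])
  also have "\<dots> = (\<lambda>v. - frechet_derivative (Lambda_d_eta c) (at x) v)"
    by (intro frechet_derivative_eq has_derivative_minus
        times_differentiable_on_1D(3)[OF differentiable_Lambda_d_eta[OF assms(1)] assms(2)])
  finally show ?thesis by (simp add: ext_d_1)
qed

section \<open>The two inclusions\<close>

lemma harmonic_d_dc_imp:
  assumes cpt: "compact_space X" and h: "\<alpha> \<in> harmonic_d_dc A J \<omega> 3"
  shows "\<alpha> \<in> harmonic_d_dLambda A J \<omega> 3"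
proof -
  have d: "ext_d \<alpha> c x vs = 0" and dc: "d_c J \<alpha> c x vs = 0"
    and ddc: "star_adjoint J \<omega> (\<lambda>\<beta>. ext_d (d_c J \<beta>)) \<alpha> c x vs = 0"
    if "c \<in> A" "x \<in> chart_range c" for c x vs
    using h that unfolding harmonic_d_dc_def form_zero_def by blast+
  have dH: "coef3 (ext_d J_d_beta c x) u v w = 0" if c: "c \<in> A" "x \<in> chart_range c" for c x u v w
  proof (rule hermitian_space.hodge_3form_eq_0[OF hermitian[OF c] alt3_ext_d[OF tensorial_J_d_beta differentiable_J_d_beta c]])
    show "hodge (metric (\<omega> c x) (J c x)) (\<omega> c x) (ext_d J_d_beta c x) [v] = 0" for v
      using ddc[OF c, of "[v]"] unfolding star_adjoint_d_c[OF c] by simp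
  qed
  \<comment> \<open>The sign is chosen against the minus in \<open>primitive_pairing\<close>, so
    that the pairing comes out nonnegative as \<open>exact_pairing_eq_0\<close> requires.\<close>
  define e where "e c x vs = - cnj (\<beta> c x vs)" for c x vs
  have blin: "bounded_linear (\<lambda>z. - cnj z)" by (rule bounded_linear_minus[OF bounded_linear_cnj])
  have e: "tensorial A 1 e"
  proof -
    have "alternating_form 1 (e c x)" if "c \<in> A" "x \<in> chart_range c" for c x
      unfolding e_def
      by (rule alternating_form_linear_comp[OF tensorialD(1)[OF tensorial_beta that] bounded_linear.linear[OF blin]])
    then show ?thesis
      using tensorialD(2)[OF tensorial_beta] unfolding tensorial_def by (simp add: e_def)
  qed
  have e1: "differentiable_form A 1 e"
    unfolding differentiable_form_def e_def
    by (intro ballI allI times_differentiable_on_bounded_linear[OF _ _ blin] open_range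
        differentiable_formD[OF differentiable_beta])
  have de: "coef2 (ext_d e c x) = (\<lambda>i k. - cnj (coef2 (ext_d \<beta> c x) i k))" if c: "c \<in> A" "x \<in> chart_range c" for c x
  proof -
    have "frechet_derivative (\<lambda>y. e c y vs) (at x) = (\<lambda>v. - cnj (frechet_derivative (\<lambda>y. \<beta> c y vs) (at x) v))" for vs
      unfolding e_def
      by (intro frechet_derivative_eq bounded_linear.has_derivative[OF blin]
          times_differentiable_on_1D(3)[OF differentiable_formD[OF differentiable_beta c(1)] c(2)])
    then show ?thesis by (simp add: fun_eq_iff coef2_def ext_d_2)
  qed
  \<comment> \<open>The second conjunct is recorded because \<open>exact_pairing_eq_0\<close> only
    yields that the pairing is zero; it is \<open>r = 0\<close> that forces d\<beta> = 0.\<close>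
  have pair: "\<exists>r\<ge>0. pf_pair (coef2 (J_d_beta c x)) (coef2 (ext_d e c x)) / of_real (pfw c x) = of_real r
      \<and> (r = 0 \<longrightarrow> coef2 (ext_d \<beta> c x) = (\<lambda>i k. 0))" if c: "c \<in> A" "x \<in> chart_range c" for c x
  proof -
    have "pf_pair (coef2 (\<Omega> c x)) (coef2 (ext_d \<beta> c x)) = 0"
      using closed_alpha_iff[OF c] d[OF c] by blast
    then have "pf_pair (\<lambda>i k. of_real (coef2 (\<omega> c x) i k)) (coef2 (ext_d \<beta> c x)) = 0"
      by (simp add: coef2_Omega)
    from hermitian_space.primitive_pairing[OF hermitian[OF c] ext_d_beta_alternating[OF c] this]
    obtain r where r: "r \<ge> 0" "pf_pair (coef2 (\<lambda>vs. ext_d \<beta> c x (map (J c x) vs))) (\<lambda>i k. cnj (coef2 (ext_d \<beta> c x) i k)) /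
        of_real (pf (coef2 (\<omega> c x))) = - of_real r" "r = 0 \<Longrightarrow> coef2 (ext_d \<beta> c x) = (\<lambda>i k. 0)"
      by blast
    have "pf_pair (coef2 (J_d_beta c x)) (coef2 (ext_d e c x)) =
        - pf_pair (coef2 (\<lambda>vs. ext_d \<beta> c x (map (J c x) vs))) (\<lambda>i k. cnj (coef2 (ext_d \<beta> c x) i k))"
      unfolding de[OF c] by (simp add: J_d_beta_def J_twist_def[abs_def] pf_pair_def)
    then have "pf_pair (coef2 (J_d_beta c x)) (coef2 (ext_d e c x)) / of_real (pfw c x) = of_real r"
      using r(2) by (simp add: pfw_def)
    with r(1,3) show ?thesis by blast
  qed
  have dbeta: "ext_d \<beta> c x vs = 0" if c: "c \<in> A" "x \<in> chart_range c" for c x vs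
  proof -
    have "pf_pair (coef2 (J_d_beta c x)) (coef2 (ext_d e c x)) = 0"
    proof (rule exact_pairing_eq_0[OF cpt tensorial_J_d_beta differentiable_J_d_beta dH e e1 _ c])
      show "\<exists>r\<ge>0. pf_pair (coef2 (J_d_beta c x)) (coef2 (ext_d e c x)) / of_real (pfw c x) = of_real r"
        if "c \<in> A" "x \<in> chart_range c" for c x
        using pair[OF that] by (elim exE conjE) (intro exI conjI)
    qed
    then have z: "coef2 (ext_d \<beta> c x) = (\<lambda>i k. 0)" using pair[OF c] by auto
    note alt = ext_d_beta_alternating[OF c]
    show ?thesis
    proof (cases "length vs = 2")
      case True
      then obtain u v where "vs = [u, v]" by (auto simp: length_Suc_conv numeral_2_eq_2)
      moreover have "ext_d \<beta> c x [axis i 1, axis k 1] = 0" for i k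
        using fun_cong[OF fun_cong[OF z, of i], of k] by (simp add: coef2_def)
      ultimately show ?thesis
        using bilinear_expand[of "\<lambda>u v. ext_d \<beta> c x [u, v]" u v, OF alternating_form_2D(1,2)[OF alt]] by simp
    next
      case False
      then show ?thesis using alt unfolding alternating_form_def by blast
    qed
  qed
  \<comment> \<open>Here d^c\<alpha> = 0 gives \<Lambda>d\<eta> = 0 outright, which is more than the
    required d(\<Lambda>d\<eta>) = 0.\<close>
  have C0: "Lambda_d_eta c x = 0" if c: "c \<in> A" "x \<in> chart_range c" for c x
    using d_c_alpha_iff[OF c] dc[OF c] by (simp add: Lambda_d_eta_def)
  have "ext_d (d_Lambda J \<omega> (star J \<omega> \<alpha>)) c x vs = 0" if c: "c \<in> A" "x \<in> chart_range c" for c x vs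
    by (rule ext_d_eq_0[OF open_range[OF c(1)] c(2)]) (simp add: d_Lambda_star_alpha[OF c(1)] C0[OF c(1)])
  then have "star_adjoint J \<omega> (\<lambda>\<beta>. ext_d (d_Lambda J \<omega> \<beta>)) \<alpha> c x vs = 0" if "c \<in> A" "x \<in> chart_range c" for c x vs
    using that by (simp add: star_adjoint_d_Lambda hodge_zero)
  moreover have "d_Lambda J \<omega> \<alpha> c x vs = 0" if c: "c \<in> A" "x \<in> chart_range c" for c x vs
    using d_Lambda_alpha[OF c d[OF c]] dbeta[OF c] by simp
  ultimately show ?thesis
    using \<alpha> d unfolding harmonic_d_dLambda_def form_zero_def by blast
qed

lemma harmonic_d_dLambda_imp:
  assumes cpt: "compact_space X" and h: "\<alpha> \<in> harmonic_d_dLambda A J \<omega> 3"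
  shows "\<alpha> \<in> harmonic_d_dc A J \<omega> 3"
proof -
  have d: "ext_d \<alpha> c x vs = 0" and dL: "d_Lambda J \<omega> \<alpha> c x vs = 0"
    and ddL: "star_adjoint J \<omega> (\<lambda>\<beta>. ext_d (d_Lambda J \<omega> \<beta>)) \<alpha> c x vs = 0"
    if "c \<in> A" "x \<in> chart_range c" for c x vs
    using h that unfolding harmonic_d_dLambda_def form_zero_def by blast+
  have dbeta: "ext_d \<beta> c x vs = 0" if c: "c \<in> A" "x \<in> chart_range c" for c x vs
    using dL[OF c, of vs] unfolding d_Lambda_alpha[OF c d[OF c]] by simp
  have DC: "frechet_derivative (Lambda_d_eta c) (at x) (axis i 1) = 0" if c: "c \<in> A" "x \<in> chart_range c" for c x i
  proof -
    have "ext_d (d_Lambda J \<omega> (star J \<omega> \<alpha>)) c x [axis i 1] = 0"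
      by (rule hermitian_space.hodge_1form_eq_0[OF hermitian[OF c]])
        (use ddL[OF c] in \<open>simp add: star_adjoint_d_Lambda\<close>)
    then show ?thesis by (simp add: ext_d_d_Lambda_star_alpha[OF c])
  qed
  define G where "G c x vs = cnj (Lambda_d_eta c x) * \<Omega> c x vs" for c x vs
  have G: "tensorial A 2 G"
  proof -
    have "alternating_form 2 (G c x)" if "c \<in> A" "x \<in> chart_range c" for c x
      unfolding G_def
      by (rule alternating_form_linear_comp[OF tensorialD(1)[OF tensorial_Omega that]
            bounded_linear.linear[OF bounded_linear_mult_right]])
    moreover have "G c x vs = G c' (transition c c' x) (map (frechet_derivative (transition c c') (at x)) vs)"
      if c: "c \<in> A" "c' \<in> A" "x \<in> overlap c c'" and l: "length vs = 2" for c c' x vs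
      unfolding G_def Lambda_d_eta_transition[OF c] tensorialD(2)[OF tensorial_Omega c l] ..
    ultimately show ?thesis unfolding tensorial_def by blast
  qed
  have cnjC: "times_differentiable_on 1 (chart_range c) (\<lambda>x. cnj (Lambda_d_eta c x))" if "c \<in> A" for c
    by (rule times_differentiable_on_bounded_linear[OF open_range[OF that] differentiable_Lambda_d_eta[OF that] bounded_linear_cnj])
  have G1: "differentiable_form A 1 G"
    unfolding differentiable_form_def G_def
    by (intro ballI allI times_differentiable_on_mult open_range cnjC differentiable_formD[OF differentiable_Omega])
  \<comment> \<open>In the product rule the derivatives of the factor vanish by \<open>DC\<close>; a
    multiple of d\<omega> = 0 remains. Local constancy is enough, so a disconnected manifold causes
    no trouble.\<close>
  have dG: "coef3 (ext_d G c x) u v w = 0" if c: "c \<in> A" "x \<in> chart_range c" for c x u v w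
  proof -
    have "frechet_derivative (\<lambda>y. cnj (Lambda_d_eta c y)) (at x) (axis i 1) = 0" for i
      using frechet_derivative_eq[OF bounded_linear.has_derivative[OF bounded_linear_cnj
            times_differentiable_on_1D(3)[OF differentiable_Lambda_d_eta[OF c(1)] c(2)]]] DC[OF c, of i] by simp
    then have "frechet_derivative (\<lambda>y. G c y vs) (at x) (axis i 1) =
        cnj (Lambda_d_eta c x) * frechet_derivative (\<lambda>y. \<Omega> c y vs) (at x) (axis i 1)" for vs i
      unfolding G_def
      by (subst frechet_derivative_eq[OF has_derivative_mult[OF times_differentiable_on_1D(3)[OF cnjC[OF c(1)] c(2)]
            times_differentiable_on_1D(3)[OF differentiable_formD[OF differentiable_Omega c(1)] c(2)]]]) simp
    then have "coef3 (ext_d G c x) u v w = cnj (Lambda_d_eta c x) * coef3 (ext_d \<Omega> c x) u v w"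
      by (simp only: coef3_def ext_d_3 right_diff_distrib distrib_left)
    then show ?thesis by (simp only: coef3_def closed_Omega[OF c] mult_zero_right)
  qed
  have pair: "pf_pair (coef2 (G c x)) (coef2 (ext_d \<eta> c x)) = cnj (Lambda_d_eta c x) * Lambda_d_eta c x * of_real (pfw c x)"
    if c: "c \<in> A" "x \<in> chart_range c" for c x
  proof -
    have "pf_pair (coef2 (G c x)) (coef2 (ext_d \<eta> c x)) = cnj (Lambda_d_eta c x) * pf_pair (coef2 (\<Omega> c x)) (coef2 (ext_d \<eta> c x))"
      by (simp add: pf_pair_def coef2_def G_def algebra_simps)
    then show ?thesis using pfw_nonzero[OF c] by (simp add: Lambda_d_eta_def)
  qed
  have C0: "Lambda_d_eta c x = 0" if c: "c \<in> A" "x \<in> chart_range c" for c x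
  proof -
    have "pf_pair (coef2 (G c x)) (coef2 (ext_d \<eta> c x)) = 0"
    proof (rule exact_pairing_eq_0[OF cpt G G1 dG tensorial_eta differentiable_eta _ c])
      fix c x assume c: "c \<in> A" "x \<in> chart_range c"
      have "pf_pair (coef2 (G c x)) (coef2 (ext_d \<eta> c x)) / of_real (pfw c x) = of_real ((cmod (Lambda_d_eta c x))\<^sup>2)"
        unfolding pair[OF c] complex_norm_square using pfw_nonzero[OF c] by (simp add: mult.commute)
      then show "\<exists>r\<ge>0. pf_pair (coef2 (G c x)) (coef2 (ext_d \<eta> c x)) / of_real (pfw c x) = of_real r"
        using zero_le_power2 by blast
    qed
    then show ?thesis using pair[OF c] pfw_nonzero[OF c] by simp
  qed
  have "d_c J \<alpha> c x vs = 0" if c: "c \<in> A" "x \<in> chart_range c" for c x vs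
    using d_c_alpha_iff[OF c] C0[OF c] pfw_nonzero[OF c] by (simp add: Lambda_d_eta_def)
  moreover have "ext_d J_d_beta c x vs = 0" if c: "c \<in> A" "x \<in> chart_range c" for c x vs
    by (rule ext_d_eq_0[OF open_range[OF c(1)] c(2)]) (simp add: J_d_beta_def J_twist_def dbeta[OF c(1)])
  then have "star_adjoint J \<omega> (\<lambda>\<beta>. ext_d (d_c J \<beta>)) \<alpha> c x vs = 0" if "c \<in> A" "x \<in> chart_range c" for c x vs
    using that by (simp add: star_adjoint_d_c hodge_zero)
  ultimately show ?thesis
    using \<alpha> d unfolding harmonic_d_dc_def form_zero_def by blast
qed

end

end

theorem theorem5p4:
  fixes X :: "'a topology" and A :: "('a, 4) chart set"
    and J :: "('a, 4) chart \<Rightarrow> real^4 \<Rightarrow> real^4 \<Rightarrow> real^4"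
    and \<omega> :: "('a, 4, real) form"
  assumes "almost_kaehler X A J \<omega>" and "compact_space X"
  shows "harmonic_d_dc A J \<omega> 3 = harmonic_d_dLambda A J \<omega> 3"
proof -
  interpret almost_kaehler_4 X A J \<omega> by unfold_locales (rule assms(1))
  have "smooth_form A 3 \<alpha>" if "\<alpha> \<in> harmonic_d_dc A J \<omega> 3 \<or> \<alpha> \<in> harmonic_d_dLambda A J \<omega> 3" for \<alpha>
    using that unfolding harmonic_d_dc_def harmonic_d_dLambda_def by blast
  then show ?thesis
    using harmonic_d_dc_imp harmonic_d_dLambda_imp assms(2) by blast
qed

end
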